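(* Let $t=2t'+1$ be an odd positive integer and let $y,z$ be complex numbers. Then $$\sum_{\lambda \in DD} \delta_{\lambda}\, x^{|\lambda|/2} \prod_{ h \in \mathcal{H}_t(\lambda)}\left( y -\frac{yt(2z+2)}{\varepsilon_h\, h}\right)= \prod_{k \geq 1} (1-x^k)(1-x^{kt})^{t'-1} \left(1-x^{kt}y^{2k}\right)^{(2z+1)(zt+3(t-1)/2)},$$ where the sum ranges over doubled distinct partitions, and $\mathcal{H}_t(\lambda)$ is the multiset of hook lengths of $\lambda$ which are integral multiples of $t$.
   Context: A partition $\lambda=(\lambda_1\ge\dots\ge\lambda_\ell>0)$ has weight $|\lambda|=\sum\lambda_i$; set $\lambda_i=0$ for $i>\ell$; the empty partition is allowed. Its boxes are the pairs $(i,j)$ (row $i$, column $j$) with $1\le i\le\ell$, $1\le j\le\lambda_i$. Ferrers diagrams are drawn in French convention (rows stacked upwards), so a box $(i,j)$ is strictly above the (principal) diagonal iff $i>j$. $\lambda^*$ is the conjugate partition. The hook length of $(i,j)$ is $\lambda_i-j+\lambda^*_j-i+1$. The Durfee length is $D(\lambda)=\#\{i:\lambda_i\ge i\}$, and $\delta_\lambda=(-1)^{D(\lambda)}$. A doubled distinct partition is a partition $\mu$ with $\mu_i=\mu_i^*+1$ for all $1\le i\le D(\mu)$ (the empty partition included). $DD$ is the set of doubled distinct partitions; they have even weight. The product over $\mathcal H_t(\lambda)$ is over all boxes of $\lambda$ whose hook length $h$ is a multiple of $t$; $\varepsilon_h=-1$ if the box with hook length $h$ is strictly above the diagonal and $\varepsilon_h=1$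 otherwise. Identities are read as identities of power series in $x$ (grouping the finitely many partitions of each weight), with $(1-u)^a=\exp\left(-a\sum_{m\ge1}u^m/m\right)$ for complex $a$. *)

theory Defs
  imports "HOL-Analysis.Analysis" "HOL-Computational_Algebra.Formal_Power_Series"
begin

text \<open>A partition is the weakly decreasing list of its (positive) parts; rows and columns are
  numbered from 1, so that the part in row \<open>i\<close> is the list entry with index \<open>i - 1\<close>.\<close>

definition is_partition :: "nat list \<Rightarrow> bool" where
  "is_partition p \<longleftrightarrow> sorted_wrt (\<ge>) p \<and> (\<forall>a\<in>set p. 0 < a)"

abbreviation weight :: "nat list \<Rightarrow> nat" where
  "weight p \<equiv> sum_list p"

definition part :: "nat list \<Rightarrow> nat \<Rightarrow> nat" where
  "part p i = (if 1 \<le> i \<and> i \<le> length p then p ! (i - 1) else 0)"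

definition conj_part :: "nat list \<Rightarrow> nat \<Rightarrow> nat" where
  "conj_part p j = card {i \<in> {1..length p}. j \<le> part p i}"

definition boxes :: "nat list \<Rightarrow> (nat \<times> nat) set" where
  "boxes p = {(i, j). 1 \<le> i \<and> i \<le> length p \<and> 1 \<le> j \<and> j \<le> part p i}"

text \<open>On boxes neither of the two subtractions truncates.\<close>

definition hook :: "nat list \<Rightarrow> nat \<times> nat \<Rightarrow> nat" where
  "hook p = (\<lambda>(i, j). (part p i - j) + (conj_part p j - i) + 1)"

definition durfee :: "nat list \<Rightarrow> nat" where
  "durfee p = card {i \<in> {1..length p}. i \<le> part p i}"

definition hook_sign :: "nat \<times> nat \<Rightarrow> int" where
  "hook_sign = (\<lambda>(i, j). if i > j then -1 else 1)"

definition boxes_mod :: "nat \<Rightarrow> nat list \<Rightarrow> (nat \<times> nat) set" where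
  "boxes_mod t p = {b \<in> boxes p. t dvd hook p b}"

definition doubled_distinct :: "nat list set" where
  "doubled_distinct =
     {p. is_partition p \<and> (\<forall>i\<in>{1..durfee p}. part p i = conj_part p i + 1)}"

text \<open>The power series \<open>(1 - u)\<^sup>a = exp (- a (u + u\<^sup>2/2 + u\<^sup>3/3 + \<dots>))\<close>; it is meaningful only
  for \<open>u\<close> with zero constant term.\<close>

definition fps_one_minus_cpow :: "complex fps \<Rightarrow> complex \<Rightarrow> complex fps" where
  "fps_one_minus_cpow u a =
     fps_exp 1 oo (- fps_const a * (Abs_fps (\<lambda>m. if m = 0 then 0 else 1 / of_nat m) oo u))"

text \<open>The coefficients of the series over doubled distinct partitions are honest finite sums.\<close>

lemma finite_partitions_weight: "finite {p. is_partition p \<and> weight p = n}"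
proof (rule finite_subset)
  have len: "length p \<le> sum_list p" if "\<forall>a\<in>set p. 0 < a" for p :: "nat list"
    using that by (induction p) auto
  show "{p. is_partition p \<and> weight p = n} \<subseteq> {p. set p \<subseteq> {..n} \<and> length p \<le> n}"
    using len by (auto simp: is_partition_def intro: member_le_sum_list)
qed (rule finite_lists_length_le, simp)

lemma finite_doubled_distinct: "finite {p \<in> doubled_distinct. weight p = n}"
  by (rule finite_subset[OF _ finite_partitions_weight[of n]]) (auto simp: doubled_distinct_def)

end

(* Put s = 2z+2. A doubled distinct partition is determined by the set M of the positive numbers
   lambda_i - i; its weight is twice the sum of M and its boxes are the pairs of an element and a smaller
   non-element of { lambda_i - i : i >= 1 }, a set that is symmetric under complementing and negating.
   Multiplying the factors of boxes exchanged by this symmetry and evaluating Cauchy determinants, one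
   finds that for y = 1 the product over the hooks is a principal minor, with index set M, of an infinite
   matrix W(s). The signed sum is therefore the Fredholm determinant of 1 - x^m W(s). By Jacobi's
   formula its logarithmic derivative in s is a trace; the behaviour of the entries under shifts by
   multiples of t shows that it is linear in s. At s = 0 the matrix is the identity. This gives
   prod (1-x^k) (1-x^(tk))^((t s^2 - 3 s)/2).
   Next, M splits into a t-core and a set that is balanced modulo t, on which alone the product depends;
   so the sum is the series of the cores times that of the balanced sets. For s = 1 a nonempty balanced
   set has weight 0, which identifies the series of the cores, and division yields the other factor. Finally
   a balanced set of sum n has 2n/t hooks divisible by t, so general y amounts to rescaling x. *)

theory Submission
  imports Defs
begin

text \<open>The columns of W come from a function space: (1 - q^t)^(-s) times the symmetric Laurent
  polynomials whose part in exponents divisible by t vanishes at q = 1. The entries are the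
  coefficients, at positive exponents, of the basis normalised by principal parts. Multiplication by
  q^K + q^(-K), t | K, preserves the space, and the s-derivative multiplies (1 - q^t)^(-s) by the
  sum of q^(tk)/k; hence the shifts by multiples of t. No closed form of the resolvent is used. Its
  trace against the shift by K = t k is evaluated twice, directly and by the multiplication rule; in
  the difference everything unknown cancels. What is left is x^(K/2), for even K, and a finite trace
  of W equal to t s - 2 or t s - 1. Weighted with 1/k these give t s - 3/2 times a logarithm. Two
  obstacles shape the rest. The Cauchy form requires t s to be no integer; the minors at other s
  follow by continuity. Moving residue classes preserves hook lengths but not the signs, so hooks
  are paired with their reflections before products are compared.\<close>

unbundle no vec_syntax
unbundle fps_syntax

section \<open>Determinants over finite index sets\<close>

text \<open>The Leibniz formula over an arbitrary index set: the expansion into principal minors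
  sums over subsets of the indices, which a matrix type of fixed dimension cannot index.
  Permutations of a subset are also permutations of the larger set, so nested determinants compare
  directly.\<close>

definition set_det :: "'i set \<Rightarrow> ('i \<Rightarrow> 'i \<Rightarrow> 'a::comm_ring_1) \<Rightarrow> 'a" where
  "set_det M A = (\<Sum>p | p permutes M. of_int (sign p) * (\<Prod>i\<in>M. A i (p i)))"

lemma set_det_cong:
  assumes "\<And>i j. i \<in> M \<Longrightarrow> j \<in> M \<Longrightarrow> A i j = B i j"
  shows "set_det M A = set_det M B"
  unfolding set_det_def
proof (intro sum.cong refl)
  fix p assume "p \<in> {p. p permutes M}"
  then have "\<And>i. i \<in> M \<Longrightarrow> p i \<in> M" by (simp add: permutes_in_image)
  then show "of_int (sign p) * (\<Prod>i\<in>M. A i (p i)) = of_int (sign p) * (\<Prod>i\<in>M. B i (p i))"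
    by (simp add: assms)
qed

lemma set_det_empty [simp]: "set_det {} A = 1"
  by (simp add: set_det_def)

section \<open>Row operations and elimination\<close>

lemma set_det_fun_upd:
  assumes "finite M" "i \<in> M"
  shows "set_det M (A(i := v)) =
    (\<Sum>p | p permutes M. of_int (sign p) * (v (p i) * (\<Prod>r\<in>M - {i}. A r (p r))))"
  unfolding set_det_def
proof (intro sum.cong refl)
  fix p
  have "(\<Prod>r\<in>M. (A(i := v)) r (p r)) = v (p i) * (\<Prod>r\<in>M - {i}. (A(i := v)) r (p r))"
    using assms by (subst prod.remove[of M i]) auto
  also have "(\<Prod>r\<in>M - {i}. (A(i := v)) r (p r)) = (\<Prod>r\<in>M - {i}. A r (p r))"
    by (rule prod.cong) auto
  finally show "of_int (sign p) * (\<Prod>r\<in>M. (A(i := v)) r (p r)) =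
      of_int (sign p) * (v (p i) * (\<Prod>r\<in>M - {i}. A r (p r)))" by simp
qed

lemma set_det_row_sum:
  assumes "finite M" "i \<in> M"
  shows "set_det M (A(i := \<lambda>j. \<Sum>k\<in>K. c k * v k j)) = (\<Sum>k\<in>K. c k * set_det M (A(i := v k)))"
proof -
  have "set_det M (A(i := \<lambda>j. \<Sum>k\<in>K. c k * v k j)) =
     (\<Sum>p | p permutes M. \<Sum>k\<in>K. c k * (of_int (sign p) * (v k (p i) * (\<Prod>r\<in>M - {i}. A r (p r)))))"
    by (simp add: set_det_fun_upd[OF assms] sum_distrib_left sum_distrib_right mult_ac)
  also have "\<dots> = (\<Sum>k\<in>K. c k * set_det M (A(i := v k)))"
    by (subst sum.swap) (simp add: set_det_fun_upd[OF assms] sum_distrib_left)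
  finally show ?thesis .
qed

lemma set_det_row_diff:
  assumes "finite M" "i \<in> M"
  shows "set_det M (A(i := \<lambda>j. u j - c * v j)) = set_det M (A(i := u)) - c * set_det M (A(i := v))"
  by (simp add: set_det_fun_upd[OF assms] algebra_simps sum_subtractf sum_distrib_left)

text \<open>Composing with the transposition of i and j flips the sign of each permutation and keeps
  its product, so the determinant equals its own negative; characteristic 0 finishes.\<close>

lemma set_det_identical_rows:
  fixes A :: "'i \<Rightarrow> 'i \<Rightarrow> 'a::{idom, semiring_char_0}"
  assumes "finite M" "i \<in> M" "j \<in> M" "i \<noteq> j" "A i = A j"
  shows "set_det M A = 0"
proof -
  let ?t = "Transposition.transpose i j"
  have t: "?t permutes M" using assms by (simp add: permutes_swap_id)
  have "set_det M A = (\<Sum>p | p permutes M. of_int (sign (p \<circ> ?t)) * (\<Prod>r\<in>M. A r ((p \<circ> ?t) r)))"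
    unfolding set_det_def by (rule sum_permutations_compose_right[OF t])
  also have "\<dots> = (\<Sum>p | p permutes M. - (of_int (sign p) * (\<Prod>r\<in>M. A r (p r))))"
  proof (intro sum.cong refl)
    fix p assume "p \<in> {p. p permutes M}"
    then have p: "permutation p" using assms(1) permutation_permutes by blast
    have "sign (p \<circ> ?t) = - sign p"
      using p assms(4) by (simp add: sign_compose permutation_swap_id sign_swap_id)
    moreover have "(\<Prod>r\<in>M. A r ((p \<circ> ?t) r)) = (\<Prod>r\<in>M. A r (p r))"
    proof -
      have "(\<Prod>r\<in>M. A r (p r)) = (\<Prod>r\<in>M. A (?t r) (p (?t r)))"
        using prod.permute[OF t, of "\<lambda>r. A r (p r)"] by (simp add: o_def)
      also have "\<dots> = (\<Prod>r\<in>M. A r ((p \<circ> ?t) r))"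
        using assms(5) by (intro prod.cong refl) (auto simp: Transposition.transpose_def)
      finally show ?thesis by simp
    qed
    ultimately show "of_int (sign (p \<circ> ?t)) * (\<Prod>r\<in>M. A r ((p \<circ> ?t) r)) =
        - (of_int (sign p) * (\<Prod>r\<in>M. A r (p r)))" by simp
  qed
  also have "\<dots> = - set_det M A" by (simp add: set_det_def sum_negf)
  finally have "2 * set_det M A = 0" by simp
  then show ?thesis by simp
qed

text \<open>The pivot row e lies outside \<open>S\<close> and is never altered, so the rows can be
  changed one at a time; each change only adds a determinant with two equal rows.\<close>

lemma set_det_row_ops:
  fixes A :: "'i \<Rightarrow> 'i \<Rightarrow> 'a::{idom, semiring_char_0}"
  assumes "finite M" "e \<notin> M" "finite S" "S \<subseteq> M"
  shows "set_det (insert e M) (\<lambda>i j. if i \<in> S then A i j - c i * A e j else A i j) = set_det (insert e M) A"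
  using assms(3,4)
proof (induction S rule: finite_induct)
  case (insert s S)
  let ?B = "\<lambda>i j. if i \<in> S then A i j - c i * A e j else A i j"
  have e: "e \<notin> S" "s \<noteq> e" "e \<noteq> s" using insert assms(2) by auto
  have "(\<lambda>i j. if i \<in> insert s S then A i j - c i * A e j else A i j) =
      ?B(s := \<lambda>j. A s j - c s * A e j)" by (auto simp: fun_eq_iff)
  then have "set_det (insert e M) (\<lambda>i j. if i \<in> insert s S then A i j - c i * A e j else A i j) =
     set_det (insert e M) (?B(s := A s)) - c s * set_det (insert e M) (?B(s := A e))"
    using set_det_row_diff[of "insert e M" s ?B "A s" "c s" "A e"] insert assms(1) by simp
  also have "set_det (insert e M) (?B(s := A e)) = 0"
    by (rule set_det_identical_rows[of _ s e]) (use insert assms(1) e in auto)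
  also have "?B(s := A s) = ?B" using insert(2) by (auto simp: fun_eq_iff)
  finally show ?case using insert by simp
qed simp

text \<open>A permutation that moves e sends some i in M to e and meets a zero of column e; those
  that fix e are exactly the permutations of M.\<close>

lemma set_det_zero_column:
  assumes "finite M" "e \<notin> M" "\<And>i. i \<in> M \<Longrightarrow> A i e = 0"
  shows "set_det (insert e M) A = A e e * set_det M A"
proof -
  let ?f = "\<lambda>p. of_int (sign p) * (\<Prod>i\<in>insert e M. A i (p i))"
  have "set_det (insert e M) A = sum ?f {p. p permutes M}"
    unfolding set_det_def
  proof (rule sum.mono_neutral_right)
    show "finite {p. p permutes insert e M}" using assms(1) by (simp add: finite_permutations)
    show "{p. p permutes M} \<subseteq> {p. p permutes insert e M}"
      using permutes_subset by blast
    show "\<forall>p\<in>{p. p permutes insert e M} - {p. p permutes M}. ?f p = 0"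
    proof
      fix p assume p: "p \<in> {p. p permutes insert e M} - {p. p permutes M}"
      have "p e \<noteq> e"
      proof
        assume "p e = e"
        then have "p permutes M" using p permutes_superset[of p "insert e M" M] by auto
        then show False using p by simp
      qed
      moreover obtain i where i: "i \<in> insert e M" "p i = e"
        using p by (metis DiffD1 insertI1 mem_Collect_eq permutes_def permutes_not_in)
      ultimately have "i \<in> M" by auto
      then have "A i (p i) = 0" using assms(3) i by simp
      then have "(\<Prod>i\<in>insert e M. A i (p i)) = 0"
        using assms(1) \<open>i \<in> M\<close> by (intro prod_zero) auto
      then show "?f p = 0" by simp
    qed
  qed
  also have "\<dots> = (\<Sum>p | p permutes M. A e e * (of_int (sign p) * (\<Prod>i\<in>M. A i (p i))))"
    using assms(1,2) by (intro sum.cong refl) (auto simp: permutes_not_in)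
  finally show ?thesis by (simp add: set_det_def sum_distrib_left)
qed

lemma set_det_schur:
  fixes A :: "'i \<Rightarrow> 'i \<Rightarrow> 'a::field_char_0"
  assumes "finite M" "e \<notin> M" "A e e \<noteq> 0"
  shows "set_det (insert e M) A = A e e * set_det M (\<lambda>i j. A i j - A i e / A e e * A e j)"
proof -
  let ?B = "\<lambda>i j. if i \<in> M then A i j - A i e / A e e * A e j else A i j"
  have "set_det (insert e M) A = set_det (insert e M) ?B"
    using set_det_row_ops[OF assms(1,2,1) order_refl, of A "\<lambda>i. A i e / A e e"] by simp
  also have "\<dots> = A e e * set_det M ?B"
    using set_det_zero_column[OF assms(1,2), of ?B] assms(2,3) by simp
  also have "set_det M ?B = set_det M (\<lambda>i j. A i j - A i e / A e e * A e j)"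
    by (rule set_det_cong) auto
  finally show ?thesis .
qed

lemma set_det_scale:
  assumes "finite M"
  shows "set_det M (\<lambda>i j. \<rho> i * \<sigma> j * A i j) = (\<Prod>i\<in>M. \<rho> i * \<sigma> i) * set_det M A"
proof -
  have "(\<Prod>i\<in>M. \<rho> i * \<sigma> (p i) * A i (p i)) = (\<Prod>i\<in>M. \<rho> i * \<sigma> i) * (\<Prod>i\<in>M. A i (p i))"
    if "p permutes M" for p
    using prod.permute[OF that, of \<sigma>] by (simp add: prod.distrib o_def)
  then show ?thesis
    by (auto simp: set_det_def sum_distrib_left mult_ac intro!: sum.cong)
qed

text \<open>The hypothesis says that eliminating any index rescales rows and columns; Cauchy matrices
  have this property.\<close>

lemma set_det_elimination_product:
  fixes A :: "'i::linorder \<Rightarrow> 'i \<Rightarrow> 'a::field_char_0"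
  assumes "finite M" "\<And>i. i \<in> M \<Longrightarrow> A i i \<noteq> 0"
    and "\<And>e i j. e \<in> M \<Longrightarrow> i \<in> M \<Longrightarrow> j \<in> M \<Longrightarrow> A i j - A i e / A e e * A e j = \<rho> e i * \<sigma> e j * A i j"
  shows "set_det M A = (\<Prod>m\<in>M. A m m * (\<Prod>k | k \<in> M \<and> k < m. 1 - A k m * A m k / (A k k * A m m)))"
  using assms
proof (induction M rule: finite_linorder_max_induct)
  case (insert e M)
  let ?f = "\<lambda>m k. 1 - A k m * A m k / (A k k * A m m)"
  have e: "e \<notin> M" using insert by auto
  have "set_det (insert e M) A = A e e * set_det M (\<lambda>i j. A i j - A i e / A e e * A e j)"
    using insert e by (intro set_det_schur) auto
  also have "set_det M (\<lambda>i j. A i j - A i e / A e e * A e j) = set_det M (\<lambda>i j. \<rho> e i * \<sigma> e j * A i j)"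
    using insert.prems by (intro set_det_cong) auto
  also have "\<dots> = (\<Prod>i\<in>M. \<rho> e i * \<sigma> e i) * set_det M A"
    by (rule set_det_scale) (use insert in auto)
  \<comment> \<open>The hypothesis taken at i = j = k expresses the scaling factors through A
    alone.\<close>
  also have "(\<Prod>i\<in>M. \<rho> e i * \<sigma> e i) = (\<Prod>k\<in>M. ?f e k)"
  proof (intro prod.cong refl)
    fix k assume "k \<in> M"
    then have "A k k - A k e / A e e * A e k = \<rho> e k * \<sigma> e k * A k k" "A k k \<noteq> 0" "A e e \<noteq> 0"
      using insert.prems by auto
    then have "\<rho> e k * \<sigma> e k = (A k k - A k e / A e e * A e k) / A k k" by simp
    also have "\<dots> = ?f e k" using \<open>A k k \<noteq> 0\<close> by (simp add: diff_divide_distrib)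
    finally show "\<rho> e k * \<sigma> e k = ?f e k" .
  qed
  also have "set_det M A = (\<Prod>m\<in>M. A m m * (\<Prod>k | k \<in> M \<and> k < m. ?f m k))"
    using insert by auto
  also have "\<dots> = (\<Prod>m\<in>M. A m m * (\<Prod>k | k \<in> insert e M \<and> k < m. ?f m k))"
    using insert(2) by (intro prod.cong refl arg_cong2[where f="(*)"]) (auto simp: not_less_iff_gr_or_eq)
  also have "(\<Prod>k\<in>M. ?f e k) = (\<Prod>k | k \<in> insert e M \<and> k < e. ?f e k)"
    using insert(2) by (intro prod.cong) auto
  finally show ?case using insert(1) e by (simp add: mult_ac)
qed simp

section \<open>Principal minors and Jacobi's formula\<close>

text \<open>Expanding each row as an identity row plus a row of -B selects the set M of rows that
  take -B; the identity rows force the permutation to fix N - M, and the minor on M remains.\<close>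

lemma set_det_one_minus:
  assumes "finite N"
  shows "set_det N (\<lambda>i j. (if i = j then 1 else 0) - B i j) = (\<Sum>M\<in>Pow N. (-1) ^ card M * set_det M B)"
proof -
  let ?d = "\<lambda>i j. if i = j then 1 else 0 :: 'b"
  have exp: "(\<Prod>i\<in>N. ?d i (p i) - B i (p i)) =
      (\<Sum>M\<in>Pow N. (-1) ^ card M * (\<Prod>i\<in>M. B i (p i)) * (\<Prod>i\<in>N - M. ?d i (p i)))" for p
  proof -
    have "(\<Prod>i\<in>N. ?d i (p i) - B i (p i)) = (\<Prod>i\<in>N. - B i (p i) + ?d i (p i))" by simp
    also have "\<dots> = (\<Sum>M\<in>Pow N. (\<Prod>i\<in>M. - B i (p i)) * (\<Prod>i\<in>N - M. ?d i (p i)))"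
      by (rule prod_add[OF assms])
    finally show ?thesis by (simp add: prod_uminus)
  qed
  have "set_det N (\<lambda>i j. ?d i j - B i j) = (\<Sum>M\<in>Pow N. (-1) ^ card M *
      (\<Sum>p | p permutes N. of_int (sign p) * (\<Prod>i\<in>M. B i (p i)) * (\<Prod>i\<in>N - M. ?d i (p i))))"
    unfolding set_det_def exp
    by (simp add: sum_distrib_left sum_distrib_right mult_ac) (subst sum.swap, simp)
  also have "\<dots> = (\<Sum>M\<in>Pow N. (-1) ^ card M * set_det M B)"
  proof (intro sum.cong refl arg_cong2[where f="(*)"])
    fix M assume M: "M \<in> Pow N"
    let ?f = "\<lambda>p. of_int (sign p) * (\<Prod>i\<in>M. B i (p i)) * (\<Prod>i\<in>N - M. ?d i (p i))"
    have "sum ?f {p. p permutes N} = sum ?f {p. p permutes M}"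
    proof (rule sum.mono_neutral_right)
      show "finite {p. p permutes N}" using assms by (simp add: finite_permutations)
      show "{p. p permutes M} \<subseteq> {p. p permutes N}" using permutes_subset M by blast
      show "\<forall>p\<in>{p. p permutes N} - {p. p permutes M}. ?f p = 0"
      proof
        fix p assume p: "p \<in> {p. p permutes N} - {p. p permutes M}"
        then obtain i where "i \<in> N - M" "p i \<noteq> i"
          using permutes_superset[of p N M] by auto
        then have "(\<Prod>i\<in>N - M. ?d i (p i)) = 0"
          using assms by (intro prod_zero bexI[of _ i]) auto
        then show "?f p = 0" by simp
      qed
    qed
    also have "\<dots> = set_det M B"
      unfolding set_det_def by (intro sum.cong refl) (auto simp: permutes_not_in intro!: prod.neutral)
    finally show "sum ?f {p. p permutes N} = set_det M B" .
  qed
  finally show ?thesis .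
qed

lemma set_det_row_dvd:
  assumes "finite M" "i \<in> M" "\<And>j. j \<in> M \<Longrightarrow> d dvd u j"
  shows "d dvd set_det M (A(i := u))"
  unfolding set_det_fun_upd[OF assms(1,2)]
  by (intro dvd_sum dvd_mult dvd_mult2 assms(3)) (use assms in \<open>auto simp: permutes_in_image\<close>)

text \<open>Since R B = 1 modulo d, also B' = (B' R) B modulo d: row i of B' is a combination of
  rows of B, and only the coefficient of row i itself survives, because the other terms repeat a
  row. An inverse modulo d is all that is required, and a truncated geometric series provides
  one.\<close>

lemma jacobi_formula_dvd:
  fixes B B' R :: "'i \<Rightarrow> 'i \<Rightarrow> 'a::{idom, semiring_char_0}"
  assumes fin: "finite M"
    and inv: "\<And>i j. i \<in> M \<Longrightarrow> j \<in> M \<Longrightarrow> d dvd (\<Sum>k\<in>M. R i k * B k j) - (if i = j then 1 else 0)"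
  shows "d dvd (\<Sum>i\<in>M. set_det M (B(i := B' i))) - (\<Sum>i\<in>M. \<Sum>j\<in>M. B' i j * R j i) * set_det M B"
proof -
  have "d dvd set_det M (B(i := B' i)) - (\<Sum>j\<in>M. B' i j * R j i) * set_det M B" if i: "i \<in> M" for i
  proof -
    let ?c = "\<lambda>l. \<Sum>k\<in>M. B' i k * R k l"
    let ?v = "\<lambda>j. \<Sum>l\<in>M. ?c l * B l j"
    have "set_det M (B(i := ?v)) = (\<Sum>l\<in>M. ?c l * set_det M (B(i := B l)))"
      by (rule set_det_row_sum[OF fin i])
    also have "\<dots> = (\<Sum>l\<in>M. if l = i then ?c l * set_det M B else 0)"
    proof (intro sum.cong refl)
      fix l assume "l \<in> M"
      then show "?c l * set_det M (B(i := B l)) = (if l = i then ?c l * set_det M B else 0)"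
        using set_det_identical_rows[OF fin i \<open>l \<in> M\<close>, of "B(i := B l)"] by auto
    qed
    also have "\<dots> = ?c i * set_det M B" using i fin by simp
    finally have v: "set_det M (B(i := ?v)) = ?c i * set_det M B" .
    have "d dvd set_det M (B(i := \<lambda>j. B' i j - 1 * ?v j))"
    proof (rule set_det_row_dvd[OF fin i])
      fix j assume j: "j \<in> M"
      have "?v j = (\<Sum>k\<in>M. B' i k * (\<Sum>l\<in>M. R k l * B l j))"
        by (simp add: sum_distrib_left sum_distrib_right mult.assoc) (rule sum.swap)
      moreover have "B' i j = (\<Sum>k\<in>M. B' i k * (if k = j then 1 else 0))"
        using fin j by (simp add: if_distrib cong: if_cong)
      ultimately have "B' i j - 1 * ?v j =
          - (\<Sum>k\<in>M. B' i k * ((\<Sum>l\<in>M. R k l * B l j) - (if k = j then 1 else 0)))"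
        by (simp only: right_diff_distrib sum_subtractf) simp
      then show "d dvd B' i j - 1 * ?v j"
        using inv j by (auto intro!: dvd_sum)
    qed
    then show ?thesis unfolding set_det_row_diff[OF fin i] v by simp
  qed
  then have "d dvd (\<Sum>i\<in>M. set_det M (B(i := B' i)) - (\<Sum>j\<in>M. B' i j * R j i) * set_det M B)"
    by (intro dvd_sum) auto
  then show ?thesis by (simp add: sum_subtractf sum_distrib_right)
qed

section \<open>Complex powers of power series\<close>

text \<open>The series of -log (1 - X).\<close>

definition neg_log :: "complex fps" where
  "neg_log = Abs_fps (\<lambda>m. if m = 0 then 0 else 1 / of_nat m)"

lemma neg_log_0 [simp]: "neg_log $ 0 = 0"
  by (simp add: neg_log_def)

lemma fps_deriv_neg_log: "fps_deriv neg_log * (1 - fps_X) = 1"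
proof -
  have "fps_deriv neg_log = Abs_fps (\<lambda>_. 1)"
    by (rule fps_ext) (simp add: neg_log_def field_simps del: of_nat_Suc)
  then show ?thesis
    by (intro fps_ext) (simp add: right_diff_distrib)
qed

text \<open>Absorbing the factor -a into the exponential leaves a only in
  \<open>fps_exp (- a)\<close>, so that exponent laws and derivatives in a reduce to those of the
  exponential series.\<close>

lemma fps_one_minus_cpow_exp:
  assumes "u $ 0 = 0"
  shows "fps_one_minus_cpow u a = fps_exp (- a) oo (neg_log oo u)"
proof -
  have "- fps_const a * (neg_log oo u) = (fps_const (- a) * fps_X) oo (neg_log oo u)"
    using assms by (simp add: fps_compose_mult_distrib)
  then have "fps_one_minus_cpow u a = fps_exp 1 oo ((fps_const (- a) * fps_X) oo (neg_log oo u))"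
    by (simp add: fps_one_minus_cpow_def neg_log_def)
  also have "\<dots> = (fps_exp 1 oo (fps_const (- a) * fps_X)) oo (neg_log oo u)"
    by (rule fps_compose_assoc) auto
  finally show ?thesis by simp
qed

lemma fps_one_minus_cpow_add:
  assumes "u $ 0 = 0"
  shows "fps_one_minus_cpow u (a + b) = fps_one_minus_cpow u a * fps_one_minus_cpow u b"
proof -
  have "fps_exp (- (a + b)) = fps_exp (- a) * fps_exp (- b)"
    by (metis fps_exp_add_mult minus_add_distrib)
  then show ?thesis
    using assms by (simp add: fps_one_minus_cpow_exp fps_compose_mult_distrib)
qed

lemma fps_one_minus_cpow_0 [simp]: "u $ 0 = 0 \<Longrightarrow> fps_one_minus_cpow u 0 = 1"
  by (simp add: fps_one_minus_cpow_exp)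

lemma fps_one_minus_cpow_compose:
  assumes "u $ 0 = 0" "v $ 0 = 0"
  shows "fps_one_minus_cpow u a oo v = fps_one_minus_cpow (u oo v) a"
  using assms by (simp add: fps_one_minus_cpow_exp fps_compose_assoc)

lemma fps_one_minus_cpow_nth_0 [simp]: "u $ 0 = 0 \<Longrightarrow> fps_one_minus_cpow u a $ 0 = 1"
  by (simp add: fps_one_minus_cpow_exp)

text \<open>The coefficient of X^n in (1 - X)^(-a), that is the binomial coefficient of a + n - 1
  over n; see \<open>fps_one_minus_cpow_X\<close>.\<close>

definition rising :: "complex \<Rightarrow> nat \<Rightarrow> complex" where
  "rising a n = pochhammer a n / fact n"

lemma rising_0 [simp]: "rising a 0 = 1"
  by (simp add: rising_def)

lemma rising_Suc: "rising a (Suc n) = rising a n * (a + of_nat n) / of_nat (Suc n)"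
  by (simp add: rising_def pochhammer_rec' field_simps)

lemma rising_rec: "of_nat (Suc n) * rising a (Suc n) = (a + of_nat n) * rising a n"
  by (simp add: rising_Suc del: of_nat_Suc)

text \<open>The power P satisfies (1 - X) P' = a P and has constant term 1; comparing coefficients
  gives the recurrence of \<open>rising\<close>.\<close>

lemma fps_one_minus_cpow_X: "fps_one_minus_cpow fps_X (- a) = Abs_fps (rising a)"
proof (rule fps_ext)
  let ?P = "fps_one_minus_cpow fps_X (- a)"
  have "fps_deriv ?P = fps_const a * ?P * fps_deriv neg_log"
    by (simp add: fps_one_minus_cpow_exp fps_compose_deriv fps_compose_mult_distrib)
  then have "fps_deriv ?P * (1 - fps_X) = fps_const a * ?P * (fps_deriv neg_log * (1 - fps_X))"
    by (simp only: mult.assoc)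
  then have ode: "fps_deriv ?P * (1 - fps_X) = fps_const a * ?P"
    by (simp only: fps_deriv_neg_log) simp
  have rec: "of_nat (Suc n) * ?P $ Suc n = (a + of_nat n) * ?P $ n" for n
  proof -
    have "(fps_deriv ?P * (1 - fps_X)) $ n = a * ?P $ n" by (simp add: ode)
    then show ?thesis
      by (cases n) (simp_all add: right_diff_distrib algebra_simps)
  qed
  show "?P $ n = Abs_fps (rising a) $ n" for n
  proof (induction n)
    case (Suc n)
    then show ?case using rec[of n] by (simp add: rising_Suc field_simps del: of_nat_Suc)
  qed simp
qed

section \<open>Coefficientwise differentiation in a parameter\<close>

definition has_coeff_deriv :: "(complex \<Rightarrow> complex fps) \<Rightarrow> complex fps \<Rightarrow> complex \<Rightarrow> bool" where
  "has_coeff_deriv F D s \<longleftrightarrow> (\<forall>n. ((\<lambda>s. F s $ n) has_field_derivative D $ n) (at s))"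

lemma has_coeff_deriv_const: "has_coeff_deriv (\<lambda>s. c) 0 s"
  by (simp add: has_coeff_deriv_def)

lemma has_coeff_deriv_sum:
  assumes "\<And>i. i \<in> I \<Longrightarrow> has_coeff_deriv (F i) (D i) s"
  shows "has_coeff_deriv (\<lambda>s. \<Sum>i\<in>I. F i s) (\<Sum>i\<in>I. D i) s"
  using assms unfolding has_coeff_deriv_def by (auto simp: fps_sum_nth intro!: DERIV_sum)

lemma has_coeff_deriv_mult:
  assumes "has_coeff_deriv F D s" "has_coeff_deriv G E s"
  shows "has_coeff_deriv (\<lambda>s. F s * G s) (D * G s + F s * E) s"
  unfolding has_coeff_deriv_def
proof
  fix n
  have "((\<lambda>s. \<Sum>i=0..n. F s $ i * G s $ (n - i)) has_field_derivative
     (\<Sum>i=0..n. F s $ i * E $ (n - i) + D $ i * G s $ (n - i))) (at s)"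
    using assms unfolding has_coeff_deriv_def by (intro DERIV_sum DERIV_mult') auto
  then show "((\<lambda>s. (F s * G s) $ n) has_field_derivative (D * G s + F s * E) $ n) (at s)"
    by (simp add: fps_mult_nth sum.distrib add.commute)
qed

lemma has_coeff_deriv_prod:
  assumes "finite I" "\<And>i. i \<in> I \<Longrightarrow> has_coeff_deriv (F i) (D i) s"
  shows "has_coeff_deriv (\<lambda>s. \<Prod>i\<in>I. F i s) (\<Sum>i\<in>I. D i * (\<Prod>j\<in>I - {i}. F j s)) s"
  using assms
proof (induction I rule: finite_induct)
  case (insert a I)
  have *: "has_coeff_deriv (\<lambda>s. F a s * (\<Prod>i\<in>I. F i s))
      (D a * (\<Prod>i\<in>I. F i s) + F a s * (\<Sum>i\<in>I. D i * (\<Prod>j\<in>I - {i}. F j s))) s"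
    using insert by (intro has_coeff_deriv_mult) auto
  have "D i * (\<Prod>j\<in>insert a I - {i}. F j s) = F a s * (D i * (\<Prod>j\<in>I - {i}. F j s))"
    if "i \<in> I" for i
  proof -
    have "insert a I - {i} = insert a (I - {i})" using insert that by auto
    then show ?thesis using insert by (simp add: mult_ac)
  qed
  then have "(\<Sum>i\<in>I. D i * (\<Prod>j\<in>insert a I - {i}. F j s)) =
      F a s * (\<Sum>i\<in>I. D i * (\<Prod>j\<in>I - {i}. F j s))"
    unfolding sum_distrib_left by (intro sum.cong refl)
  moreover have "insert a I - {a} = I" using insert by auto
  ultimately show ?case using * insert by (simp del: insert_Diff_single)
qed (simp add: has_coeff_deriv_const)

lemma has_coeff_deriv_chain:
  assumes "(f has_field_derivative f') (at s)" "has_coeff_deriv F D (f s)"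
  shows "has_coeff_deriv (\<lambda>s. F (f s)) (fps_const f' * D) s"
  unfolding has_coeff_deriv_def
proof
  fix n
  have "((\<lambda>s. F s $ n) has_field_derivative D $ n) (at (f s))"
    using assms(2) by (simp add: has_coeff_deriv_def)
  from DERIV_chain2[OF this assms(1)]
  show "((\<lambda>s. F (f s) $ n) has_field_derivative (fps_const f' * D) $ n) (at s)"
    by (simp add: mult.commute)
qed

text \<open>The derivative of (1 - u)^a in a is log (1 - u) times (1 - u)^a. Each coefficient is a
  finite sum because the inner series has no constant term, so termwise differentiation
  suffices.\<close>

lemma has_coeff_deriv_cpow:
  assumes "u $ 0 = 0"
  shows "has_coeff_deriv (fps_one_minus_cpow u) (- (neg_log oo u) * fps_one_minus_cpow u a) a"
  unfolding has_coeff_deriv_def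
proof
  fix n
  let ?V = "neg_log oo u"
  have V: "?V $ 0 = 0" by simp
  have d: "((\<lambda>a. fps_exp (- a) $ i * c) has_field_derivative - ((fps_X * fps_exp (- a)) $ i * c)) (at a)"
    for i :: nat and c :: complex
  proof (cases i)
    case (Suc k)
    have "((\<lambda>a. (- a) ^ Suc k / fact (Suc k) * c) has_field_derivative
       (of_nat (Suc k) * (- a) ^ k * (- 1)) / fact (Suc k) * c) (at a)"
      by (auto intro!: derivative_eq_intros simp del: fact_Suc power_Suc)
    also have "(of_nat (Suc k) * (- a) ^ k * (- 1)) / fact (Suc k) * c = - ((- a) ^ k / fact k * c)"
      by (simp add: field_simps del: of_nat_Suc)
    finally show ?thesis using Suc by (simp del: fact_Suc of_nat_Suc power_Suc)
  qed simp
  have "((\<lambda>a. \<Sum>i=0..n. fps_exp (- a) $ i * ?V ^ i $ n) has_field_derivative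
      (\<Sum>i=0..n. - ((fps_X * fps_exp (- a)) $ i * ?V ^ i $ n))) (at a)"
    by (intro DERIV_sum d)
  moreover have "(\<Sum>i=0..n. - ((fps_X * fps_exp (- a)) $ i * ?V ^ i $ n)) =
      (- ?V * fps_one_minus_cpow u a) $ n"
  proof -
    have "?V * fps_one_minus_cpow u a = (fps_X * fps_exp (- a)) oo ?V"
      using assms by (simp add: fps_one_minus_cpow_exp fps_compose_mult_distrib)
    then show ?thesis by (simp add: fps_compose_nth sum_negf)
  qed
  ultimately show "((\<lambda>a. fps_one_minus_cpow u a $ n) has_field_derivative
      (- ?V * fps_one_minus_cpow u a) $ n) (at a)"
    using assms by (simp add: fps_one_minus_cpow_exp fps_compose_nth)
qed

text \<open>Differentiating (1 - X)^(-s) in s multiplies it by -log (1 - X); the weights 1/k of all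
  later shifts are the coefficients of this logarithm.\<close>

lemma rising_deriv:
  "((\<lambda>s. rising s n) has_field_derivative (\<Sum>k=1..n. rising s (n - k) / of_nat k)) (at s)"
proof -
  have "has_coeff_deriv (\<lambda>s. fps_one_minus_cpow fps_X (- s))
      (fps_const (- 1) * (- (neg_log oo fps_X) * fps_one_minus_cpow fps_X (- s))) s"
    by (rule has_coeff_deriv_chain[OF _ has_coeff_deriv_cpow]) (auto intro!: derivative_eq_intros)
  then have "((\<lambda>s. rising s n) has_field_derivative (neg_log * Abs_fps (rising s)) $ n) (at s)"
    by (simp add: has_coeff_deriv_def fps_one_minus_cpow_X flip: fps_const_neg)
  also have "(neg_log * Abs_fps (rising s)) $ n = (\<Sum>k=1..n. rising s (n - k) / of_nat k)"
    by (simp add: fps_mult_nth neg_log_def sum.atLeast_Suc_atMost)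
  finally show ?thesis .
qed

lemma rising_deriv_neg:
  "((\<lambda>s. rising (- s) n) has_field_derivative - (\<Sum>k=1..n. rising (- s) (n - k) / of_nat k)) (at s)"
  using DERIV_chain2[OF rising_deriv DERIV_minus[OF DERIV_ident], of n s UNIV] by simp

text \<open>The coefficients of (1 - X)^s (1 - X)^(-s) = 1.\<close>

lemma rising_convolution: "(\<Sum>j\<le>n. rising (- s) j * rising s (n - j)) = (if n = 0 then 1 else 0)"
proof -
  have "fps_one_minus_cpow fps_X (- (- s)) * fps_one_minus_cpow fps_X (- s) = 1"
    using fps_one_minus_cpow_add[of fps_X s "- s"] by simp
  then have "(Abs_fps (rising (- s)) * Abs_fps (rising s)) $ n = 1 $ n"
    by (simp only: fps_one_minus_cpow_X)
  then show ?thesis by (simp add: fps_mult_nth atMost_atLeast0)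
qed

text \<open>The product of (1 - X)^s and X d/dX (1 - X)^(-s) is s X / (1 - X), whose coefficients at
  positive exponents all equal s. This is where the term linear in s of \<open>Wc_trace\<close>
  originates.\<close>

lemma rising_weighted_convolution:
  assumes "n > 0"
  shows "(\<Sum>j\<le>n. of_nat (n - j) * (rising (- s) j * rising s (n - j))) = s"
proof -
  let ?h = "Abs_fps (rising s)" and ?g = "Abs_fps (rising (- s))"
  have gh: "?g * ?h = 1"
    using fps_one_minus_cpow_add[of fps_X s "- s"]
      fps_one_minus_cpow_X[of s] fps_one_minus_cpow_X[of "- s"] by simp
  have "fps_deriv ?h * (1 - fps_X) = fps_const s * ?h"
  proof (rule fps_ext)
    fix m show "(fps_deriv ?h * (1 - fps_X)) $ m = (fps_const s * ?h) $ m"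
      using rising_rec[of m s] rising_rec[of "m - 1" s]
      by (cases m) (simp_all add: right_diff_distrib algebra_simps)
  qed
  then have "?g * (fps_deriv ?h * (1 - fps_X)) = fps_const s" using gh
    by (metis mult.commute mult.left_neutral mult.assoc)
  then have "?g * fps_deriv ?h * (1 - fps_X) * fps_deriv neg_log = fps_const s * fps_deriv neg_log"
    by (simp add: mult.assoc)
  then have e: "?g * fps_deriv ?h = fps_const s * fps_deriv neg_log"
    by (metis fps_deriv_neg_log mult.assoc mult.commute mult.right_neutral)
  obtain m where m: "n = Suc m" using assms by (cases n) auto
  have "(\<Sum>j\<le>n. of_nat (n - j) * (rising (- s) j * rising s (n - j))) =
      (\<Sum>j\<le>m. rising (- s) j * (of_nat (Suc m - j) * rising s (Suc m - j)))"
    by (simp add: m mult_ac)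
  also have "\<dots> = (?g * fps_deriv ?h) $ m"
    by (auto simp: fps_mult_nth atMost_atLeast0 Suc_diff_le intro!: sum.cong)
  also have "\<dots> = s" by (simp add: e neg_log_def del: of_nat_Suc)
  finally show ?thesis .
qed

section \<open>The kernel\<close>

text \<open>\<open>Hc t s n\<close> and \<open>Qc t s c n\<close> are the coefficients of \<open>q\<^sup>n\<close> in \<open>h = (1 - q\<^sup>t) powr (- s)\<close> and
  in \<open>(q\<^sup>c + q powi (- c) - 2 [t dvd c]) h\<close>; \<open>Wc t s c\<close> is the combination of the latter with
  principal part \<open>q powi (- c)\<close> (lemma \<open>Wc_neg\<close>). A function spanned by the \<open>Wc\<close> is therefore determined
  by its values at negative arguments.\<close>

definition Hc :: "nat \<Rightarrow> complex \<Rightarrow> int \<Rightarrow> complex" where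
  "Hc t s n = (if 0 \<le> n \<and> int t dvd n then rising s (nat (n div int t)) else 0)"

definition Qc :: "nat \<Rightarrow> complex \<Rightarrow> nat \<Rightarrow> int \<Rightarrow> complex" where
  "Qc t s c n = Hc t s (n + int c) + Hc t s (n - int c) - (if t dvd c then 2 * Hc t s n else 0)"

definition Wc :: "nat \<Rightarrow> complex \<Rightarrow> nat \<Rightarrow> int \<Rightarrow> complex" where
  "Wc t s c n = (\<Sum>j<(c + t - 1) div t. rising (- s) j * Qc t s (c - t * j) n)"

text \<open>The quotient is the ceiling of c/t: the sum in \<open>Wc\<close> runs over the j for
  which c - t j is positive, and no subtraction in it truncates.\<close>

lemma ceil_div_less_iff:
  assumes "t > 0"
  shows "j < (c + t - 1) div t \<longleftrightarrow> t * j < (c::nat)"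
proof -
  have "j < (c + t - 1) div t \<longleftrightarrow> Suc j \<le> (c + t - 1) div t" by auto
  also have "\<dots> \<longleftrightarrow> Suc j * t \<le> c + t - 1"
    using assms by (simp add: less_eq_div_iff_mult_less_eq)
  also have "\<dots> \<longleftrightarrow> t * j < c" using assms by (auto simp: mult.commute)
  finally show ?thesis .
qed

lemma ceil_div_shift:
  assumes "t > 0"
  shows "(c - t * j + t - 1) div t = (c + t - 1) div t - (j::nat)"
proof -
  have "i < (c - t * j + t - 1) div t \<longleftrightarrow> i < (c + t - 1) div t - j" for i
    unfolding ceil_div_less_iff[OF assms] less_diff_conv
    by (auto simp: ceil_div_less_iff[OF assms] algebra_simps)
  then show ?thesis by (metis linorder_neqE_nat less_irrefl)
qed

lemma Wc_0 [simp]: "t > 0 \<Longrightarrow> Wc t s 0 n = 0"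
  by (simp add: Wc_def)

lemma Hc_neg [simp]: "n < 0 \<Longrightarrow> Hc t s n = 0"
  by (simp add: Hc_def)

lemma Hc_mult: "t > 0 \<Longrightarrow> Hc t s (int t * int k) = rising s k"
  by (simp add: Hc_def)

text \<open>At a negative exponent only the part q^(-(c - t j)) h of each \<open>Qc\<close>
  contributes, so the sum is a coefficient of q^(-c) (1 - q^t)^s (1 - q^t)^(-s) = q^(-c).\<close>

lemma Wc_neg:
  assumes t: "t > 0" and n: "n < 0"
  shows "Wc t s c n = (if n = - int c then 1 else 0)"
proof -
  have Q: "Qc t s (c - t * j) n = Hc t s (n + int c - int t * int j)" if "t * j < c" for j
  proof -
    have "int t * int j < int c" using that by (metis of_nat_less_iff of_nat_mult)
    then have "Hc t s (n - int (c - t * j)) = 0" "Hc t s n = 0" using n by auto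
    then show ?thesis using that by (simp add: Qc_def of_nat_diff algebra_simps)
  qed
  have "Wc t s c n = (\<Sum>j<(c + t - 1) div t. rising (- s) j * Hc t s (n + int c - int t * int j))"
    unfolding Wc_def
    by (intro sum.cong refl arg_cong2[where f="(*)"] Q) (use ceil_div_less_iff[OF t] in blast)
  also have "\<dots> = (if n = - int c then 1 else 0)"
  proof (cases "0 \<le> n + int c \<and> int t dvd n + int c")
    case False
    have "Hc t s (n + int c - int t * int j) = 0" for j
    proof (cases "0 \<le> n + int c")
      case True
      then have "\<not> int t dvd n + int c - int t * int j" using False
        by (metis dvd_triv_left dvd_diff_right_iff diff_add_cancel dvd_add)
      then show ?thesis by (simp add: Hc_def)
    next
      case False
      then have "n + int c - int t * int j < 0"
        by (smt (verit) of_nat_0_le_iff mult_nonneg_nonneg)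
      then show ?thesis by simp
    qed
    moreover have "n \<noteq> - int c" using False by auto
    ultimately show ?thesis by simp
  next
    case True
    then obtain e where e: "n + int c = int t * e" by (elim conjE dvdE)
    then have "e \<ge> 0" using True t by (metis of_nat_0_less_iff zero_le_mult_iff not_less)
    then obtain d where d: "n + int c = int t * int d" using e nonneg_int_cases by metis
    \<comment> \<open>As n is negative, t d = n + c is smaller than c; hence the range of j contains
      the complete convolution.\<close>
    have dlt: "d < (c + t - 1) div t"
      unfolding ceil_div_less_iff[OF t] using d n by (metis of_nat_less_iff of_nat_mult add_less_same_cancel2)
    have H: "Hc t s (n + int c - int t * int j) = (if j \<le> d then rising s (d - j) else 0)" for j
    proof (cases "j \<le> d")
      case True
      then have "n + int c - int t * int j = int t * int (d - j)"
        by (simp add: d of_nat_diff right_diff_distrib)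
      then show ?thesis using True by (simp only: Hc_mult[OF t] if_True)
    next
      case False
      then have "n + int c - int t * int j < 0" using t by (simp add: d)
      then show ?thesis using False by simp
    qed
    have "(\<Sum>j<(c + t - 1) div t. rising (- s) j * Hc t s (n + int c - int t * int j)) =
        (\<Sum>j\<le>d. rising (- s) j * Hc t s (n + int c - int t * int j))"
      by (rule sum.mono_neutral_right) (use dlt H in auto)
    also have "\<dots> = (\<Sum>j\<le>d. rising (- s) j * rising s (d - j))"
      by (intro sum.cong refl) (simp add: H)
    also have "\<dots> = (if d = 0 then 1 else 0)" by (rule rising_convolution)
    also have "\<dots> = (if n = - int c then 1 else 0)" using d t by auto
    finally show ?thesis .
  qed
  finally show ?thesis .
qed

text \<open>Inverts the triangular definition of \<open>Wc\<close>: grouping the double sum by k = i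
  + j, the convolution of the two binomial series leaves only k = 0.\<close>

lemma Qc_eq_sum_Wc:
  assumes t: "t > 0" and c: "c > 0"
  shows "Qc t s c n = (\<Sum>j<(c + t - 1) div t. rising s j * Wc t s (c - t * j) n)"
proof -
  let ?b = "(c + t - 1) div t"
  have "(\<Sum>j<?b. rising s j * Wc t s (c - t * j) n) =
      (\<Sum>j<?b. \<Sum>i<?b - j. rising s j * rising (- s) i * Qc t s (c - t * (j + i)) n)"
    unfolding Wc_def ceil_div_shift[OF t] sum_distrib_left by (simp add: mult.assoc distrib_left)
  also have "\<dots> = (\<Sum>(j,i)\<in>{(j,i). j + i < ?b}. rising s j * rising (- s) i * Qc t s (c - t * (j + i)) n)"
    by (subst sum.Sigma) (auto intro!: sum.cong)
  also have "\<dots> = (\<Sum>k<?b. \<Sum>i\<le>k. rising s i * rising (- s) (k - i) * Qc t s (c - t * (i + (k - i))) n)"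
    by (rule sum.triangle_reindex)
  also have "\<dots> = (\<Sum>k<?b. (\<Sum>i\<le>k. rising s i * rising (- s) (k - i)) * Qc t s (c - t * k) n)"
    by (simp add: sum_distrib_right)
  also have "\<dots> = (\<Sum>k<?b. if k = 0 then Qc t s c n else 0)"
    using rising_convolution[of "- s"] by (intro sum.cong refl) auto
  also have "\<dots> = Qc t s c n" using ceil_div_less_iff[OF t, of 0 c] c by simp
  finally show ?thesis by simp
qed

section \<open>Functions spanned by the kernel, and the multiplication rule\<close>

definition spanned :: "nat \<Rightarrow> complex \<Rightarrow> (int \<Rightarrow> complex) \<Rightarrow> bool" where
  "spanned t s f \<longleftrightarrow> (\<exists>N. \<forall>n. f n = (\<Sum>d=1..N. f (- int d) * Wc t s d n))"

text \<open>The values at -d with d > N vanish, so the bound can be raised; this lets several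
  spanned functions share one bound.\<close>

lemma spanned_bound:
  assumes t: "t > 0" and f: "\<And>n. f n = (\<Sum>d=1..N. f (- int d) * Wc t s d n)" and M: "M \<ge> N"
  shows "f n = (\<Sum>d=1..M. f (- int d) * Wc t s d n)"
proof -
  have "f (- int d) = 0" if "d > N" for d
  proof -
    have "f (- int d) = (\<Sum>e=1..N. f (- int e) * Wc t s e (- int d))" by (rule f)
    also have "\<dots> = 0" using that by (intro sum.neutral) (auto simp: Wc_neg[OF t])
    finally show ?thesis .
  qed
  then have "(\<Sum>d=1..M. f (- int d) * Wc t s d n) = (\<Sum>d=1..N. f (- int d) * Wc t s d n)"
    using M by (intro sum.mono_neutral_right) auto
  then show ?thesis using f[of n] by simp
qed

lemma spanned_lincomb:
  assumes t: "t > 0" and "finite I" "\<And>i. i \<in> I \<Longrightarrow> spanned t s (f i)"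
  shows "spanned t s (\<lambda>n. \<Sum>i\<in>I. a i * f i n)"
proof -
  from assms(3) obtain N where N: "\<And>i n. i \<in> I \<Longrightarrow> f i n = (\<Sum>d=1..N i. f i (- int d) * Wc t s d n)"
    unfolding spanned_def by metis
  let ?M = "\<Sum>i\<in>I. N i"
  have *: "f i n = (\<Sum>d=1..?M. f i (- int d) * Wc t s d n)" if "i \<in> I" for i n
    by (rule spanned_bound[OF t]) (use N that assms(2) in \<open>auto intro: member_le_sum\<close>)
  have "(\<Sum>i\<in>I. a i * f i n) = (\<Sum>d=1..?M. (\<Sum>i\<in>I. a i * f i (- int d)) * Wc t s d n)" for n
  proof -
    have "(\<Sum>i\<in>I. a i * f i n) = (\<Sum>i\<in>I. a i * (\<Sum>d=1..?M. f i (- int d) * Wc t s d n))"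
      by (intro sum.cong refl arg_cong2[where f="(*)"] *)
    also have "\<dots> = (\<Sum>d=1..?M. (\<Sum>i\<in>I. a i * f i (- int d)) * Wc t s d n)"
      unfolding sum_distrib_left sum_distrib_right by (subst sum.swap) (simp add: mult.assoc)
    finally show ?thesis .
  qed
  then show ?thesis unfolding spanned_def by blast
qed

lemma spanned_add:
  assumes "t > 0" "spanned t s f" "spanned t s g"
  shows "spanned t s (\<lambda>n. a * f n + b * g n)"
  using spanned_lincomb[OF assms(1), of "{True, False}" s "\<lambda>i. if i then f else g" "\<lambda>i. if i then a else b"]
    assms by simp

lemma spanned_zero: "spanned t s (\<lambda>n. 0)"
  by (auto simp: spanned_def)

lemma spanned_Wc:
  assumes "t > 0"
  shows "spanned t s (Wc t s c)"
  unfolding spanned_def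
proof (intro exI[of _ c] allI)
  fix n
  have "(\<Sum>d=1..c. Wc t s c (- int d) * Wc t s d n) = (\<Sum>d=1..c. if d = c then Wc t s c n else 0)"
    by (intro sum.cong refl) (auto simp: Wc_neg[OF assms])
  also have "\<dots> = Wc t s c n" using assms by (cases "c = 0") auto
  finally show "Wc t s c n = (\<Sum>d=1..c. Wc t s c (- int d) * Wc t s d n)" by simp
qed

lemma spanned_Qc:
  assumes "t > 0"
  shows "spanned t s (Qc t s c)"
proof (cases "c = 0")
  case True
  then have "Qc t s c = (\<lambda>n. 0)" by (auto simp: Qc_def)
  then show ?thesis by (simp add: spanned_zero)
next
  case False
  then have "Qc t s c = (\<lambda>n. \<Sum>j<(c + t - 1) div t. rising s j * Wc t s (c - t * j) n)"
    using Qc_eq_sum_Wc[OF assms] by auto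
  then show ?thesis
    using spanned_lincomb[OF assms, of "{..<(c + t - 1) div t}" s "\<lambda>j. Wc t s (c - t * j)" "rising s"]
    by (simp add: spanned_Wc[OF assms])
qed

text \<open>Multiplication by q^K + q^(-K) with K = t k. The symmetric monomials produce c + K and
  |c - K|; as t divides K, both have the same correction term as c, and the surplus combines to -2
  times the function at K.\<close>

lemma Qc_shift:
  "Qc t s c (n + int (t * k)) + Qc t s c (n - int (t * k)) =
     Qc t s (c + t * k) n + Qc t s (nat \<bar>int c - int (t * k)\<bar>) n
     - (if t dvd c then 2 * Qc t s (t * k) n else 0)"
proof -
  define K where "K = t * k"
  have d1: "t dvd c + K \<longleftrightarrow> t dvd c" unfolding K_def by (metis dvd_add_left_iff dvd_triv_left)
  have d2: "t dvd nat \<bar>int c - int K\<bar> \<longleftrightarrow> t dvd c"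
  proof -
    have "t dvd nat \<bar>int c - int K\<bar> \<longleftrightarrow> int t dvd int c - int K"
      by (metis int_dvd_int_iff dvd_abs_iff abs_ge_zero int_nat_eq)
    also have "\<dots> \<longleftrightarrow> int t dvd int c" unfolding K_def
      by (metis dvd_diff_left_iff dvd_triv_left of_nat_mult)
    finally show ?thesis by simp
  qed
  have d3: "t dvd K" by (simp add: K_def)
  have H: "Hc t s (n + int (nat \<bar>int c - int K\<bar>)) + Hc t s (n - int (nat \<bar>int c - int K\<bar>)) =
      Hc t s (n + int c - int K) + Hc t s (n - int c + int K)"
    by (cases "c \<ge> K") (simp_all add: algebra_simps)
  show ?thesis unfolding K_def[symmetric] Qc_def d1 d2 H
    using d3 by (auto simp: algebra_simps)
qed

text \<open>Both sides are spanned, so the principal parts decide. The pole of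
  \<open>Wc t s c\<close> moves to c - K and c + K, with K = t k, and the coefficients at the
  exponents K - d for 1 <= d <= K become poles. If c <= K, then c - K truncates to 0 and that term
  is 0 by \<open>Wc_0\<close>, as it should be.\<close>

lemma Wc_shift:
  assumes t: "t > 0" and c: "c > 0"
  shows "Wc t s c (n + int (t * k)) + Wc t s c (n - int (t * k)) =
    Wc t s (c - t * k) n + Wc t s (c + t * k) n + (\<Sum>d=1..t * k. Wc t s c (int (t * k) - int d) * Wc t s d n)"
proof -
  define K where "K = t * k"
  define f where "f n = Wc t s c (n + int K) + Wc t s c (n - int K)" for n
  have "f = (\<lambda>n. \<Sum>j<(c + t - 1) div t. rising (- s) j *
      (Qc t s (c - t * j) (n + int K) + Qc t s (c - t * j) (n - int K)))"
    by (simp add: fun_eq_iff f_def Wc_def distrib_left sum.distrib)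
  moreover have "spanned t s (\<lambda>n. Qc t s e (n + int K) + Qc t s e (n - int K))" for e
  proof -
    have "(\<lambda>n. Qc t s e (n + int K) + Qc t s e (n - int K)) =
      (\<lambda>n. 1 * (1 * Qc t s (e + K) n + 1 * Qc t s (nat \<bar>int e - int K\<bar>) n)
         + (if t dvd e then - 2 else 0) * Qc t s K n)"
      unfolding K_def Qc_shift by (auto simp: fun_eq_iff)
    then show ?thesis by (simp only: spanned_add[OF t] spanned_Qc[OF t])
  qed
  ultimately have "spanned t s f"
    using spanned_lincomb[OF t, of "{..<(c + t - 1) div t}" s
      "\<lambda>j n. Qc t s (c - t * j) (n + int K) + Qc t s (c - t * j) (n - int K)"] by simp
  then obtain N where N: "\<And>n. f n = (\<Sum>d=1..N. f (- int d) * Wc t s d n)"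
    unfolding spanned_def by blast
  define M where "M = N + c + K"
  have "f n = (\<Sum>d=1..M. f (- int d) * Wc t s d n)"
    by (rule spanned_bound[OF t N]) (simp add: M_def)
  also have "\<dots> = (\<Sum>d=1..M. (if d = c - K then Wc t s d n else 0) + (if d = c + K then Wc t s d n else 0)
      + (if d \<le> K then Wc t s c (int K - int d) * Wc t s d n else 0))"
  proof (intro sum.cong refl)
    fix d assume d: "d \<in> {1..M}"
    have "Wc t s c (- int d - int K) = (if d + K = c then 1 else 0)"
      by (subst Wc_neg[OF t]) (use d in auto)
    moreover have "Wc t s c (- int d + int K) = (if d = c + K then 1 else 0)" if "d > K"
      by (subst Wc_neg[OF t]) (use d that in auto)
    moreover have "- int d + int K = int K - int d" by simp
    ultimately have "f (- int d) = (if d = c - K then 1 else 0) + (if d = c + K then 1 else 0)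
      + (if d \<le> K then Wc t s c (int K - int d) else 0)"
    proof (cases "d \<le> K")
      case True
      then have "d \<noteq> c + K" "d + K = c \<longleftrightarrow> d = c - K" using c d by auto
      then show ?thesis
        using True \<open>Wc t s c (- int d - int K) = _\<close> by (auto simp: f_def)
    next
      case False
      then show ?thesis
        using \<open>Wc t s c (- int d - int K) = _\<close> \<open>d > K \<Longrightarrow> _\<close> d by (auto simp: f_def)
    qed
    then show "f (- int d) * Wc t s d n = (if d = c - K then Wc t s d n else 0)
      + (if d = c + K then Wc t s d n else 0)
      + (if d \<le> K then Wc t s c (int K - int d) * Wc t s d n else 0)"
      by (auto simp: distrib_right)
  qed
  also have "\<dots> = Wc t s (c - K) n + Wc t s (c + K) n + (\<Sum>d=1..K. Wc t s c (int K - int d) * Wc t s d n)"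
  proof -
    have "(\<Sum>d=1..M. if d = c - K then Wc t s d n else 0) = Wc t s (c - K) n"
      using t by (cases "c - K = 0") (auto simp: M_def)
    moreover have "(\<Sum>d=1..M. if d = c + K then Wc t s d n else 0) = Wc t s (c + K) n"
      using t by (cases "c + K = 0") (auto simp: M_def)
    moreover have "(\<Sum>d=1..M. if d \<le> K then Wc t s c (int K - int d) * Wc t s d n else 0) =
        (\<Sum>d=1..K. Wc t s c (int K - int d) * Wc t s d n)"
      by (rule sum.mono_neutral_cong_right) (auto simp: M_def)
    ultimately show ?thesis by (simp add: sum.distrib)
  qed
  finally show ?thesis by (simp add: f_def K_def)
qed

section \<open>The kernel at s = 0 and its derivative in s\<close>

lemma rising_at_0: "rising 0 n = (if n = 0 then 1 else 0)"
  by (cases n) (auto simp: rising_def pochhammer_rec)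

text \<open>At s = 0 the series h is 1 and only j = 0 remains in \<open>Wc\<close>; of q^c + q^(-c)
  - 2 [t dvd c] only q^c has a positive exponent.\<close>

lemma Wc_at_0:
  assumes t: "t > 0" and c: "c > 0" and n: "n > 0"
  shows "Wc t 0 c n = (if n = int c then 1 else 0)"
proof -
  have H: "Hc t 0 m = (if m = 0 then 1 else 0)" for m
    using t by (auto simp: Hc_def rising_at_0 zero_le_mult_iff elim!: dvdE)
  have b: "(c + t - 1) div t > 0" using ceil_div_less_iff[OF t, of 0 c] c by simp
  have "Wc t 0 c n = (\<Sum>j<(c + t - 1) div t. if j = 0 then Qc t 0 c n else 0)"
    unfolding Wc_def by (intro sum.cong refl) (simp add: rising_at_0)
  also have "\<dots> = Qc t 0 c n" using b by simp
  finally show ?thesis using n by (auto simp: Qc_def H)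
qed

text \<open>The series h is multiplied by -log (1 - q^t), the sum of q^(t k) / k. The bound loses
  nothing, since t k exceeds n for k > B.\<close>

lemma Hc_deriv:
  assumes t: "t > 0" and B: "n \<le> int B"
  shows "((\<lambda>s. Hc t s n) has_field_derivative (\<Sum>k=1..B. Hc t s (n - int (t * k)) / of_nat k)) (at s)"
proof (cases "0 \<le> n \<and> int t dvd n")
  case False
  have "Hc t s (n - int (t * k)) = 0" for k
  proof (cases "0 \<le> n")
    case True
    then have "\<not> int t dvd n - int (t * k)" using False
      by (metis dvd_diff_left_iff dvd_triv_left of_nat_mult)
    then show ?thesis by (simp add: Hc_def)
  next
    case False
    then have "n - int (t * k) < 0" by (smt (verit) of_nat_0_le_iff)
    then show ?thesis by simp
  qed
  moreover have "(\<lambda>s. Hc t s n) = (\<lambda>s. 0)" using False by (auto simp: Hc_def)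
  ultimately show ?thesis by simp
next
  case True
  then obtain e where e: "n = int t * e" by (elim conjE dvdE)
  then have "e \<ge> 0" using True t by (metis of_nat_0_less_iff zero_le_mult_iff not_less)
  then obtain d where d: "n = int t * int d" using e nonneg_int_cases by metis
  have "d \<le> B"
  proof -
    have "int d * 1 \<le> int d * int t" using t by (intro mult_left_mono) auto
    then show ?thesis using d B by (simp add: mult.commute)
  qed
  have H: "Hc t s (n - int (t * k)) = (if k \<le> d then rising s (d - k) else 0)" for k
  proof (cases "k \<le> d")
    case True
    then have "n - int (t * k) = int t * int (d - k)"
      by (simp add: d of_nat_diff right_diff_distrib)
    then show ?thesis using True by (simp only: Hc_mult[OF t] if_True)
  next
    case False
    then have "n - int (t * k) < 0" using t by (simp add: d)
    then show ?thesis using False by simp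
  qed
  have "(\<Sum>k=1..B. Hc t s (n - int (t * k)) / of_nat k) = (\<Sum>k=1..d. rising s (d - k) / of_nat k)"
    by (rule sum.mono_neutral_cong_right) (use \<open>d \<le> B\<close> H in auto)
  moreover have "(\<lambda>s. Hc t s n) = (\<lambda>s. rising s d)" using d Hc_mult[OF t] by auto
  ultimately show ?thesis using rising_deriv[of d s] by simp
qed

lemma Qc_deriv:
  assumes t: "t > 0" and B: "n + int c \<le> int B"
  shows "((\<lambda>s. Qc t s c n) has_field_derivative (\<Sum>k=1..B. Qc t s c (n - int (t * k)) / of_nat k)) (at s)"
proof -
  have e: "(\<Sum>k=1..B. Qc t s c (n - int (t * k)) / of_nat k) =
     (\<Sum>k=1..B. Hc t s ((n + int c) - int (t * k)) / of_nat k)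
     + (\<Sum>k=1..B. Hc t s ((n - int c) - int (t * k)) / of_nat k)
     - (if t dvd c then 2 * (\<Sum>k=1..B. Hc t s (n - int (t * k)) / of_nat k) else 0)"
    by (simp add: Qc_def algebra_simps sum.distrib sum_subtractf sum_distrib_left
        add_divide_distrib diff_divide_distrib)
  have "((\<lambda>s. if t dvd c then 2 * Hc t s n else 0) has_field_derivative
     (if t dvd c then 2 * (\<Sum>k=1..B. Hc t s (n - int (t * k)) / of_nat k) else 0)) (at s)"
    using B Hc_deriv[OF t, of n B s] by (auto intro!: DERIV_cmult)
  then show ?thesis unfolding e unfolding Qc_def
    using B by (intro DERIV_add DERIV_diff Hc_deriv[OF t]) auto
qed

text \<open>Differentiating h moves the argument down by t k; differentiating the coefficients of (1
  - q^t)^s lowers the index by t k, with the opposite sign. For k > B both terms vanish: n - t k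
  lies below -c, and c - t k truncates to 0.\<close>

lemma Wc_deriv:
  assumes t: "t > 0" and B: "n + int c \<le> int B" "c \<le> B"
  shows "((\<lambda>s. Wc t s c n) has_field_derivative
    (\<Sum>k=1..B. (Wc t s c (n - int (t * k)) - Wc t s (c - t * k) n) / of_nat k)) (at s)"
proof -
  let ?b = "(c + t - 1) div t"
  have bB: "?b \<le> B"
  proof (rule ccontr)
    assume "\<not> ?b \<le> B"
    then have "t * B < c" using ceil_div_less_iff[OF t, of B c] by simp
    moreover have "1 * B \<le> t * B" using t by (intro mult_right_mono) auto
    ultimately show False using B by simp
  qed
  have "((\<lambda>s. Wc t s c n) has_field_derivative
     (\<Sum>j<?b. - (\<Sum>k=1..j. rising (- s) (j - k) / of_nat k) * Qc t s (c - t * j) n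
         + (\<Sum>k=1..B. Qc t s (c - t * j) (n - int (t * k)) / of_nat k) * rising (- s) j)) (at s)"
    unfolding Wc_def
  proof (intro DERIV_sum DERIV_mult rising_deriv_neg Qc_deriv[OF t])
    fix j show "n + int (c - t * j) \<le> int B" using B by linarith
  qed
  also have "(\<Sum>j<?b. - (\<Sum>k=1..j. rising (- s) (j - k) / of_nat k) * Qc t s (c - t * j) n
         + (\<Sum>k=1..B. Qc t s (c - t * j) (n - int (t * k)) / of_nat k) * rising (- s) j) =
     (\<Sum>k=1..B. Wc t s c (n - int (t * k)) / of_nat k)
     - (\<Sum>j<?b. (\<Sum>k=1..j. rising (- s) (j - k) / of_nat k) * Qc t s (c - t * j) n)"
  proof -
    have "(\<Sum>j<?b. (\<Sum>k=1..B. Qc t s (c - t * j) (n - int (t * k)) / of_nat k) * rising (- s) j) =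
        (\<Sum>k=1..B. Wc t s c (n - int (t * k)) / of_nat k)"
      unfolding Wc_def sum_distrib_right sum_divide_distrib
      by (subst sum.swap) (simp add: mult_ac)
    then show ?thesis by (simp add: sum.distrib sum_subtractf sum_negf)
  qed
  also have "(\<Sum>j<?b. (\<Sum>k=1..j. rising (- s) (j - k) / of_nat k) * Qc t s (c - t * j) n) =
     (\<Sum>k=1..B. Wc t s (c - t * k) n / of_nat k)"
  proof -
    have "(\<Sum>j<?b. (\<Sum>k=1..j. rising (- s) (j - k) / of_nat k) * Qc t s (c - t * j) n) =
        (\<Sum>j<?b. \<Sum>k=1..B. if k \<le> j then rising (- s) (j - k) / of_nat k * Qc t s (c - t * j) n else 0)"
      unfolding sum_distrib_right using bB
      by (intro sum.cong refl sum.mono_neutral_cong_left) auto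
    also have "\<dots> = (\<Sum>k=1..B. \<Sum>j<?b. if k \<le> j then rising (- s) (j - k) / of_nat k * Qc t s (c - t * j) n else 0)"
      by (rule sum.swap)
    also have "\<dots> = (\<Sum>k=1..B. Wc t s (c - t * k) n / of_nat k)"
    proof (intro sum.cong refl)
      fix k
      have "(\<Sum>j<?b. if k \<le> j then rising (- s) (j - k) / of_nat k * Qc t s (c - t * j) n else 0) =
         (\<Sum>i<?b - k. rising (- s) i / of_nat k * Qc t s (c - t * (i + k)) n)"
      proof -
        have "(\<Sum>j<?b. if k \<le> j then rising (- s) (j - k) / of_nat k * Qc t s (c - t * j) n else 0) =
            (\<Sum>j=k..<?b. rising (- s) (j - k) / of_nat k * Qc t s (c - t * j) n)"
          by (rule sum.mono_neutral_cong_right) auto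
        also have "\<dots> = (\<Sum>i<?b - k. rising (- s) i / of_nat k * Qc t s (c - t * (i + k)) n)"
          by (rule sum.reindex_bij_witness[of _ "\<lambda>i. i + k" "\<lambda>j. j - k"]) auto
        finally show ?thesis .
      qed
      also have "\<dots> = Wc t s (c - t * k) n / of_nat k"
        unfolding Wc_def ceil_div_shift[OF t]
        by (simp add: sum_divide_distrib algebra_simps)
      finally show "(\<Sum>j<?b. if k \<le> j then rising (- s) (j - k) / of_nat k * Qc t s (c - t * j) n else 0) =
         Wc t s (c - t * k) n / of_nat k" .
    qed
    finally show ?thesis .
  qed
  finally show ?thesis by (simp add: diff_divide_distrib sum_subtractf)
qed

section \<open>The finite trace left over by the multiplication rule\<close>

lemma Hc_mult_int: "t > 0 \<Longrightarrow> Hc t s (int t * e) = (if e \<ge> 0 then rising s (nat e) else 0)"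
  by (auto simp: Hc_def zero_le_mult_iff)

lemma Hc_not_dvd: "\<not> int t dvd n \<Longrightarrow> Hc t s n = 0"
  by (simp add: Hc_def)

lemma sum_multiples:
  assumes t: "t > 0" and 0: "\<And>d. \<not> t dvd d \<Longrightarrow> f d = 0"
  shows "(\<Sum>d\<in>{t * j<..t * k}. f d) = (\<Sum>\<delta>\<in>{j<..(k::nat)}. f (t * \<delta>) :: complex)"
proof -
  have "(\<Sum>d\<in>{t * j<..t * k}. f d) = (\<Sum>d\<in>(\<lambda>\<delta>. t * \<delta>) ` {j<..k}. f d)"
  proof (rule sum.mono_neutral_right)
    show "\<forall>d\<in>{t * j<..t * k} - (\<lambda>\<delta>. t * \<delta>) ` {j<..k}. f d = 0"
    proof
      fix d assume d: "d \<in> {t * j<..t * k} - (\<lambda>\<delta>. t * \<delta>) ` {j<..k}"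
      have "\<not> t dvd d"
      proof
        assume "t dvd d"
        then obtain e where "d = t * e" by (elim dvdE)
        then show False using d t by auto
      qed
      then show "f d = 0" by (rule 0)
    qed
  qed (use t in auto)
  also have "\<dots> = (\<Sum>\<delta>\<in>{j<..k}. f (t * \<delta>))"
    using t by (subst sum.reindex) (auto simp: inj_on_def)
  finally show ?thesis .
qed

text \<open>After grouping by l = j + i the complete convolution kills every l > 0.\<close>

lemma sum_rising_triangle:
  "(\<Sum>j<k. \<Sum>i<k - j. if P (j + i) then rising (- s) j * rising s i else 0) = (if k > 0 \<and> P 0 then 1 else 0)"
proof -
  have "(\<Sum>j<k. \<Sum>i<k - j. if P (j + i) then rising (- s) j * rising s i else 0) =
     (\<Sum>(j,i)\<in>{(j,i). j + i < k}. if P (j + i) then rising (- s) j * rising s i else 0)"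
    by (subst sum.Sigma) (auto intro!: sum.cong)
  also have "\<dots> = (\<Sum>l<k. \<Sum>i\<le>l. if P (i + (l - i)) then rising (- s) i * rising s (l - i) else 0)"
    by (rule sum.triangle_reindex)
  also have "\<dots> = (\<Sum>l<k. if P l then (\<Sum>i\<le>l. rising (- s) i * rising s (l - i)) else 0)"
    by (intro sum.cong refl) (auto intro!: sum.neutral)
  also have "\<dots> = (\<Sum>l<k. if l = 0 then (if P 0 then 1 else 0) else 0)"
    by (intro sum.cong refl) (simp add: rising_convolution)
  also have "\<dots> = (if k > 0 \<and> P 0 then 1 else 0)" by simp
  finally show ?thesis .
qed

text \<open>The three terms of \<open>Qc\<close> are summed separately. The first does not depend on
  d, and counting the d turns it into t times the weighted convolution, that is t s. The second
  vanishes unless t divides d, because t is odd, and records the parity of k. The third gives -2. So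
  s enters linearly, through the first term only.\<close>

lemma Wc_trace:
  assumes t: "odd t" and k: "k > 0"
  shows "(\<Sum>d=1..t * k. Wc t s d (int (t * k) - int d)) =
     of_nat t * s - 2 + (if even k then 1 else 0)"
proof -
  define K where "K = t * k"
  have t0: "t > 0" using t odd_pos by blast
  define F where "F j d = rising (- s) j * (Hc t s (int K - int (t * j)) + Hc t s (int K - 2 * int d + int (t * j))
      - (if t dvd d then 2 * Hc t s (int K - int d) else 0))" for j d
  have "(\<Sum>d=1..K. Wc t s d (int K - int d)) = (\<Sum>d=1..K. \<Sum>j<k. if t * j < d then F j d else 0)"
  proof (intro sum.cong refl)
    fix d assume d: "d \<in> {1..K}"
    have "Wc t s d (int K - int d) = (\<Sum>j<(d + t - 1) div t. F j d)"
      unfolding Wc_def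
    proof (intro sum.cong refl)
      fix j assume "j \<in> {..<(d + t - 1) div t}"
      then have j: "t * j < d" using ceil_div_less_iff[OF t0] by blast
      have "t dvd d - t * j \<longleftrightarrow> t dvd d"
        using j by (metis dvd_diffD dvd_diff_nat dvd_triv_left less_imp_le)
      then show "rising (- s) j * Qc t s (d - t * j) (int K - int d) = F j d"
        using j unfolding Qc_def F_def by (simp add: of_nat_diff less_imp_le algebra_simps)
    qed
    also have "\<dots> = (\<Sum>j<k. if t * j < d then F j d else 0)"
    proof (rule sum.mono_neutral_cong_left)
      have "j < k" if "j < (d + t - 1) div t" for j
      proof -
        have "t * j < d" using that ceil_div_less_iff[OF t0] by blast
        then have "t * j < t * k" using d unfolding K_def by (meson atLeastAtMost_iff less_le_trans)
        then show ?thesis by simp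
      qed
      then show "{..<(d + t - 1) div t} \<subseteq> {..<k}"
        by (meson lessThan_subset_iff linorder_not_le less_irrefl)
      show "\<forall>j\<in>{..<k} - {..<(d + t - 1) div t}. (if t * j < d then F j d else 0) = 0"
        using ceil_div_less_iff[OF t0, of _ d] by (metis DiffD2 lessThan_iff)
      show "F j d = (if t * j < d then F j d else 0)" if "j \<in> {..<(d + t - 1) div t}" for j
        using that ceil_div_less_iff[OF t0, of j d] by (metis lessThan_iff)
    qed simp
    finally show "Wc t s d (int K - int d) = (\<Sum>j<k. if t * j < d then F j d else 0)" .
  qed
  also have "\<dots> = (\<Sum>j<k. \<Sum>d=1..K. if t * j < d then F j d else 0)" by (rule sum.swap)
  also have "\<dots> = (\<Sum>j<k. \<Sum>d\<in>{t * j<..t * k}. F j d)"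
    by (intro sum.cong refl sum.mono_neutral_cong_right) (auto simp: K_def intro: le_less_trans[OF zero_le])
  also have "\<dots> = (\<Sum>j<k. of_nat t * (of_nat (k - j) * (rising (- s) j * rising s (k - j)))
      + (\<Sum>i<k - j. if even (k - (j + i)) then rising (- s) j * rising s i else 0)
      - 2 * (\<Sum>i<k - j. if True then rising (- s) j * rising s i else 0))"
  proof (intro sum.cong refl)
    fix j assume "j \<in> {..<k}"
    then have j: "j < k" by simp
    have e1: "Hc t s (int K - int (t * j)) = rising s (k - j)"
    proof -
      have "int K - int (t * j) = int t * int (k - j)" using j by (simp add: K_def of_nat_diff right_diff_distrib)
      then show ?thesis by (simp only: Hc_mult[OF t0])
    qed
    have "(\<Sum>d\<in>{t * j<..t * k}. F j d) = (\<Sum>d\<in>{t * j<..t * k}. rising (- s) j * rising s (k - j))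
       + (\<Sum>d\<in>{t * j<..t * k}. rising (- s) j * Hc t s (int K - 2 * int d + int (t * j)))
       - (\<Sum>d\<in>{t * j<..t * k}. rising (- s) j * (if t dvd d then 2 * Hc t s (int K - int d) else 0))"
      unfolding F_def e1 by (simp only: distrib_left right_diff_distrib sum.distrib sum_subtractf)
    also have "(\<Sum>d\<in>{t * j<..t * k}. rising (- s) j * rising s (k - j)) =
       of_nat t * (of_nat (k - j) * (rising (- s) j * rising s (k - j)))"
      using j by (simp add: of_nat_diff algebra_simps)
    also have "(\<Sum>d\<in>{t * j<..t * k}. rising (- s) j * Hc t s (int K - 2 * int d + int (t * j))) =
       (\<Sum>\<delta>\<in>{j<..k}. rising (- s) j * Hc t s (int K - 2 * int (t * \<delta>) + int (t * j)))"
    proof (rule sum_multiples[OF t0])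
      fix d assume d: "\<not> t dvd d"
      have "\<not> int t dvd int K - 2 * int d + int (t * j)"
      proof
        assume "int t dvd int K - 2 * int d + int (t * j)"
        moreover have "int t dvd int K + int (t * j)" by (simp add: K_def)
        ultimately have "int t dvd int K + int (t * j) - (int K - 2 * int d + int (t * j))"
          by (rule dvd_diff[rotated])
        then have "int t dvd int (2 * d)" by simp
        then have "t dvd 2 * d" by (simp only: of_nat_dvd_iff)
        moreover have "coprime t 2" using t by simp
        ultimately show False using d by (simp add: coprime_dvd_mult_right_iff)
      qed
      then show "rising (- s) j * Hc t s (int K - 2 * int d + int (t * j)) = 0" by (simp add: Hc_not_dvd)
    qed
    also have "\<dots> = (\<Sum>\<delta>\<in>{j<..k}. if 2 * \<delta> \<le> k + j then rising (- s) j * rising s (k + j - 2 * \<delta>) else 0)"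
    proof (intro sum.cong refl)
      fix \<delta>
      have "int K - 2 * int (t * \<delta>) + int (t * j) = int t * (int k + int j - 2 * int \<delta>)"
        by (simp add: K_def algebra_simps)
      moreover have "nat (int k + int j - 2 * int \<delta>) = k + j - 2 * \<delta>" by linarith
      ultimately show "rising (- s) j * Hc t s (int K - 2 * int (t * \<delta>) + int (t * j)) =
          (if 2 * \<delta> \<le> k + j then rising (- s) j * rising s (k + j - 2 * \<delta>) else 0)"
        by (simp only: Hc_mult_int[OF t0]) auto
    qed
    also have "\<dots> = (\<Sum>\<delta> | j < \<delta> \<and> 2 * \<delta> \<le> k + j. rising (- s) j * rising s (k + j - 2 * \<delta>))"
      using j by (intro sum.mono_neutral_cong_right) auto
    \<comment> \<open>The new index i = k + j - 2 \<delta> is the subscript of the binomial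
      coefficient; it runs through the i < k - j with the parity of k - j.\<close>
    also have "\<dots> = (\<Sum>i | i < k - j \<and> even (k - (j + i)). rising (- s) j * rising s i)"
    proof (rule sum.reindex_bij_witness[of _ "\<lambda>i. (k + j - i) div 2" "\<lambda>\<delta>. k + j - 2 * \<delta>"])
      fix \<delta> assume "\<delta> \<in> {\<delta>. j < \<delta> \<and> 2 * \<delta> \<le> k + j}"
      then have \<delta>: "j < \<delta>" "2 * \<delta> \<le> k + j" by auto
      then show "(k + j - (k + j - 2 * \<delta>)) div 2 = \<delta>" by simp
      have "k - (j + (k + j - 2 * \<delta>)) = 2 * (\<delta> - j)" using \<delta> by linarith
      then show "k + j - 2 * \<delta> \<in> {i. i < k - j \<and> even (k - (j + i))}" using \<delta> j by auto
    next
      fix i assume "i \<in> {i. i < k - j \<and> even (k - (j + i))}"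
      then obtain e where e: "i < k - j" "k - (j + i) = 2 * e"
        unfolding mem_Collect_eq by (metis evenE)
      then have "k = 2 * e + j + i" "e > 0" by auto
      then have "k + j - i = 2 * (e + j) \<and> e > 0" by simp
      then show "k + j - 2 * ((k + j - i) div 2) = i" "(k + j - i) div 2 \<in> {\<delta>. j < \<delta> \<and> 2 * \<delta> \<le> k + j}"
        using e by auto
    qed simp
    also have "\<dots> = (\<Sum>i<k - j. if even (k - (j + i)) then rising (- s) j * rising s i else 0)"
      by (rule sum.mono_neutral_cong_left) auto
    also have "(\<Sum>d\<in>{t * j<..t * k}. rising (- s) j * (if t dvd d then 2 * Hc t s (int K - int d) else 0)) =
       (\<Sum>\<delta>\<in>{j<..k}. rising (- s) j * (if t dvd t * \<delta> then 2 * Hc t s (int K - int (t * \<delta>)) else 0))"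
      by (rule sum_multiples[OF t0]) simp
    also have "\<dots> = (\<Sum>\<delta>\<in>{j<..k}. 2 * (rising (- s) j * rising s (k - \<delta>)))"
    proof (intro sum.cong refl)
      fix \<delta> assume "\<delta> \<in> {j<..k}"
      then have "int K - int (t * \<delta>) = int t * int (k - \<delta>)" by (simp add: K_def of_nat_diff right_diff_distrib)
      then show "rising (- s) j * (if t dvd t * \<delta> then 2 * Hc t s (int K - int (t * \<delta>)) else 0) =
         2 * (rising (- s) j * rising s (k - \<delta>))" by (simp only: Hc_mult[OF t0] dvd_triv_left if_True) simp
    qed
    also have "\<dots> = (\<Sum>i<k - j. 2 * (rising (- s) j * rising s i))"
      by (rule sum.reindex_bij_witness[of _ "\<lambda>i. k - i" "\<lambda>\<delta>. k - \<delta>"]) (use j in auto)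
    finally show "(\<Sum>d\<in>{t * j<..t * k}. F j d) =
        of_nat t * (of_nat (k - j) * (rising (- s) j * rising s (k - j)))
        + (\<Sum>i<k - j. if even (k - (j + i)) then rising (- s) j * rising s i else 0)
        - 2 * (\<Sum>i<k - j. if True then rising (- s) j * rising s i else 0)"
      by (simp add: sum_distrib_left)
  qed
  also have "\<dots> = of_nat t * (\<Sum>j<k. of_nat (k - j) * (rising (- s) j * rising s (k - j)))
      + (\<Sum>j<k. \<Sum>i<k - j. if even (k - (j + i)) then rising (- s) j * rising s i else 0)
      - 2 * (\<Sum>j<k. \<Sum>i<k - j. if True then rising (- s) j * rising s i else 0)"
    by (simp add: sum.distrib sum_subtractf sum_distrib_left)
  also have "(\<Sum>j<k. of_nat (k - j) * (rising (- s) j * rising s (k - j))) =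
      (\<Sum>j\<le>k. of_nat (k - j) * (rising (- s) j * rising s (k - j)))"
    by (simp add: lessThan_Suc_atMost[symmetric])
  also have "\<dots> = s" by (rule rising_weighted_convolution[OF k])
  also have "(\<Sum>j<k. \<Sum>i<k - j. if even (k - (j + i)) then rising (- s) j * rising s i else 0) =
      (if k > 0 \<and> even (k - 0) then 1 else 0)" by (rule sum_rising_triangle[of "\<lambda>l. even (k - l)"])
  also have "(\<Sum>j<k. \<Sum>i<k - j. if True then rising (- s) j * rising s i else 0) = (if k > 0 \<and> True then 1 else 0)"
    by (rule sum_rising_triangle[of "\<lambda>l. True"])
  finally show ?thesis using k unfolding K_def by simp
qed

section \<open>Closed forms of truncated binomial convolutions\<close>

lemma rising_Suc': "rising s (Suc n) = s * rising (s + 1) n / of_nat (Suc n)"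
  by (simp add: rising_def pochhammer_rec)

lemma rising_neg_Suc: "rising (- s) (Suc n) = - s * rising (1 - s) n / of_nat (Suc n)"
  using rising_Suc'[of "- s" n] by simp

lemma rising_one_minus_Suc:
  "rising (1 - s) (Suc n) = rising (1 - s) n * (of_nat (Suc n) - s) / of_nat (Suc n)"
  by (simp add: rising_Suc algebra_simps)

lemma rising_one_plus_Suc:
  "rising (s + 1) (Suc n) = rising (s + 1) n * (s + of_nat (Suc n)) / of_nat (Suc n)"
  by (simp add: rising_Suc algebra_simps)

text \<open>Taking partial sums is multiplication by 1 / (1 - X), which turns (1 - X)^s into (1 -
  X)^(s - 1).\<close>

lemma sum_rising: "(\<Sum>j\<le>n. rising (- s) j) = rising (1 - s) n"
proof (induction n)
  case (Suc n)
  have "of_nat (Suc n) \<noteq> (0::complex)" by (simp del: of_nat_Suc)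
  then show ?case
    using Suc by (simp add: rising_neg_Suc rising_one_minus_Suc divide_simps del: of_nat_Suc)
      (simp add: algebra_simps)
qed simp

text \<open>A convolution that is cut off still has a closed form, in which m and k are coupled only
  through the denominator. This is the source of the Cauchy structure for entries of opposite
  residues.\<close>

lemma sum_rising_mult_const:
  "(\<Sum>j\<le>k. rising (- s) j * rising s (m + 1 + k - j)) =
     s * rising (s + 1) m * rising (1 - s) k / of_nat (m + k + 1)"
proof (induction k arbitrary: m)
  case 0
  then show ?case using rising_Suc'[of s m] by simp
next
  case (Suc k)
  have "(\<Sum>j\<le>Suc k. rising (- s) j * rising s (m + 1 + Suc k - j)) =
      (\<Sum>j\<le>k. rising (- s) j * rising s (Suc m + 1 + k - j)) + rising (- s) (Suc k) * rising s (Suc m)"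
    by simp
  also have "\<dots> = s * rising (s + 1) (Suc m) * rising (1 - s) k / of_nat (Suc m + k + 1)
      + (- s * rising (1 - s) k / of_nat (Suc k)) * (s * rising (s + 1) m / of_nat (Suc m))"
    by (simp only: Suc.IH[of "Suc m"] rising_neg_Suc[of s k] rising_Suc'[of s m])
  also have "\<dots> = s * rising (s + 1) m * rising (1 - s) (Suc k) / of_nat (m + Suc k + 1)"
  proof -
    define a b p q :: complex where "a = rising (s + 1) m" "b = rising (1 - s) k"
      "p = of_nat (Suc m)" "q = of_nat (Suc k)"
    have ne: "p \<noteq> 0" "q \<noteq> 0" "p + q \<noteq> 0"
      unfolding a_b_p_q_def by (simp_all del: of_nat_Suc flip: of_nat_add)
    have 1: "rising (s + 1) (Suc m) = a * (s + p) / p"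
      by (simp add: rising_Suc a_b_p_q_def algebra_simps)
    have 2: "rising (1 - s) (Suc k) = b * (q - s) / q"
      by (simp add: rising_Suc a_b_p_q_def algebra_simps)
    have 3: "of_nat (Suc m + k + 1) = p + q" "of_nat (m + Suc k + 1) = p + q"
      by (simp_all add: a_b_p_q_def)
    show ?thesis unfolding 1 2 3 a_b_p_q_def(1,2)[symmetric] a_b_p_q_def(3,4)[symmetric]
      using ne by (simp add: divide_simps) (simp add: algebra_simps)
  qed
  finally show ?case .
qed

text \<open>The counterpart for entries of equal residues, with m - k + s coupling m and k. It is
  stated in multiplied form because this factor may vanish.\<close>

lemma sum_rising_mult_shift:
  "(of_nat m - of_nat k + s) * (\<Sum>i\<le>k. if i \<le> m then rising (- s) (k - i) * rising s (m - i) else 0) =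
     s * rising (s + 1) m * rising (1 - s) k"
proof (induction m arbitrary: k)
  case 0
  have "(s - of_nat k) * rising (- s) k = s * rising (1 - s) k"
  proof (cases k)
    case (Suc n)
    have "of_nat (Suc n) \<noteq> (0::complex)" by (simp del: of_nat_Suc)
    then show ?thesis unfolding Suc rising_neg_Suc rising_one_minus_Suc
      by (simp add: divide_simps del: of_nat_Suc) (simp add: algebra_simps)
  qed simp
  moreover have "(\<Sum>i\<le>k. if i \<le> 0 then rising (- s) (k - i) * rising s (0 - i) else 0) = rising (- s) k"
    by simp
  ultimately show ?case by simp
next
  case (Suc m)
  show ?case
  proof (cases k)
    case 0
    have "of_nat (Suc m) \<noteq> (0::complex)" by (simp del: of_nat_Suc)
    moreover have "(\<Sum>i\<le>0. if i \<le> Suc m then rising (- s) (0 - i) * rising s (Suc m - i) else 0) =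
        s * rising (s + 1) m / of_nat (Suc m)"
      using rising_Suc'[of s m] by simp
    ultimately show ?thesis unfolding 0
      by (simp add: rising_one_plus_Suc divide_simps del: of_nat_Suc sum.atMost_Suc) (simp add: algebra_simps)
  next
    case k: (Suc n)
    \<comment> \<open>The term i = 0 splits off and the rest is the sum for the two lowered indices;
      the prefactor depends only on their difference and is the same for both.\<close>
    have "(\<Sum>i\<le>Suc n. if i \<le> Suc m then rising (- s) (Suc n - i) * rising s (Suc m - i) else 0) =
       rising (- s) (Suc n) * rising s (Suc m)
       + (\<Sum>i\<le>n. if i \<le> m then rising (- s) (n - i) * rising s (m - i) else 0)"
      by (subst sum.atMost_Suc_shift) (simp only: diff_Suc_Suc Suc_le_mono diff_zero if_True zero_le)
    then have "(of_nat (Suc m) - of_nat (Suc n) + s) *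
        (\<Sum>i\<le>Suc n. if i \<le> Suc m then rising (- s) (Suc n - i) * rising s (Suc m - i) else 0) =
        (of_nat m - of_nat n + s) * (rising (- s) (Suc n) * rising s (Suc m))
        + s * rising (s + 1) m * rising (1 - s) n"
      using Suc.IH[of n] by (simp add: distrib_left)
    also have "\<dots> = s * rising (s + 1) (Suc m) * rising (1 - s) (Suc n)"
    proof -
      define a b p q :: complex where "a = rising (s + 1) m" "b = rising (1 - s) n"
        "p = of_nat (Suc m)" "q = of_nat (Suc n)"
      have ne: "p \<noteq> 0" "q \<noteq> 0"
        unfolding a_b_p_q_def by (simp_all del: of_nat_Suc)
      have 1: "rising (s + 1) (Suc m) = a * (s + p) / p"
        by (simp add: rising_Suc a_b_p_q_def algebra_simps)
      have 2: "rising (1 - s) (Suc n) = b * (q - s) / q"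
        by (simp add: rising_Suc a_b_p_q_def algebra_simps)
      have 3: "of_nat m - of_nat n = p - q" by (simp add: a_b_p_q_def)
      have 4: "rising (- s) (Suc n) = - s * b / q" "rising s (Suc m) = s * a / p"
        unfolding a_b_p_q_def using rising_neg_Suc[of s n] rising_Suc'[of s m] by blast+
      show ?thesis unfolding 1 2 3 4 a_b_p_q_def(1,2)[symmetric]
        using ne by (simp add: divide_simps) (simp add: algebra_simps)
    qed
    finally show ?thesis by (simp only: k)
  qed
qed

section \<open>Principal minors of the kernel\<close>

text \<open>The product over the hooks \<open>h\<close> divisible by \<open>t\<close> of the partition with Frobenius coordinates
  \<open>M\<close>, where two boxes with the same hook length on opposite sides of the diagonal, if exchanged by
  the symmetry of the partition, contribute the single factor \<open>1 - (t s / h)\<^sup>2\<close>.\<close>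

definition set_weight :: "nat \<Rightarrow> complex \<Rightarrow> nat set \<Rightarrow> complex" where
  "set_weight t s M = (\<Prod>m\<in>M.
     (if t dvd m then (1 - of_nat t * s / of_nat m) * (1 - of_nat t * s / of_nat (2 * m)) else 1) *
     (\<Prod>k\<in>{0<..<m}.
        if k \<notin> M \<and> t dvd m - k then 1 - (of_nat t * s / of_nat (m - k))\<^sup>2
        else if k \<in> M \<and> t dvd m + k then 1 - (of_nat t * s / of_nat (m + k))\<^sup>2 else 1))"

section \<open>The entries of the kernel\<close>

lemma ceil_div_not_dvd:
  assumes "t > 0" "\<not> t dvd (c::nat)"
  shows "(c + t - 1) div t = Suc (c div t)"
proof -
  have "j < (c + t - 1) div t \<longleftrightarrow> j < Suc (c div t)" for j
  proof -
    have "j < Suc (c div t) \<longleftrightarrow> j * t \<le> c"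
      using assms(1) by (simp add: less_Suc_eq_le less_eq_div_iff_mult_less_eq)
    also have "\<dots> \<longleftrightarrow> t * j < c" using assms(2) by (auto simp: mult.commute order_le_less)
    finally show ?thesis using ceil_div_less_iff[OF assms(1)] by blast
  qed
  then show ?thesis by (metis linorder_neqE_nat less_irrefl)
qed

text \<open>As t is odd and does not divide c, it does not divide m - c, so only the part q^(-(c - t
  j)) h contributes. The residues of m and c add up to exactly t, hence the additional 1 in (m + c)
  / t = m div t + c div t + 1.\<close>

lemma Wc_entry_opposite:
  assumes t: "odd t" and c: "\<not> t dvd c" and mc: "t dvd m + c"
  shows "Wc t s c (int m) =
    s * of_nat t * rising (s + 1) (m div t) * rising (1 - s) (c div t) / of_nat (m + c)"
proof -
  have t0: "t > 0" using t odd_pos by blast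
  have nd: "\<not> int t dvd int m - int c"
  proof
    assume "int t dvd int m - int c"
    then have "int t dvd int (m + c) - (int m - int c)" using mc by (metis dvd_diff of_nat_dvd_iff)
    then have "int t dvd int (2 * c)" by simp
    then have "t dvd 2 * c" by (simp only: of_nat_dvd_iff)
    moreover have "coprime t 2" using t by simp
    ultimately show False using c by (simp add: coprime_dvd_mult_right_iff)
  qed
  have n: "m + c = t * (m div t + 1 + c div t)"
  proof -
    have "m + c = (t * (m div t) + m mod t) + (t * (c div t) + c mod t)" by simp
    also have "\<dots> = t * (m div t + c div t) + (m mod t + c mod t)"
      by (simp only: distrib_left add_ac)
    finally have split: "m + c = t * (m div t + c div t) + (m mod t + c mod t)" .
    then have "t dvd m mod t + c mod t" using mc by (metis dvd_add_right_iff dvd_triv_left)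
    moreover have "c mod t > 0" using c by (simp add: mod_greater_zero_iff_not_dvd)
    moreover have "m mod t + c mod t < 2 * t" using t0 by (metis add_strict_mono mod_less_divisor mult_2)
    ultimately obtain e where e: "m mod t + c mod t = t * e" "0 < t * e" "t * e < t * 2"
      by (metis add_gr_0 dvdE mult.commute)
    then have "e = 1" by (cases "e = 0 \<or> e = 1") (auto simp: mult_less_cancel1)
    then have "m mod t + c mod t = t" using e by simp
    then show ?thesis using split by (simp add: algebra_simps)
  qed
  have "Wc t s c (int m) = (\<Sum>j\<le>c div t. rising (- s) j * rising s (m div t + 1 + c div t - j))"
    unfolding Wc_def ceil_div_not_dvd[OF t0 c] lessThan_Suc_atMost
  proof (intro sum.cong refl arg_cong2[where f="(*)"])
    fix j assume "j \<in> {..c div t}"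
    then have j: "j \<le> c div t" by simp
    then have jc: "t * j \<le> c" using t0 by (metis div_times_less_eq_dividend mult.commute mult_le_mono2 le_trans)
    have 1: "int m + int (c - t * j) = int t * int (m div t + 1 + c div t - j)"
    proof -
      have "int m + int (c - t * j) = int (m + c) - int t * int j" using jc by (simp add: of_nat_diff)
      also have "\<dots> = int t * (int (m div t + 1 + c div t) - int j)" unfolding n of_nat_mult by (simp only: right_diff_distrib)
      finally show ?thesis using j by (simp add: of_nat_diff)
    qed
    have 2: "\<not> int t dvd int m - int (c - t * j)"
    proof
      assume "int t dvd int m - int (c - t * j)"
      then have "int t dvd int m - int c + int t * int j" using jc by (simp add: of_nat_diff algebra_simps)
      then show False using nd by (metis dvd_add_left_iff dvd_triv_left)
    qed
    have 3: "\<not> t dvd c - t * j" using c jc by (metis dvd_diffD dvd_triv_left)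
    show "Qc t s (c - t * j) (int m) = rising s (m div t + 1 + c div t - j)"
      unfolding Qc_def 1 Hc_not_dvd[OF 2] Hc_mult[OF t0] using 3 by simp
  qed
  also have "\<dots> = s * rising (s + 1) (m div t) * rising (1 - s) (c div t) / of_nat (m div t + c div t + 1)"
    by (rule sum_rising_mult_const)
  also have "\<dots> = s * of_nat t * rising (s + 1) (m div t) * rising (1 - s) (c div t) / of_nat (m + c)"
  proof -
    have "of_nat (m + c) = of_nat t * (of_nat (m div t + c div t + 1) :: complex)"
      unfolding n of_nat_mult[symmetric] by (simp only: add_ac)
    then show ?thesis using t0 by simp
  qed
  finally show ?thesis .
qed

text \<open>Here only the part q^(c - t j) h contributes. The factor m - c + t s stays on the left
  since it vanishes for some s.\<close>

lemma Wc_entry_same: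
  assumes t: "odd t" and c: "\<not> t dvd c" and mc: "m mod t = c mod t"
  shows "Wc t s c (int m) * (of_nat m - of_nat c + of_nat t * s) =
    s * of_nat t * rising (s + 1) (m div t) * rising (1 - s) (c div t)"
proof -
  have t0: "t > 0" using t odd_pos by blast
  have e: "int m - int c = int t * (int (m div t) - int (c div t))"
  proof -
    have "int m = int t * int (m div t) + int (m mod t)" "int c = int t * int (c div t) + int (c mod t)"
      by (metis mult_div_mod_eq of_nat_add of_nat_mult)+
    then show ?thesis using mc by (simp add: right_diff_distrib)
  qed
  have nd: "\<not> int t dvd int m + int c"
  proof
    assume "int t dvd int m + int c"
    then have "int t dvd int m + int c - (int m - int c)" by (rule dvd_diff) (simp add: e)
    then have "int t dvd int (2 * c)" by simp
    then have "t dvd 2 * c" by (simp only: of_nat_dvd_iff)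
    moreover have "coprime t 2" using t by simp
    ultimately show False using c by (simp add: coprime_dvd_mult_right_iff)
  qed
  let ?f = "\<lambda>i. if i \<le> m div t then rising (- s) (c div t - i) * rising s (m div t - i) else 0"
  have "Wc t s c (int m) = (\<Sum>j\<le>c div t. ?f (c div t - j))"
    unfolding Wc_def ceil_div_not_dvd[OF t0 c] lessThan_Suc_atMost
  proof (intro sum.cong refl)
    fix j assume "j \<in> {..c div t}"
    then have j: "j \<le> c div t" by simp
    then have jc: "t * j \<le> c" using t0 by (metis div_times_less_eq_dividend mult.commute mult_le_mono2 le_trans)
    have 1: "int m - int (c - t * j) = int t * (int (m div t) - int (c div t) + int j)"
      using jc e by (simp add: of_nat_diff distrib_left)
    have 2: "\<not> int t dvd int m + int (c - t * j)"
    proof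
      assume "int t dvd int m + int (c - t * j)"
      then have "int t dvd int m + int c - int t * int j" using jc by (simp add: of_nat_diff algebra_simps)
      then show False using nd by (metis dvd_diff_left_iff dvd_triv_left)
    qed
    have 3: "\<not> t dvd c - t * j" using c jc by (metis dvd_diffD dvd_triv_left)
    have 4: "0 \<le> int (m div t) - int (c div t) + int j \<longleftrightarrow> c div t - j \<le> m div t" by linarith
    have 5: "nat (int (m div t) - int (c div t) + int j) = m div t - (c div t - j)" using j by linarith
    have 6: "c div t - (c div t - j) = j" using j by simp
    show "rising (- s) j * Qc t s (c - t * j) (int m) = ?f (c div t - j)"
      unfolding Qc_def 1 Hc_not_dvd[OF 2] Hc_mult_int[OF t0] 4 5 6 using 3 by simp
  qed
  also have "\<dots> = (\<Sum>i\<le>c div t. ?f i)"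
    by (rule sum.reindex_bij_witness[of _ "\<lambda>i. c div t - i" "\<lambda>i. c div t - i"]) auto
  finally have W: "Wc t s c (int m) = (\<Sum>i\<le>c div t. ?f i)" .
  have "of_nat m - of_nat c + of_nat t * s = of_nat t * (of_nat (m div t) - of_nat (c div t) + s)"
  proof -
    have "(of_nat m - of_nat c :: complex) = of_int (int m - int c)" by simp
    also have "\<dots> = of_nat t * (of_nat (m div t) - of_nat (c div t))" unfolding e by simp
    finally show ?thesis by (simp add: distrib_left)
  qed
  then show ?thesis unfolding W using sum_rising_mult_shift[of "m div t" "c div t" s]
    by (simp add: mult_ac)
qed

lemma Wc_entry_zero:
  assumes t: "odd t" and mc: "m mod t \<noteq> c mod t" "\<not> t dvd m + c"
  shows "Wc t s c (int m) = 0"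
proof -
  have t0: "t > 0" using t odd_pos by blast
  have "Qc t s (c - t * j) (int m) = 0" if "t * j < c" for j
  proof -
    have 1: "\<not> int t dvd int m + int (c - t * j)"
    proof
      assume "int t dvd int m + int (c - t * j)"
      then have "int t dvd int m + int (c - t * j) + int t * int j" by simp
      then have "int t dvd int (m + c)" using that by (simp add: of_nat_diff)
      then show False using mc(2) by (simp only: of_nat_dvd_iff)
    qed
    have 2: "\<not> int t dvd int m - int (c - t * j)"
    proof
      assume "int t dvd int m - int (c - t * j)"
      then have "int t dvd int m - int (c - t * j) - int t * int j" by simp
      then have "int t dvd int m - int c" using that by (simp add: of_nat_diff)
      then have "int m mod int t = int c mod int t" by (simp add: mod_eq_dvd_iff)
      then show False using mc(1) by (metis of_nat_eq_iff of_nat_mod)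
    qed
    have "\<not> (t dvd c - t * j \<and> int t dvd int m)"
    proof
      assume *: "t dvd c - t * j \<and> int t dvd int m"
      then have "int t dvd int m + int (c - t * j)" by (simp add: of_nat_dvd_iff)
      then show False using 1 by blast
    qed
    then show ?thesis using 1 2 by (auto simp: Qc_def Hc_not_dvd)
  qed
  then show ?thesis
    unfolding Wc_def by (intro sum.neutral ballI) (metis ceil_div_less_iff[OF t0] lessThan_iff mult_zero_right)
qed

text \<open>For multiples of t all three terms of \<open>Qc\<close> are present and each sum has its
  own closed form; over the common denominator the numerator factors again.\<close>

lemma Wc_entry_multiples:
  assumes t: "t > 0"
  shows "Wc t s (t * Suc k) (int (t * Suc m)) * ((s + of_nat (Suc m)) * of_nat (Suc m + Suc k) * (of_nat m - of_nat k + s)) =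
    s * rising (s + 1) (Suc m) * rising (1 - s) k * (of_nat (Suc k) - s) * (2 * of_nat (Suc k) - s)"
proof -
  have b: "(t * Suc k + t - 1) div t = Suc k"
  proof -
    have "j < (t * Suc k + t - 1) div t \<longleftrightarrow> j < Suc k" for j
      unfolding ceil_div_less_iff[OF t] using t by (simp del: mult_Suc_right)
    then show ?thesis by (metis linorder_neqE_nat less_irrefl)
  qed
  let ?f = "\<lambda>i. if i \<le> m then rising (- s) (k - i) * rising s (m - i) else 0"
  define R where "R = (\<Sum>i\<le>k. ?f i)"
  have "Wc t s (t * Suc k) (int (t * Suc m)) = (\<Sum>j\<le>k. rising (- s) j * rising s (Suc m + 1 + k - j)
      + ?f (k - j) - 2 * rising s (Suc m) * rising (- s) j)"
    unfolding Wc_def b lessThan_Suc_atMost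
  proof (intro sum.cong refl)
    fix j assume "j \<in> {..k}"
    then have j: "j \<le> k" by simp
    have 0: "t * Suc k - t * j = t * (Suc k - j)" by (simp add: right_diff_distrib')
    have 1: "int (t * Suc m) + int (t * (Suc k - j)) = int t * int (Suc m + 1 + k - j)"
      unfolding of_nat_mult distrib_left[symmetric] using j
      by (intro arg_cong2[where f="(*)"] refl) linarith
    have 2: "int (t * Suc m) - int (t * (Suc k - j)) = int t * (int m - int k + int j)"
      unfolding of_nat_mult right_diff_distrib[symmetric] using j
      by (intro arg_cong2[where f="(*)"] refl) linarith
    have 3: "int (t * Suc m) = int t * int (Suc m)" by (rule of_nat_mult)
    have 4: "0 \<le> int m - int k + int j \<longleftrightarrow> k - j \<le> m" by linarith
    have 5: "nat (int m - int k + int j) = m - (k - j)" using j by linarith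
    have 6: "k - (k - j) = j" using j by simp
    have Q: "Qc t s (t * (Suc k - j)) (int (t * Suc m)) = rising s (Suc m + 1 + k - j)
       + (if k - j \<le> m then rising s (m - (k - j)) else 0) - 2 * rising s (Suc m)"
      unfolding Qc_def 1 2 unfolding 3
      by (simp only: Hc_mult_int[OF t] Hc_mult[OF t] 4 5 dvd_triv_left if_True of_nat_0_le_iff nat_int)
    show "rising (- s) j * Qc t s (t * Suc k - t * j) (int (t * Suc m)) =
       rising (- s) j * rising s (Suc m + 1 + k - j) + ?f (k - j) - 2 * rising s (Suc m) * rising (- s) j"
      unfolding 0 6 Q by (cases "k - j \<le> m") (simp_all add: algebra_simps)
  qed
  also have "\<dots> = (\<Sum>j\<le>k. rising (- s) j * rising s (Suc m + 1 + k - j)) + (\<Sum>j\<le>k. ?f (k - j))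
      - 2 * rising s (Suc m) * (\<Sum>j\<le>k. rising (- s) j)"
    by (simp only: sum.distrib sum_subtractf sum_distrib_left)
  also have "(\<Sum>j\<le>k. ?f (k - j)) = R" unfolding R_def
    by (rule sum.reindex_bij_witness[of _ "\<lambda>i. k - i" "\<lambda>i. k - i"]) auto
  also have "(\<Sum>j\<le>k. rising (- s) j) = rising (1 - s) k" by (rule sum_rising)
  also have "(\<Sum>j\<le>k. rising (- s) j * rising s (Suc m + 1 + k - j)) =
      s * rising (s + 1) (Suc m) * rising (1 - s) k / of_nat (Suc m + k + 1)"
    by (rule sum_rising_mult_const)
  finally have W: "Wc t s (t * Suc k) (int (t * Suc m)) =
      s * rising (s + 1) (Suc m) * rising (1 - s) k / of_nat (Suc m + k + 1) + R
      - 2 * rising s (Suc m) * rising (1 - s) k" .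
  have R: "(of_nat m - of_nat k + s) * R = s * rising (s + 1) m * rising (1 - s) k"
    unfolding R_def by (rule sum_rising_mult_shift)
  define a b p q :: complex where "a = rising (s + 1) m" "b = rising (1 - s) k"
    "p = of_nat (Suc m)" "q = of_nat (Suc k)"
  note d = a_b_p_q_def
  have ne: "p \<noteq> 0" "q \<noteq> 0" "p + q \<noteq> 0"
    unfolding d by (simp_all del: of_nat_Suc flip: of_nat_add)
  have 1: "rising (s + 1) (Suc m) = a * (s + p) / p" "rising s (Suc m) = s * a / p"
    using rising_one_plus_Suc[of s m] rising_Suc'[of s m] by (simp_all add: d)
  have 2: "of_nat (Suc m + k + 1) = p + q" "of_nat (Suc m + Suc k) = p + q" "of_nat m - of_nat k + s = p - q + s"
    by (simp_all add: d)
  have R': "(p - q + s) * R = s * a * b" using R unfolding 2 d(1,2) .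
  \<comment> \<open>The factor p - q + s is kept together with R, so that \<open>R'\<close> replaces
    their product and no division by a possibly vanishing quantity occurs.\<close>
  have "(s * (a * (s + p) / p) * b / (p + q) + R - 2 * (s * a / p) * b) * ((s + p) * (p + q) * (p - q + s)) =
     (s * (a * (s + p) / p) * b - 2 * (s * a / p) * b * (p + q)) * (s + p) * (p - q + s)
       + ((p - q + s) * R) * (s + p) * (p + q)"
  proof -
    have "(X / w + R - Y) * (v * w * u) = (X - Y * w) * v * u + (u * R) * v * w"
      if "w \<noteq> 0" for X Y u v w :: complex
      using that by (simp add: field_simps)
    then show ?thesis using ne by blast
  qed
  also have "\<dots> = s * (a * (s + p) / p) * b * (q - s) * (2 * q - s)"
    unfolding R' using ne by (simp add: divide_simps) (simp add: algebra_simps)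
  finally show ?thesis unfolding W 1 2 d(2)[symmetric] d(3,4)[symmetric] .
qed

lemma rising_prod: "rising (s + 1) n * rising (1 - s) n = (\<Prod>j=1..n. 1 - (s / of_nat j)\<^sup>2)"
proof (induction n)
  case (Suc n)
  have "of_nat (Suc n) \<noteq> (0::complex)" by (simp del: of_nat_Suc)
  then have e: "1 - (s / of_nat (Suc n))\<^sup>2 = (s + of_nat (Suc n)) / of_nat (Suc n) * ((of_nat (Suc n) - s) / of_nat (Suc n))"
    by (simp add: divide_simps power2_eq_square del: of_nat_Suc) (simp add: algebra_simps)
  have "rising (s + 1) (Suc n) * rising (1 - s) (Suc n) =
      (rising (s + 1) n * rising (1 - s) n) * (1 - (s / of_nat (Suc n))\<^sup>2)"
    unfolding e rising_one_plus_Suc rising_one_minus_Suc by (simp add: mult_ac del: of_nat_Suc)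
  then show ?case using Suc by (simp del: of_nat_Suc)
qed simp

section \<open>The Cauchy form of the kernel\<close>

text \<open>Identifies the residues r and -r. Entries between different classes vanish by
  \<open>Wc_entry_zero\<close>, so each class forms a block of its own.\<close>

definition res_class :: "nat \<Rightarrow> nat \<Rightarrow> nat" where
  "res_class t m = min (m mod t) (t - m mod t)"

lemma dvd_add_iff_mod:
  assumes "t > 0"
  shows "t dvd m + c \<longleftrightarrow> (m mod t + c mod t = 0 \<or> m mod t + c mod t = (t::nat))"
proof -
  have iff: "t dvd m + c \<longleftrightarrow> t dvd m mod t + c mod t"
    by (metis dvd_eq_mod_eq_0 mod_add_eq)
  have lt: "m mod t + c mod t < 2 * t"
    using assms by (metis add_strict_mono mod_less_divisor mult_2)
  show ?thesis unfolding iff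
  proof
    assume "t dvd m mod t + c mod t"
    then obtain e where e: "m mod t + c mod t = t * e" by (elim dvdE)
    have "t * e < t * 2" using lt e by (simp add: mult.commute)
    then have "e < 2" by simp
    then have "e = 0 \<or> e = 1" by auto
    then show "m mod t + c mod t = 0 \<or> m mod t + c mod t = t" using e by auto
  next
    assume "m mod t + c mod t = 0 \<or> m mod t + c mod t = t"
    then show "t dvd m mod t + c mod t" by (metis dvd_0_right dvd_refl)
  qed
qed

lemma res_class_eq_iff:
  assumes "odd t"
  shows "res_class t m = res_class t c \<longleftrightarrow> m mod t = c mod t \<or> t dvd m + c"
proof -
  have t: "t > 0" using assms odd_pos by blast
  have "min a (t - a) = min b (t - b) \<longleftrightarrow> a = b \<or> a + b = 0 \<or> a + b = t" if "a < t" "b < t" for a b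
  proof -
    have "a \<noteq> t - a" "b \<noteq> t - b"
      using assms that by (metis even_add le_add_diff_inverse2 less_imp_le)+
    then show ?thesis using that by (auto simp: min_def)
  qed
  from this[OF mod_less_divisor[OF t] mod_less_divisor[OF t]] show ?thesis
    unfolding dvd_add_iff_mod[OF t] res_class_def .
qed

lemma res_class_dvd_iff:
  assumes "odd t"
  shows "t dvd m \<longleftrightarrow> res_class t m = 0"
proof -
  have t: "t > 0" using assms odd_pos by blast
  have "a = 0 \<longleftrightarrow> min a (t - a) = 0" if "a < t" for a
    using that by (simp add: min_def)
  from this[OF mod_less_divisor[OF t]] show ?thesis unfolding res_class_def dvd_eq_mod_eq_0 .
qed

definition low_res :: "nat \<Rightarrow> nat \<Rightarrow> bool" where
  "low_res t m \<longleftrightarrow> 2 * (m mod t) < t"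

text \<open>Within a class of residues \<open>\<plusminus>r\<close> the matrix of the \<open>Wc\<close> is, up to scaling of
  rows and columns, the Cauchy matrix with nodes \<open>row_node\<close> and \<open>col_node\<close>; here
  \<open>\<sigma> = t s\<close>.\<close>

definition row_node :: "nat \<Rightarrow> complex \<Rightarrow> nat \<Rightarrow> complex" where
  "row_node t \<sigma> m = (if t dvd m then of_nat m ^ 2 + \<sigma> * of_nat m
     else if low_res t m then of_nat m else - of_nat m - \<sigma>)"

definition col_node :: "nat \<Rightarrow> complex \<Rightarrow> nat \<Rightarrow> complex" where
  "col_node t \<sigma> c = (if t dvd c then of_nat c ^ 2 - \<sigma> * of_nat c
     else if low_res t c then of_nat c - \<sigma> else - of_nat c)"

definition row_factor :: "nat \<Rightarrow> complex \<Rightarrow> nat \<Rightarrow> complex" where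
  "row_factor t s m = (if t dvd m then of_nat t ^ 2 * (s * rising (s + 1) (m div t) / (s + of_nat (m div t)))
     else (if low_res t m then 1 else - 1) * s * of_nat t * rising (s + 1) (m div t))"

definition col_factor :: "nat \<Rightarrow> complex \<Rightarrow> nat \<Rightarrow> complex" where
  "col_factor t s c = (if t dvd c then rising (1 - s) (c div t - 1) * (of_nat (c div t) - s) * (2 * of_nat (c div t) - s)
     else rising (1 - s) (c div t))"

lemma low_res_same: "m mod t = c mod t \<Longrightarrow> low_res t m = low_res t c"
  by (simp add: low_res_def)

lemma low_res_opposite:
  assumes "odd t" "\<not> t dvd m" "t dvd m + c"
  shows "low_res t m \<longleftrightarrow> \<not> low_res t c"
proof -
  have t: "t > 0" using assms(1) odd_pos by blast
  have "m mod t + c mod t = t"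
    using assms dvd_add_iff_mod[OF t, of m c] by (metis add_is_0 dvd_eq_mod_eq_0)
  moreover have "2 * a < t \<longleftrightarrow> \<not> 2 * b < t" if "a + b = t" for a b
    using that assms(1) by presburger
  ultimately show ?thesis unfolding low_res_def by blast
qed

text \<open>Equal residues require the denominator m - c + \<sigma>, opposite residues m + c.
  Reversing the sign of the nodes for the upper residue makes both a difference of a row node and a
  column node, up to a sign that depends on the row only. For multiples of t the product of the two
  denominators is needed, which is the difference of m^2 + \<sigma> m and c^2 - \<sigma> c.\<close>

lemma node_diff:
  assumes t: "odd t" and mc: "res_class t m = res_class t c"
  shows "row_node t \<sigma> m - col_node t \<sigma> c =
    (if t dvd m then (of_nat m + of_nat c) * (of_nat m - of_nat c + \<sigma>)
     else (if low_res t m then 1 else - 1) *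
       (if m mod t = c mod t then of_nat m - of_nat c + \<sigma> else of_nat m + of_nat c))"
proof -
  have d: "t dvd m \<longleftrightarrow> t dvd c" using res_class_dvd_iff[OF t] mc by simp
  show ?thesis
  proof (cases "t dvd m")
    case True
    then show ?thesis using d by (simp add: row_node_def col_node_def power2_eq_square algebra_simps)
  next
    case False
    then have dc: "\<not> t dvd c" using d by simp
    show ?thesis
    proof (cases "m mod t = c mod t")
      case same: True
      show ?thesis
        unfolding row_node_def col_node_def using False dc same low_res_same[OF same]
        by (cases "low_res t c") (simp_all only: if_True if_False refl, simp_all)
    next
      case opp: False
      then have "t dvd m + c" using res_class_eq_iff[OF t] mc by blast
      then have "low_res t m \<longleftrightarrow> \<not> low_res t c" by (rule low_res_opposite[OF t False])
      then show ?thesis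
        unfolding row_node_def col_node_def using False dc opp
        by (cases "low_res t c") (simp_all only: if_True if_False refl not_True_eq_False not_False_eq_True, simp_all)
    qed
  qed
qed

text \<open>Collects the entry formulas. The assumption on t s excludes zeros of m - c + t s and of
  s + m / t, the only factors that could make a division fail.\<close>

lemma Wc_cauchy:
  assumes t: "odd t" and gen: "\<And>n::int. of_nat t * s \<noteq> of_int n" and pos: "m > 0" "c > 0"
  shows "Wc t s c (int m) = (if res_class t m = res_class t c
     then row_factor t s m * col_factor t s c / (row_node t (of_nat t * s) m - col_node t (of_nat t * s) c) else 0)"
    and "res_class t m = res_class t c \<Longrightarrow> row_node t (of_nat t * s) m - col_node t (of_nat t * s) c \<noteq> 0"
proof -
  have t0: "t > 0" using t odd_pos by blast
  have ne1: "of_nat m - of_nat c + of_nat t * s \<noteq> 0"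
  proof
    assume "of_nat m - of_nat c + of_nat t * s = 0"
    then have "of_nat t * s = of_int (int c - int m)" by (simp add: algebra_simps eq_diff_eq)
    then show False using gen by blast
  qed
  have ne2: "of_nat m + of_nat c \<noteq> (0::complex)" using pos by (simp flip: of_nat_add)
  show ne: "row_node t (of_nat t * s) m - col_node t (of_nat t * s) c \<noteq> 0" if "res_class t m = res_class t c"
    unfolding node_diff[OF t that] using ne1 ne2 by auto
  show "Wc t s c (int m) = (if res_class t m = res_class t c
     then row_factor t s m * col_factor t s c / (row_node t (of_nat t * s) m - col_node t (of_nat t * s) c) else 0)"
  proof (cases "res_class t m = res_class t c")
    case False
    then show ?thesis using Wc_entry_zero[OF t, of m c s] res_class_eq_iff[OF t, of m c] by simp
  next
    case True
    have d: "t dvd m \<longleftrightarrow> t dvd c" using res_class_dvd_iff[OF t] True by simp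
    show ?thesis
    proof (cases "t dvd m")
      case dm: True
      then obtain \<mu> \<kappa> where mk: "m = t * Suc \<mu>" "c = t * Suc \<kappa>"
        using d pos by (metis dvdE gr0_implies_Suc mult_0_right not_gr0)
      have div: "m div t = Suc \<mu>" "c div t = Suc \<kappa>" using t0 unfolding mk by (simp_all del: mult_Suc_right)
      have node: "row_node t (of_nat t * s) m - col_node t (of_nat t * s) c =
          of_nat t ^ 2 * (of_nat (Suc \<mu> + Suc \<kappa>) * (of_nat \<mu> - of_nat \<kappa> + s))"
        unfolding node_diff[OF t True] using dm by (simp add: mk power2_eq_square algebra_simps)
      have sp: "s + of_nat (Suc \<mu>) \<noteq> 0"
      proof
        assume "s + of_nat (Suc \<mu>) = 0"
        then have "s = - of_nat (Suc \<mu>)" by (simp only: eq_neg_iff_add_eq_0)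
        then have "of_nat t * s = - of_nat (t * Suc \<mu>)" by (simp only: of_nat_mult mult_minus_right)
        then have "of_nat t * s = of_int (- int (t * Suc \<mu>))"
          by (simp only: of_int_minus of_int_of_nat_eq)
        then show False using gen by blast
      qed
      define D v N where "D = of_nat (Suc \<mu> + Suc \<kappa>) * (of_nat \<mu> - of_nat \<kappa> + s)"
        and "v = s + of_nat (Suc \<mu>)"
        and "N = s * rising (s + 1) (Suc \<mu>) * rising (1 - s) \<kappa> * (of_nat (Suc \<kappa>) - s) * (2 * of_nat (Suc \<kappa>) - s)"
      have "D \<noteq> 0" using ne[OF True] unfolding node D_def[symmetric] by auto
      moreover have "v \<noteq> 0" using sp unfolding v_def .
      moreover have "row_factor t s m * col_factor t s c = of_nat t ^ 2 * N / v"
        using dm d unfolding row_factor_def col_factor_def div N_def v_def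
        by (simp only: if_True diff_Suc_1 times_divide_eq_left times_divide_eq_right mult.assoc)
      moreover have "Wc t s c (int m) * (v * D) = N"
        unfolding mk D_def v_def N_def using Wc_entry_multiples[OF t0, of s \<kappa> \<mu>] by (simp only: mult.assoc)
      moreover have "W = T * N / v / (T * D)" if "D \<noteq> 0" "W * (v * D) = N" "T \<noteq> 0" "v \<noteq> 0" for W T :: complex
      proof -
        have "W = N / (v * D)" using that by (simp add: eq_divide_eq)
        then show ?thesis using that by simp
      qed
      ultimately have "Wc t s c (int m) = row_factor t s m * col_factor t s c / (of_nat t ^ 2 * D)"
        using t0 by simp
      then show ?thesis unfolding node D_def by (simp only: True if_True refl)
    next
      case dm: False
      then have dc: "\<not> t dvd c" using d by simp
      define \<epsilon> :: complex where "\<epsilon> = (if low_res t m then 1 else - 1)"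
      have "\<epsilon> \<noteq> 0" by (simp add: \<epsilon>_def)
      have fac: "row_factor t s m * col_factor t s c =
          \<epsilon> * (s * of_nat t * rising (s + 1) (m div t) * rising (1 - s) (c div t))"
        using dm dc by (simp only: row_factor_def col_factor_def if_False \<epsilon>_def mult.assoc)
      have "Wc t s c (int m) = row_factor t s m * col_factor t s c / (row_node t (of_nat t * s) m - col_node t (of_nat t * s) c)"
      proof (cases "m mod t = c mod t")
        case same: True
        have node: "row_node t (of_nat t * s) m - col_node t (of_nat t * s) c = \<epsilon> * (of_nat m - of_nat c + of_nat t * s)"
          using dm same by (simp only: node_diff[OF t True] if_True if_False \<epsilon>_def refl)
        show ?thesis
          unfolding fac node Wc_entry_same[OF t dc same, of s, symmetric] using ne1 \<open>\<epsilon> \<noteq> 0\<close> by simp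
      next
        case opp: False
        then have "t dvd m + c" using res_class_eq_iff[OF t] True by blast
        then have W: "Wc t s c (int m) =
            s * of_nat t * rising (s + 1) (m div t) * rising (1 - s) (c div t) / (of_nat m + of_nat c)"
          using Wc_entry_opposite[OF t dc, of m s] by (simp only: of_nat_add)
        have node: "row_node t (of_nat t * s) m - col_node t (of_nat t * s) c = \<epsilon> * (of_nat m + of_nat c)"
          using dm opp by (simp only: node_diff[OF t True] if_False \<epsilon>_def)
        show ?thesis
          unfolding fac node W using \<open>\<epsilon> \<noteq> 0\<close> by simp
      qed
      then show ?thesis by (simp only: True if_True refl)
    qed
  qed
qed

section \<open>Evaluation of the principal minors\<close>

text \<open>The substitution m - k = t j reduces the product to \<open>rising_prod\<close>; the
  bound \<open>(m - 1) div t\<close> leaves out k = 0 when t divides m.\<close>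

lemma prod_residue_hooks:
  assumes t: "t > 0" and m: "m > 0"
  shows "(\<Prod>k\<in>{0<..<m}. if t dvd m - k then 1 - (of_nat t * s / of_nat (m - k))\<^sup>2 else (1::complex)) =
    rising (s + 1) ((m - 1) div t) * rising (1 - s) ((m - 1) div t)"
proof -
  let ?f = "\<lambda>k. 1 - (of_nat t * s / of_nat (m - k))\<^sup>2"
  have "(\<Prod>k\<in>{0<..<m}. if t dvd m - k then ?f k else 1) = (\<Prod>k | k \<in> {0<..<m} \<and> t dvd m - k. ?f k)"
    by (rule prod.mono_neutral_cong_right) auto
  also have "\<dots> = (\<Prod>j=1..(m - 1) div t. 1 - (s / of_nat j)\<^sup>2)"
  proof (rule prod.reindex_bij_witness[of _ "\<lambda>j. m - t * j" "\<lambda>k. (m - k) div t"])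
    fix k assume k: "k \<in> {k \<in> {0<..<m}. t dvd m - k}"
    then obtain e where e: "m - k = t * e" by auto
    have "e > 0" using e k by (cases e) auto
    moreover have "e * t \<le> m - 1" using e k by (simp add: mult.commute) linarith
    then have "e \<le> (m - 1) div t"
      using t by (simp add: less_eq_div_iff_mult_less_eq)
    moreover have "k = m - t * e" using e k by auto
    ultimately show "m - t * ((m - k) div t) = k" "(m - k) div t \<in> {1..(m - 1) div t}"
      using e t by auto
    show "1 - (s / of_nat ((m - k) div t))\<^sup>2 = ?f k"
      unfolding e using t by simp
  next
    fix j assume j: "j \<in> {1..(m - 1) div t}"
    then have "t * j \<le> m - 1" using t by (simp add: less_eq_div_iff_mult_less_eq mult.commute)
    then have "m - (m - t * j) = t * j" "t * j < m" using m by auto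
    moreover have "t * j > 0" using j t by simp
    ultimately show "(m - (m - t * j)) div t = j" "m - t * j \<in> {k \<in> {0<..<m}. t dvd m - k}"
      using t m by auto
  qed
  also have "\<dots> = rising (s + 1) ((m - 1) div t) * rising (1 - s) ((m - 1) div t)"
    by (rule rising_prod[symmetric])
  finally show ?thesis .
qed

text \<open>The case of a single index: the right-hand side is \<open>set_weight t s {m}\<close>.
  Larger minors multiply such factors by corrections for pairs.\<close>

lemma Wc_diagonal:
  assumes t: "odd t" and gen: "\<And>n::int. of_nat t * s \<noteq> of_int n" and m: "m > 0"
  shows "Wc t s m (int m) =
     (if t dvd m then (1 - of_nat t * s / of_nat m) * (1 - of_nat t * s / of_nat (2 * m)) else 1) *
     (\<Prod>k\<in>{0<..<m}. if t dvd m - k then 1 - (of_nat t * s / of_nat (m - k))\<^sup>2 else 1)"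
proof -
  have t0: "t > 0" using t odd_pos by blast
  have s0: "s \<noteq> 0" using gen[of 0] by auto
  show ?thesis
  proof (cases "t dvd m")
    case True
    then obtain \<mu> where m': "m = t * Suc \<mu>" using m by (metis dvdE gr0_implies_Suc mult_0_right not_gr0)
    have dv: "(m - 1) div t = \<mu>"
    proof -
      have "j \<le> (m - 1) div t \<longleftrightarrow> j \<le> \<mu>" for j
      proof -
        have "j \<le> (m - 1) div t \<longleftrightarrow> t * j < m"
          using t0 m by (auto simp: less_eq_div_iff_mult_less_eq mult.commute)
        also have "\<dots> \<longleftrightarrow> j < Suc \<mu>" unfolding m' using t0 by (simp only: mult_less_cancel1 simp_thms)
        finally show ?thesis by auto
      qed
      then show ?thesis by (meson order_antisym order_refl)
    qed
    define p a b where "p = (of_nat (Suc \<mu>) :: complex)" and "a = rising (s + 1) \<mu>" and "b = rising (1 - s) \<mu>"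
    have p: "p \<noteq> 0" unfolding p_def by (simp del: of_nat_Suc)
    have "s + p \<noteq> 0"
    proof
      assume "s + p = 0"
      then have "s = - p" by (simp only: eq_neg_iff_add_eq_0)
      then have "of_nat t * s = - of_nat (t * Suc \<mu>)" unfolding p_def by (simp only: of_nat_mult mult_minus_right)
      then have "of_nat t * s = of_int (- int (t * Suc \<mu>))" by (simp only: of_int_minus of_int_of_nat_eq)
      then show False using gen by blast
    qed
    have "Wc t s m (int m) * ((s + p) * (2 * p) * s) = s * (a * (s + p) / p) * b * (p - s) * (2 * p - s)"
    proof -
      have "of_nat (Suc \<mu> + Suc \<mu>) = 2 * p" by (simp add: p_def)
      then show ?thesis
        using Wc_entry_multiples[OF t0, of s \<mu> \<mu>]
        unfolding m' rising_one_plus_Suc a_def b_def p_def by (simp only: diff_self add_0)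
    qed
    also have "s * (a * (s + p) / p) * b * (p - s) * (2 * p - s) =
        (1 - s / p) * (1 - s / (2 * p)) * (a * b) * ((s + p) * (2 * p) * s)"
    proof -
      have "1 - s / p = (p - s) / p" "1 - s / (2 * p) = (2 * p - s) / (2 * p)"
        using p by (simp_all add: diff_divide_distrib)
      then show ?thesis using p by simp
    qed
    finally have "Wc t s m (int m) = (1 - s / p) * (1 - s / (2 * p)) * (a * b)"
      using p s0 \<open>s + p \<noteq> 0\<close> by simp
    moreover have "of_nat t * s / of_nat m = s / p" "of_nat t * s / of_nat (2 * m) = s / (2 * p)"
    proof -
      have m1: "of_nat m = of_nat t * p" unfolding m' p_def by (rule of_nat_mult)
      then have m2: "of_nat (2 * m) = of_nat t * (2 * p)" by simp
      show "of_nat t * s / of_nat m = s / p" "of_nat t * s / of_nat (2 * m) = s / (2 * p)"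
        unfolding m1 m2 using t0 by simp_all
    qed
    ultimately show ?thesis
      unfolding prod_residue_hooks[OF t0 m] dv a_def b_def using True by (simp only: if_True)
  next
    case False
    have "Wc t s m (int m) * (of_nat t * s) =
        (rising (s + 1) (m div t) * rising (1 - s) (m div t)) * (of_nat t * s)"
      using Wc_entry_same[OF t False refl, of s] by simp
    then have W: "Wc t s m (int m) = rising (s + 1) (m div t) * rising (1 - s) (m div t)"
      using t0 s0 by simp
    have "(m - 1) div t = m div t"
    proof -
      have "j \<le> (m - 1) div t \<longleftrightarrow> j \<le> m div t" for j
      proof -
        have "j \<le> (m - 1) div t \<longleftrightarrow> j * t < m"
          using t0 m by (auto simp: less_eq_div_iff_mult_less_eq)
        also have "\<dots> \<longleftrightarrow> j * t \<le> m" using False by (auto simp: order_le_less)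
        also have "\<dots> \<longleftrightarrow> j \<le> m div t" using t0 by (simp add: less_eq_div_iff_mult_less_eq)
        finally show ?thesis .
      qed
      then show ?thesis by (meson order_antisym order_refl)
    qed
    then show ?thesis unfolding prod_residue_hooks[OF t0 m] W using False by (simp only: if_False mult_1)
  qed
qed

lemma one_minus_div_ne_0:
  assumes "\<And>n::int. \<sigma> \<noteq> of_int n"
  shows "1 - (\<sigma> / of_nat k)\<^sup>2 \<noteq> (0::complex)" "1 - \<sigma> / of_nat k \<noteq> 0"
proof -
  show "1 - \<sigma> / of_nat k \<noteq> 0"
  proof
    assume *: "1 - \<sigma> / of_nat k = 0"
    then have "k \<noteq> 0" by (intro notI) simp
    then have "\<sigma> = of_int (int k)" using * by (simp add: field_simps)
    then show False using assms by blast
  qed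
  show "1 - (\<sigma> / of_nat k)\<^sup>2 \<noteq> 0"
  proof
    assume "1 - (\<sigma> / of_nat k)\<^sup>2 = 0"
    then have *: "\<sigma> / of_nat k = 1 \<or> \<sigma> / of_nat k = - 1" by (simp add: power2_eq_1_iff)
    then have "k \<noteq> 0" by (intro notI) simp
    then have "\<sigma> = of_int (int k) \<or> \<sigma> = of_int (- int k)" using * by (auto simp: field_simps)
    then show False using assms by blast
  qed
qed

text \<open>The 2 x 2 minor of k and m divided by its diagonal product, in Cauchy form. Adding k to
  M removes the hook of length m - k and creates one of length m + k; these are the two factors on
  the right.\<close>

lemma pair_factor:
  assumes t: "odd t" and gen: "\<And>n::int. \<sigma> \<noteq> of_int n" and km: "0 < k" "k < m"
    and cl: "res_class t k = res_class t m"
  shows "1 - (row_node t \<sigma> k - col_node t \<sigma> k) * (row_node t \<sigma> m - col_node t \<sigma> m) /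
       ((row_node t \<sigma> k - col_node t \<sigma> m) * (row_node t \<sigma> m - col_node t \<sigma> k)) =
    (if t dvd m + k then 1 - (\<sigma> / of_nat (m + k))\<^sup>2 else 1) /
    (if t dvd m - k then 1 - (\<sigma> / of_nat (m - k))\<^sup>2 else 1)"
proof -
  have t0: "t > 0" using t odd_pos by blast
  define a b where "a = (of_nat m :: complex)" and "b = (of_nat k :: complex)"
  have ab: "of_nat (m + k) = a + b" "of_nat (m - k) = a - b" using km by (simp_all add: a_def b_def of_nat_diff)
  have ne: "a + b \<noteq> 0" "a - b \<noteq> 0" using km unfolding ab[symmetric] by (simp_all only: of_nat_eq_0_iff)
  have ne2: "1 - (\<sigma> / (a - b))\<^sup>2 \<noteq> 0" using one_minus_div_ne_0(1)[OF gen, of "m - k"] unfolding ab .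
  have sq: "(a - b)\<^sup>2 - \<sigma>\<^sup>2 \<noteq> 0"
  proof
    assume "(a - b)\<^sup>2 - \<sigma>\<^sup>2 = 0"
    then have "\<sigma>\<^sup>2 = (a - b)\<^sup>2" by simp
    then have "(\<sigma> / (a - b))\<^sup>2 = 1" unfolding power_divide using ne by simp
    then show False using ne2 by simp
  qed
  have q: "1 - (\<sigma> / (a - b))\<^sup>2 = ((a - b)\<^sup>2 - \<sigma>\<^sup>2) / (a - b)\<^sup>2" using ne by (simp add: power_divide diff_divide_distrib)
  have r: "1 - (\<sigma> / (a + b))\<^sup>2 = ((a + b)\<^sup>2 - \<sigma>\<^sup>2) / (a + b)\<^sup>2" using ne by (simp add: power_divide diff_divide_distrib)
  have fac: "(b - a + \<sigma>) * (a - b + \<sigma>) = - ((a - b)\<^sup>2 - \<sigma>\<^sup>2)" by (simp add: power2_eq_square algebra_simps)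
  show ?thesis
  proof (cases "t dvd m")
    case True
    then have dk: "t dvd k" using res_class_dvd_iff[OF t] cl by simp
    have d: "t dvd m + k" "t dvd m - k" using True dk by (auto simp: dvd_diff_nat)
    have "1 - (b + b) * (b - b + \<sigma>) * ((a + a) * (a - a + \<sigma>)) /
        ((b + a) * (b - a + \<sigma>) * ((a + b) * (a - b + \<sigma>))) =
        1 + (2 * b * \<sigma>) * (2 * a * \<sigma>) / ((a + b)\<^sup>2 * ((a - b)\<^sup>2 - \<sigma>\<^sup>2))"
    proof -
      have "(b + a) * (b - a + \<sigma>) * ((a + b) * (a - b + \<sigma>)) = - ((a + b)\<^sup>2 * ((a - b)\<^sup>2 - \<sigma>\<^sup>2))"
        by (simp add: power2_eq_square algebra_simps)
      then show ?thesis by simp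
    qed
    also have "\<dots> = (((a + b)\<^sup>2 * ((a - b)\<^sup>2 - \<sigma>\<^sup>2)) + (2 * b * \<sigma>) * (2 * a * \<sigma>)) / ((a + b)\<^sup>2 * ((a - b)\<^sup>2 - \<sigma>\<^sup>2))"
      using ne sq by (simp add: add_divide_distrib)
    \<comment> \<open>The numerator factors because (a + b)^2 - 4 a b = (a - b)^2.\<close>
    also have "((a + b)\<^sup>2 * ((a - b)\<^sup>2 - \<sigma>\<^sup>2)) + (2 * b * \<sigma>) * (2 * a * \<sigma>) = (a - b)\<^sup>2 * ((a + b)\<^sup>2 - \<sigma>\<^sup>2)"
      by (simp add: power2_eq_square algebra_simps)
    also have "(a - b)\<^sup>2 * ((a + b)\<^sup>2 - \<sigma>\<^sup>2) / ((a + b)\<^sup>2 * ((a - b)\<^sup>2 - \<sigma>\<^sup>2)) =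
        (1 - (\<sigma> / (a + b))\<^sup>2) / (1 - (\<sigma> / (a - b))\<^sup>2)"
      unfolding q r by simp
    finally have main: "1 - (b + b) * (b - b + \<sigma>) * ((a + a) * (a - a + \<sigma>)) /
        ((b + a) * (b - a + \<sigma>) * ((a + b) * (a - b + \<sigma>))) =
        (1 - (\<sigma> / (a + b))\<^sup>2) / (1 - (\<sigma> / (a - b))\<^sup>2)" .
    have n: "row_node t \<sigma> k - col_node t \<sigma> k = (b + b) * (b - b + \<sigma>)"
        "row_node t \<sigma> m - col_node t \<sigma> m = (a + a) * (a - a + \<sigma>)"
        "row_node t \<sigma> k - col_node t \<sigma> m = (b + a) * (b - a + \<sigma>)"
        "row_node t \<sigma> m - col_node t \<sigma> k = (a + b) * (a - b + \<sigma>)"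
      using True dk cl by (simp_all only: node_diff[OF t] node_diff[OF t cl[symmetric]] node_diff[OF t cl] if_True a_def b_def)
    show ?thesis unfolding n ab using d main by (simp only: if_True)
  next
    case False
    then have dk: "\<not> t dvd k" using res_class_dvd_iff[OF t] cl by simp
    define \<epsilon> where "\<epsilon> j = (if low_res t j then 1 else - 1 :: complex)" for j
    have e2: "\<epsilon> j * \<epsilon> j = 1" for j by (simp add: \<epsilon>_def)
    have n0: "row_node t \<sigma> k - col_node t \<sigma> k = \<epsilon> k * \<sigma>" "row_node t \<sigma> m - col_node t \<sigma> m = \<epsilon> m * \<sigma>"
      using False dk by (simp_all add: node_diff[OF t] \<epsilon>_def)
    show ?thesis
    proof (cases "m mod t = k mod t")
      case same: True
      have d: "t dvd m - k" using same km by (metis less_imp_le mod_eq_dvd_iff_nat)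
      have d': "\<not> t dvd m + k"
      proof
        assume "t dvd m + k"
        from low_res_opposite[OF t False this] low_res_same[OF same] show False by simp
      qed
      have n: "row_node t \<sigma> k - col_node t \<sigma> m = \<epsilon> k * (b - a + \<sigma>)"
          "row_node t \<sigma> m - col_node t \<sigma> k = \<epsilon> m * (a - b + \<sigma>)"
        using False dk same
        by (simp_all only: node_diff[OF t cl[symmetric]] node_diff[OF t cl] if_False if_True refl \<epsilon>_def a_def b_def)
      have ek: "\<epsilon> k = \<epsilon> m" using low_res_same[OF same] by (simp add: \<epsilon>_def)
      have h: "\<epsilon> m * \<sigma> * (\<epsilon> m * \<sigma>) = \<sigma>\<^sup>2"
        "\<epsilon> m * (b - a + \<sigma>) * (\<epsilon> m * (a - b + \<sigma>)) = - ((a - b)\<^sup>2 - \<sigma>\<^sup>2)"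
        using e2[of m] fac by (simp_all add: power2_eq_square mult_ac)
      have "1 - \<epsilon> k * \<sigma> * (\<epsilon> m * \<sigma>) / (\<epsilon> k * (b - a + \<sigma>) * (\<epsilon> m * (a - b + \<sigma>))) =
          1 + \<sigma>\<^sup>2 / ((a - b)\<^sup>2 - \<sigma>\<^sup>2)"
        unfolding ek h by (simp only: divide_minus_right diff_minus_eq_add)
      also have "\<dots> = (a - b)\<^sup>2 / ((a - b)\<^sup>2 - \<sigma>\<^sup>2)" using sq by (simp add: field_simps)
      also have "\<dots> = 1 / (1 - (\<sigma> / (a - b))\<^sup>2)" unfolding q by simp
      finally show ?thesis unfolding n0 n ab using d d' by (simp only: if_True if_False)
    next
      case opp: False
      have d: "t dvd m + k" using res_class_eq_iff[OF t] cl opp by metis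
      have d': "\<not> t dvd m - k" using opp km by (metis less_imp_le mod_eq_dvd_iff_nat)
      have n: "row_node t \<sigma> k - col_node t \<sigma> m = \<epsilon> k * (b + a)"
          "row_node t \<sigma> m - col_node t \<sigma> k = \<epsilon> m * (a + b)"
        using False dk opp
        by (simp_all only: node_diff[OF t cl[symmetric]] node_diff[OF t cl] if_False refl \<epsilon>_def a_def b_def eq_commute[of "k mod t"])
      have "\<epsilon> k \<noteq> 0" "\<epsilon> m \<noteq> 0" by (simp_all add: \<epsilon>_def)
      then have "1 - \<epsilon> k * \<sigma> * (\<epsilon> m * \<sigma>) / (\<epsilon> k * (b + a) * (\<epsilon> m * (a + b))) = 1 - (\<sigma> / (a + b))\<^sup>2"
        by (simp add: power2_eq_square add.commute)
      then show ?thesis unfolding n0 n ab using d d' by (simp only: if_True if_False div_by_1)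
    qed
  qed
qed

text \<open>Eliminating e from a Cauchy block multiplies row i by (x_i - x_e) / (x_i - y_e) and
  column j by (y_e - y_j) / (x_e - y_j); other classes are left alone. So
  \<open>set_det_elimination_product\<close> applies, and \<open>Wc_diagonal\<close> and
  \<open>pair_factor\<close> evaluate its factors.\<close>

lemma set_det_Wc_generic:
  assumes t: "odd t" and gen: "\<And>n::int. of_nat t * s \<noteq> of_int n" and M: "finite M" "0 \<notin> M"
  shows "set_det M (\<lambda>m c. Wc t s c (int m)) = set_weight t s M"
proof -
  let ?A = "\<lambda>m c. Wc t s c (int m)" and ?\<sigma> = "of_nat t * s"
  let ?X = "row_node t ?\<sigma>" and ?Y = "col_node t ?\<sigma>" and ?a = "row_factor t s" and ?b = "col_factor t s"
  let ?cl = "res_class t"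
  have pos: "m > 0" if "m \<in> M" for m using that M by (metis not_gr0)
  have A: "?A m c = (if ?cl m = ?cl c then ?a m * ?b c / (?X m - ?Y c) else 0)"
    and ne: "?cl m = ?cl c \<Longrightarrow> ?X m - ?Y c \<noteq> 0" if "m \<in> M" "c \<in> M" for m c
    using Wc_cauchy[OF t gen pos[OF that(1)] pos[OF that(2)]] by blast+
  have diag: "?A m m \<noteq> 0" if "m \<in> M" for m
    unfolding Wc_diagonal[OF t gen pos[OF that]]
    using one_minus_div_ne_0(1)[OF gen] one_minus_div_ne_0(2)[OF gen, of m] one_minus_div_ne_0(2)[OF gen, of "2 * m"]
    by (simp del: of_nat_mult of_nat_Suc of_nat_diff)
  have ab: "?a m \<noteq> 0" "?b m \<noteq> 0" if "m \<in> M" for m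
    using diag[OF that] A[OF that that] by auto
  define \<rho> where "\<rho> e i = (if ?cl i = ?cl e then (?X i - ?X e) / (?X i - ?Y e) else 1)" for e i
  define \<tau> where "\<tau> e j = (if ?cl j = ?cl e then (?Y e - ?Y j) / (?X e - ?Y j) else 1)" for e j
  have "set_det M ?A = (\<Prod>m\<in>M. ?A m m * (\<Prod>k | k \<in> M \<and> k < m. 1 - ?A k m * ?A m k / (?A k k * ?A m m)))"
  proof (rule set_det_elimination_product[OF M(1) diag])
    fix e i j assume eij: "e \<in> M" "i \<in> M" "j \<in> M"
    show "?A i j - ?A i e / ?A e e * ?A e j = \<rho> e i * \<tau> e j * ?A i j"
    proof (cases "?cl i = ?cl e \<and> ?cl j = ?cl e")
      case True
      have cauchy: "p * q / (xi - yj) - (p * q' / (xi - ye)) / (p' * q' / (xe - ye)) * (p' * q / (xe - yj)) =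
          (xi - xe) / (xi - ye) * ((ye - yj) / (xe - yj)) * (p * q / (xi - yj))"
        if "xi - yj \<noteq> 0" "xi - ye \<noteq> 0" "xe - ye \<noteq> 0" "xe - yj \<noteq> 0" "p' \<noteq> 0" "q' \<noteq> 0"
        for p q p' q' xi xe yj ye :: complex
      proof -
        have "(p * q' / (xi - ye)) / (p' * q' / (xe - ye)) * (p' * q / (xe - yj)) =
            p * q * ((xe - ye) / ((xi - ye) * (xe - yj)))"
          using that by simp
        moreover have "1 / (xi - yj) - (xe - ye) / ((xi - ye) * (xe - yj)) =
            ((xi - ye) * (xe - yj) - (xi - yj) * (xe - ye)) / ((xi - yj) * ((xi - ye) * (xe - yj)))"
          using that by (simp add: diff_divide_distrib)
        moreover have "(xi - ye) * (xe - yj) - (xi - yj) * (xe - ye) = (xi - xe) * (ye - yj)"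
          by (simp add: algebra_simps)
        moreover have "p * q / (xi - yj) - p * q * ((xe - ye) / ((xi - ye) * (xe - yj))) =
            p * q * (1 / (xi - yj) - (xe - ye) / ((xi - ye) * (xe - yj)))"
          by (simp add: right_diff_distrib)
        ultimately show ?thesis by (simp add: mult_ac)
      qed
      show ?thesis
        using A eij True ne ab cauchy[of "?X i" "?Y j" "?Y e" "?X e" "?a e" "?b e" "?a i" "?b j"]
        by (simp add: \<rho>_def \<tau>_def)
    next
      case False
      then show ?thesis using A eij by (auto simp: \<rho>_def \<tau>_def)
    qed
  qed
  also have "\<dots> = set_weight t s M"
    unfolding set_weight_def
  proof (intro prod.cong refl)
    fix m assume m: "m \<in> M"
    let ?p = "\<lambda>k. if t dvd m + k then 1 - (?\<sigma> / of_nat (m + k))\<^sup>2 else 1"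
    let ?q = "\<lambda>k. if t dvd m - k then 1 - (?\<sigma> / of_nat (m - k))\<^sup>2 else 1"
    have q0: "?q k \<noteq> 0" for k using one_minus_div_ne_0(1)[OF gen] by simp
    have cancel: "b * (a / b) = a" if "b \<noteq> 0" for a b :: complex using that by simp
    have "(\<Prod>k | k \<in> M \<and> k < m. 1 - ?A k m * ?A m k / (?A k k * ?A m m)) = (\<Prod>k | k \<in> M \<and> k < m. ?p k / ?q k)"
    proof (intro prod.cong refl)
      fix k assume "k \<in> {k. k \<in> M \<and> k < m}"
      then have k: "k \<in> M" "0 < k" "k < m" using pos by auto
      show "1 - ?A k m * ?A m k / (?A k k * ?A m m) = ?p k / ?q k"
      proof (cases "?cl k = ?cl m")
        case True
        have "?A k m * ?A m k / (?A k k * ?A m m) = (?X k - ?Y k) * (?X m - ?Y m) / ((?X k - ?Y m) * (?X m - ?Y k))"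
          using A[OF k(1) m] A[OF m k(1)] A[OF m m] A[OF k(1) k(1)] True ab[OF m] ab[OF k(1)]
          by simp
        then show ?thesis using pair_factor[OF t gen k(2,3) True] by simp
      next
        case False
        then have "\<not> t dvd m + k" "\<not> t dvd m - k"
          using res_class_eq_iff[OF t, of k m] k(3)
          by (metis add.commute, metis less_imp_le mod_eq_dvd_iff_nat)
        then show ?thesis using A[OF k(1) m] False by simp
      qed
    qed
    \<comment> \<open>Letting all k < m take part aligns this product with the one in the diagonal
      entry; for k in M the factor of m - k then cancels.\<close>
    also have "\<dots> = (\<Prod>k\<in>{0<..<m}. if k \<in> M then ?p k / ?q k else 1)"
      by (rule prod.mono_neutral_cong_left) (use pos in auto)
    finally have "?A m m * (\<Prod>k | k \<in> M \<and> k < m. 1 - ?A k m * ?A m k / (?A k k * ?A m m)) =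
        (if t dvd m then (1 - ?\<sigma> / of_nat m) * (1 - ?\<sigma> / of_nat (2 * m)) else 1) *
        (\<Prod>k\<in>{0<..<m}. ?q k * (if k \<in> M then ?p k / ?q k else 1))"
      unfolding Wc_diagonal[OF t gen pos[OF m]] by (simp only: prod.distrib mult.assoc)
    also have "(\<Prod>k\<in>{0<..<m}. ?q k * (if k \<in> M then ?p k / ?q k else 1)) =
        (\<Prod>k\<in>{0<..<m}.
          if k \<notin> M \<and> t dvd m - k then 1 - (?\<sigma> / of_nat (m - k))\<^sup>2
          else if k \<in> M \<and> t dvd m + k then 1 - (?\<sigma> / of_nat (m + k))\<^sup>2 else 1)"
    proof (intro prod.cong refl)
      fix k
      show "?q k * (if k \<in> M then ?p k / ?q k else 1) =
          (if k \<notin> M \<and> t dvd m - k then 1 - (?\<sigma> / of_nat (m - k))\<^sup>2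
          else if k \<in> M \<and> t dvd m + k then 1 - (?\<sigma> / of_nat (m + k))\<^sup>2 else 1)"
      proof (cases "k \<in> M")
        case True
        then have "?q k * (if k \<in> M then ?p k / ?q k else 1) = ?p k"
          by (simp only: True if_True cancel[OF q0])
        then show ?thesis using True by (simp only: simp_thms if_False)
      qed simp
    qed
    finally show "?A m m * (\<Prod>k | k \<in> M \<and> k < m. 1 - ?A k m * ?A m k / (?A k k * ?A m m)) =
        (if t dvd m then (1 - ?\<sigma> / of_nat m) * (1 - ?\<sigma> / of_nat (2 * m)) else 1) *
        (\<Prod>k\<in>{0<..<m}.
          if k \<notin> M \<and> t dvd m - k then 1 - (?\<sigma> / of_nat (m - k))\<^sup>2
          else if k \<in> M \<and> t dvd m + k then 1 - (?\<sigma> / of_nat (m + k))\<^sup>2 else 1)" .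
  qed
  finally show ?thesis .
qed

text \<open>Minor and weight are continuous in s, and the excluded values of s lie 1/t apart, so
  each of them is a limit of generic ones.\<close>

theorem set_det_Wc:
  assumes t: "odd t" and M: "finite M" "0 \<notin> M"
  shows "set_det M (\<lambda>m c. Wc t s c (int m)) = set_weight t s M"
proof (cases "\<exists>n::int. of_nat t * s = of_int n")
  case False
  then show ?thesis using set_det_Wc_generic[OF t _ M] by blast
next
  case True
  then obtain n :: int where n: "of_nat t * s = of_int n" by blast
  have t0: "t > 0" using t odd_pos by blast
  let ?f = "\<lambda>s. set_det M (\<lambda>m c. Wc t s c (int m))" and ?g = "\<lambda>s. set_weight t s M"
  have "isCont (\<lambda>s. Wc t s c (int m)) s" for c m
    using Wc_deriv[OF t0, of "int m" c "m + c" s] by (auto intro: DERIV_isCont)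
  then have f: "(?f \<longlongrightarrow> ?f s) (at s)"
    unfolding set_det_def isCont_def by (intro tendsto_intros)
  have g: "(?g \<longlongrightarrow> ?g s) (at s)"
  proof -
    have c1: "isCont (\<lambda>s. of_nat t * s / of_nat k) s" for k :: nat
      unfolding divide_inverse by (intro continuous_intros)
    have c2: "isCont (\<lambda>s. if P then f s else g s) s" if "isCont f s" "isCont g s"
      for P and f g :: "complex \<Rightarrow> complex"
      using that by (cases P) auto
    have "isCont ?g s"
      unfolding set_weight_def by (intro continuous_intros c1 c2)
    then show ?thesis by (simp add: isCont_def)
  qed
  have "\<forall>\<^sub>F u in at s. ?f u = ?g u"
    unfolding eventually_at
  proof (intro exI conjI ballI impI)
    show "(1 :: real) / of_nat t > 0" using t0 by simp
    fix u assume u: "u \<noteq> s \<and> dist u s < 1 / of_nat t"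
    have "of_nat t * u \<noteq> of_int k" for k :: int
    proof
      assume k: "of_nat t * u = of_int k"
      then have e: "of_nat t * (u - s) = of_int (k - n)" using n by (simp add: right_diff_distrib)
      then have "norm (of_nat t * (u - s)) = \<bar>real_of_int (k - n)\<bar>" by (metis norm_of_int)
      moreover have "norm (of_nat t * (u - s)) < 1"
      proof -
        have "norm (of_nat t * (u - s)) = real t * dist u s"
          by (simp only: norm_mult norm_of_nat dist_norm)
        then show ?thesis using u t0 by (simp add: field_simps)
      qed
      ultimately have "k - n = 0" by linarith
      then show False using e u t0 by simp
    qed
    then show "?f u = ?g u" using set_det_Wc_generic[OF t _ M] by blast
  qed
  then have "(?g \<longlongrightarrow> ?f s) (at s)" using f by (rule Lim_transform_eventually[rotated])
  then show ?thesis using g by (rule tendsto_unique[OF trivial_limit_at])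
qed

section \<open>The Fredholm determinant of the kernel\<close>

text \<open>Agreement of the coefficients up to n, put as divisibility because
  \<open>jacobi_formula_dvd\<close> delivers it in that form.\<close>

definition fcong :: "nat \<Rightarrow> complex fps \<Rightarrow> complex fps \<Rightarrow> bool" where
  "fcong n f g \<longleftrightarrow> fps_X ^ Suc n dvd f - g"

lemma X_power_dvd_iff: "fps_X ^ k dvd (f :: complex fps) \<longleftrightarrow> (\<forall>i<k. f $ i = 0)"
proof
  assume "fps_X ^ k dvd f"
  then obtain h where "f = fps_X ^ k * h" by (elim dvdE)
  then show "\<forall>i<k. f $ i = 0" by (simp add: fps_X_power_mult_nth)
next
  assume "\<forall>i<k. f $ i = 0"
  then have "f = fps_X ^ k * Abs_fps (\<lambda>i. f $ (i + k))"
    by (intro fps_ext) (simp add: fps_X_power_mult_nth)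
  then show "fps_X ^ k dvd f" by (rule dvdI)
qed

lemma fcong_iff: "fcong n f g \<longleftrightarrow> (\<forall>i\<le>n. f $ i = g $ i)"
  by (auto simp: fcong_def X_power_dvd_iff less_Suc_eq_le simp del: power_Suc)

lemma fcong_refl [simp]: "fcong n f f"
  by (simp add: fcong_def)

lemma fcong_sym: "fcong n f g \<Longrightarrow> fcong n g f"
  by (simp add: fcong_iff)

lemma fcong_trans [trans]: "fcong n f g \<Longrightarrow> fcong n g h \<Longrightarrow> fcong n f h"
  by (simp add: fcong_iff)

lemma fcong_eq_trans [trans]:
  "f = g \<Longrightarrow> fcong n g h \<Longrightarrow> fcong n f h"
  "fcong n f g \<Longrightarrow> g = h \<Longrightarrow> fcong n f h"
  by simp_all

lemma fcong_add: "fcong n f g \<Longrightarrow> fcong n f' g' \<Longrightarrow> fcong n (f + f') (g + g')"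
  by (simp add: fcong_iff)

lemma fcong_diff: "fcong n f g \<Longrightarrow> fcong n f' g' \<Longrightarrow> fcong n (f - f') (g - g')"
  by (simp add: fcong_iff)

lemma fcong_uminus: "fcong n f g \<Longrightarrow> fcong n (- f) (- g)"
  by (simp add: fcong_iff)

lemma fcong_mult: "fcong n f g \<Longrightarrow> fcong n f' g' \<Longrightarrow> fcong n (f * f') (g * g')"
  by (simp add: fcong_iff fps_mult_nth)

lemma fcong_sum: "(\<And>i. i \<in> I \<Longrightarrow> fcong n (f i) (g i)) \<Longrightarrow> fcong n (sum f I) (sum g I)"
  by (simp add: fcong_iff fps_sum_nth)

lemma fcong_0_power: "k > n \<Longrightarrow> fcong n (fps_X ^ k * f) 0"
  by (simp add: fcong_iff fps_X_power_mult_nth)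

lemma fcong_cancel_one_minus_power:
  assumes "K > 0" "fcong n ((1 - fps_X ^ K) * f) ((1 - fps_X ^ K) * g)"
  shows "fcong n f g"
proof -
  have u: "inverse (1 - fps_X ^ K) * (1 - fps_X ^ K :: complex fps) = 1"
    using assms(1) by (intro inverse_mult_eq_1) simp
  have "inverse (1 - fps_X ^ K) * ((1 - fps_X ^ K) * h) = h" for h :: "complex fps"
    using u by (metis mult.assoc mult_1)
  moreover have "fcong n (inverse (1 - fps_X ^ K) * ((1 - fps_X ^ K) * f)) (inverse (1 - fps_X ^ K) * ((1 - fps_X ^ K) * g))"
    by (rule fcong_mult[OF fcong_refl assms(2)])
  ultimately show ?thesis by metis
qed

section \<open>The truncated resolvent\<close>

primrec mat_power :: "nat \<Rightarrow> (nat \<Rightarrow> nat \<Rightarrow> complex fps) \<Rightarrow> nat \<Rightarrow> nat \<Rightarrow> nat \<Rightarrow> complex fps" where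
  "mat_power n A 0 = (\<lambda>i j. if i = j then 1 else 0)"
| "mat_power n A (Suc l) = (\<lambda>i j. \<Sum>k=1..n. mat_power n A l i k * A k j)"

lemma mat_power_Suc_left:
  assumes "i \<in> {1..n}" "j \<in> {1..n}"
  shows "mat_power n A (Suc l) i j = (\<Sum>k=1..n. A i k * mat_power n A l k j)"
  using assms
proof (induction l arbitrary: i j)
  case 0
  then show ?case by (simp add: if_distrib[of "\<lambda>x. x * _"] if_distrib[of "\<lambda>x. _ * x"] cong: if_cong)
next
  case (Suc l)
  have "mat_power n A (Suc (Suc l)) i j = (\<Sum>k=1..n. mat_power n A (Suc l) i k * A k j)" by simp
  also have "\<dots> = (\<Sum>k=1..n. (\<Sum>m=1..n. A i m * mat_power n A l m k) * A k j)"
    using Suc by (intro sum.cong refl arg_cong2[where f="(*)"]) auto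
  also have "\<dots> = (\<Sum>m=1..n. A i m * mat_power n A (Suc l) m j)"
    by (simp add: sum_distrib_left sum_distrib_right mult.assoc) (rule sum.swap)
  finally show ?case .
qed

text \<open>The geometric series for the inverse of 1 - A up to the power n. Every row of
  \<open>weighted_matrix\<close> with index in 1..n is divisible by x, so the power n + 1 vanishes
  modulo x^(n+1).\<close>

definition resolvent :: "nat \<Rightarrow> (nat \<Rightarrow> nat \<Rightarrow> complex fps) \<Rightarrow> nat \<Rightarrow> nat \<Rightarrow> complex fps" where
  "resolvent n A i j = (\<Sum>l\<le>n. mat_power n A l i j)"

lemma resolvent_step:
  assumes A: "\<And>i j. i \<in> {1..n} \<Longrightarrow> fps_X dvd A i j"
  shows "fcong n (\<Sum>l\<le>n. mat_power n A (Suc l) i j) (resolvent n A i j - (if i = j then 1 else 0))"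
proof -
  have d: "fps_X ^ l dvd mat_power n A l i j" for l i j
  proof (induction l arbitrary: j)
    case (Suc l)
    show ?case unfolding mat_power.simps power_Suc2
      by (intro dvd_sum mult_dvd_mono Suc A)
  qed simp
  have "resolvent n A i j + mat_power n A (Suc n) i j = (if i = j then 1 else 0) + (\<Sum>l\<le>n. mat_power n A (Suc l) i j)"
    unfolding resolvent_def using sum.atMost_Suc_shift[of "\<lambda>l. mat_power n A l i j" n]
    by (simp del: mat_power.simps(2))
  then have "(\<Sum>l\<le>n. mat_power n A (Suc l) i j) - (resolvent n A i j - (if i = j then 1 else 0)) = mat_power n A (Suc n) i j"
    by (simp add: algebra_simps del: mat_power.simps(2))
  then show ?thesis unfolding fcong_def using d[of "Suc n" i j] by (simp del: mat_power.simps(2) power_Suc)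
qed

lemma resolvent_mult_right:
  assumes A: "\<And>i j. i \<in> {1..n} \<Longrightarrow> fps_X dvd A i j"
  shows "fcong n (\<Sum>k=1..n. resolvent n A i k * A k j) (resolvent n A i j - (if i = j then 1 else 0))"
proof -
  have "(\<Sum>k=1..n. resolvent n A i k * A k j) = (\<Sum>l\<le>n. mat_power n A (Suc l) i j)"
    unfolding resolvent_def by (simp add: sum_distrib_right) (rule sum.swap)
  moreover have "fcong n (\<Sum>l\<le>n. mat_power n A (Suc l) i j) (resolvent n A i j - (if i = j then 1 else 0))"
    by (rule resolvent_step) (rule A)
  ultimately show ?thesis by (simp only:)
qed

lemma resolvent_mult_left:
  assumes A: "\<And>i j. i \<in> {1..n} \<Longrightarrow> fps_X dvd A i j" and ij: "i \<in> {1..n}" "j \<in> {1..n}"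
  shows "fcong n (\<Sum>k=1..n. A i k * resolvent n A k j) (resolvent n A i j - (if i = j then 1 else 0))"
proof -
  have "(\<Sum>k=1..n. A i k * resolvent n A k j) = (\<Sum>l\<le>n. mat_power n A (Suc l) i j)"
    unfolding resolvent_def mat_power_Suc_left[OF ij] by (simp add: sum_distrib_left) (rule sum.swap)
  moreover have "fcong n (\<Sum>l\<le>n. mat_power n A (Suc l) i j) (resolvent n A i j - (if i = j then 1 else 0))"
    by (rule resolvent_step) (rule A)
  ultimately show ?thesis by (simp only:)
qed

section \<open>The trace of the s-derivative against the resolvent\<close>

text \<open>For K = t k this is the k-th summand of the derivative in \<open>Wc_deriv\<close>,
  without the factor 1/k.\<close>

definition flow_matrix :: "nat \<Rightarrow> complex \<Rightarrow> nat \<Rightarrow> nat \<Rightarrow> nat \<Rightarrow> complex" where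
  "flow_matrix t s K i j = Wc t s j (int i - int K) - Wc t s (j - K) (int i)"

definition weighted_matrix :: "nat \<Rightarrow> complex \<Rightarrow> nat \<Rightarrow> nat \<Rightarrow> complex fps" where
  "weighted_matrix t s i j = fps_X ^ i * fps_const (Wc t s j (int i))"

text \<open>The weights satisfy \<open>x\<^sup>i\<^sup>+\<^sup>K = x\<^sup>K x\<^sup>i\<close>, so shifting rows and columns under the trace
  expresses the trace of the flow by itself, up to the factor \<open>x\<^sup>K\<close>; the reflection
  formula \<open>Wc_shift\<close> supplies a second such expression.\<close>

lemma flow_trace:
  fixes t k K n :: nat and s :: complex
  assumes t: "odd t" and k: "k > 0" and K: "K = t * k"
  defines "R \<equiv> resolvent n (weighted_matrix t s)"
  defines "Y \<equiv> \<Sum>i=1..n. \<Sum>j=1..n. R j i * (fps_X ^ i * fps_const (flow_matrix t s K i j))"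
  shows "fcong n ((1 - fps_X ^ K) * Y)
    ((if even K then fps_X ^ (K div 2) else 0) + fps_X ^ K * fps_const (of_nat t * s - 2 + (if even k then 1 else 0)))"
proof -
  have t0: "t > 0" using t odd_pos by blast
  have K0: "K > 0" using t0 k K by simp
  let ?A = "weighted_matrix t s"
  let ?x = "fps_X :: complex fps"
  define W where "W i j = fps_const (Wc t s j i)" for i j
  have A: "?A i j = ?x ^ i * W (int i) j" for i j by (simp add: weighted_matrix_def W_def)
  have Xdvd: "fps_X dvd ?A i j" if "i \<in> {1..n}" for i j
    unfolding A using that by (intro dvd_mult2) (auto simp: dvd_power)
  have RA: "fcong n (\<Sum>k=1..n. R i k * ?A k j) (R i j - (if i = j then 1 else 0))" for i j
    unfolding R_def by (rule resolvent_mult_right) (rule Xdvd)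
  \<comment> \<open>The product W R with all integers as row arguments. For a row i in 1..n, x^i
    times it is R minus the identity; row 0 occurs below as well.\<close>
  define V where "V m j = (\<Sum>k=1..n. W m k * R k j)" for m j
  have R: "fcong n (R i j) ((if i = j then 1 else 0) + ?x ^ i * V (int i) j)" if "i \<in> {1..n}" "j \<in> {1..n}" for i j
  proof -
    have "(\<Sum>k=1..n. ?A i k * R k j) = ?x ^ i * V (int i) j"
      unfolding A V_def by (simp add: sum_distrib_left mult.assoc)
    moreover have "fcong n (\<Sum>k=1..n. ?A i k * R k j) (R i j - (if i = j then 1 else 0))"
      unfolding R_def by (rule resolvent_mult_left[OF _ that]) (rule Xdvd)
    ultimately have "fcong n (?x ^ i * V (int i) j) (R i j - (if i = j then 1 else 0))"
      by (simp only:)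
    then show ?thesis by (auto simp: fcong_iff)
  qed
  \<comment> \<open>The contribution of the poles of W, at i + j = K. The identity part of R enters
    only for i = j = K / 2, whence the term x^(K/2) for even K.\<close>
  have pairs: "fcong n (\<Sum>i=1..n. \<Sum>j=1..n. if i + j = K then R j i * ?x ^ i else 0)
      ((if even K then ?x ^ (K div 2) else 0) + ?x ^ K * (\<Sum>j | 1 \<le> j \<and> j < K \<and> j \<le> n \<and> K - j \<le> n. V (int j) (K - j)))"
  proof -
    have "(\<Sum>i=1..n. \<Sum>j=1..n. if i + j = K then R j i * ?x ^ i else 0) =
        (\<Sum>j=1..n. \<Sum>i=1..n. if i = K - j then (if j < K then R j i * ?x ^ i else 0) else 0)"
      by (subst sum.swap, intro sum.cong refl) auto
    also have "\<dots> = (\<Sum>j=1..n. if j < K \<and> K - j \<le> n then R j (K - j) * ?x ^ (K - j) else 0)"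
      by (intro sum.cong refl) auto
    also have "\<dots> = (\<Sum>j | 1 \<le> j \<and> j < K \<and> j \<le> n \<and> K - j \<le> n. R j (K - j) * ?x ^ (K - j))"
      by (rule sum.mono_neutral_cong_right) auto
    also have "fcong n \<dots> (\<Sum>j | 1 \<le> j \<and> j < K \<and> j \<le> n \<and> K - j \<le> n.
        ((if j = K - j then 1 else 0) + ?x ^ j * V (int j) (K - j)) * ?x ^ (K - j))"
      by (intro fcong_sum fcong_mult fcong_refl R) auto
    also have "\<dots> = (\<Sum>j | 1 \<le> j \<and> j < K \<and> j \<le> n \<and> K - j \<le> n.
        (if j = K - j then ?x ^ (K - j) else 0) + ?x ^ K * V (int j) (K - j))"
    proof (intro sum.cong refl)
      fix j assume "j \<in> {j. 1 \<le> j \<and> j < K \<and> j \<le> n \<and> K - j \<le> n}"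
      then have e: "?x ^ j * ?x ^ (K - j) = ?x ^ K" by (simp flip: power_add)
      have gen: "((if q then 1 else 0) + a * v) * b = (if q then b else 0) + (a * b) * v"
        for q and a b v :: "complex fps" by (simp add: algebra_simps)
      show "((if j = K - j then 1 else 0) + ?x ^ j * V (int j) (K - j)) * ?x ^ (K - j) =
          (if j = K - j then ?x ^ (K - j) else 0) + ?x ^ K * V (int j) (K - j)"
        unfolding gen e ..
    qed
    also have "\<dots> = (\<Sum>j | 1 \<le> j \<and> j < K \<and> j \<le> n \<and> K - j \<le> n. if j = K - j then ?x ^ (K - j) else 0)
        + ?x ^ K * (\<Sum>j | 1 \<le> j \<and> j < K \<and> j \<le> n \<and> K - j \<le> n. V (int j) (K - j))"
      by (simp add: sum.distrib sum_distrib_left)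
    also have "fcong n \<dots> ((if even K then ?x ^ (K div 2) else 0)
        + ?x ^ K * (\<Sum>j | 1 \<le> j \<and> j < K \<and> j \<le> n \<and> K - j \<le> n. V (int j) (K - j)))"
    proof (intro fcong_add fcong_refl)
      have "(\<Sum>j | 1 \<le> j \<and> j < K \<and> j \<le> n \<and> K - j \<le> n. if j = K - j then ?x ^ (K - j) else 0) =
          (\<Sum>j | 1 \<le> j \<and> j < K \<and> j \<le> n \<and> K - j \<le> n. if j = K div 2 then (if even K then ?x ^ (K div 2) else 0) else 0)"
      proof (intro sum.cong refl)
        fix j assume "j \<in> {j. 1 \<le> j \<and> j < K \<and> j \<le> n \<and> K - j \<le> n}"
        then have "j < K" by simp
        show "(if j = K - j then ?x ^ (K - j) else 0) =
            (if j = K div 2 then (if even K then ?x ^ (K div 2) else 0) else 0)"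
        proof (cases "j + j = K")
          case True
          then have "K - j = j" "K div 2 = j" "even K" by auto
          then show ?thesis by (simp only: if_True refl)
        next
          case False
          then have "j \<noteq> K - j" "\<not> (even K \<and> j = K div 2)" using \<open>j < K\<close> by (auto elim!: evenE)
          then show ?thesis by (auto simp only: if_False split: if_splits)
        qed
      qed
      also have "\<dots> = (if K div 2 \<le> n then (if even K then ?x ^ (K div 2) else 0) else 0)"
        using K0 by (auto elim!: evenE)
      also have "fcong n \<dots> (if even K then ?x ^ (K div 2) else 0)"
        using fcong_0_power[of n "K div 2" 1] by (auto intro: fcong_sym)
      finally show "fcong n (\<Sum>j | 1 \<le> j \<and> j < K \<and> j \<le> n \<and> K - j \<le> n. if j = K - j then ?x ^ (K - j) else 0)
          (if even K then ?x ^ (K div 2) else 0)" .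
    qed
    finally show ?thesis .
  qed
  show ?thesis
  proof (cases "K \<le> n")
    case False
    \<comment> \<open>Here i - K is negative and j - K truncates to 0, so only pole entries occur;
      moreover x^K vanishes modulo x^(n+1).\<close>
    have "Y = (\<Sum>i=1..n. \<Sum>j=1..n. if i + j = K then R j i * ?x ^ i else 0)"
      unfolding Y_def
    proof (intro sum.cong refl)
      fix i j assume ij: "i \<in> {1..n}" "j \<in> {1..n}"
      then have "flow_matrix t s K i j = (if i + j = K then 1 else 0)"
        using False t0 unfolding flow_matrix_def by (subst Wc_neg) auto
      then show "R j i * (?x ^ i * fps_const (flow_matrix t s K i j)) = (if i + j = K then R j i * ?x ^ i else 0)"
        by simp
    qed
    then have "fcong n Y ((if even K then ?x ^ (K div 2) else 0)
        + ?x ^ K * (\<Sum>j | 1 \<le> j \<and> j < K \<and> j \<le> n \<and> K - j \<le> n. V (int j) (K - j)))"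
      using pairs by (simp only:)
    note Y0 = this
    have X0: "fcong n (?x ^ K * c) 0" for c using False by (intro fcong_0_power) simp
    have "fcong n Y ((if even K then ?x ^ (K div 2) else 0) + 0)"
      by (rule fcong_trans[OF Y0 fcong_add[OF fcong_refl X0]])
    from fcong_diff[OF this X0] have "fcong n (Y - ?x ^ K * Y) ((if even K then ?x ^ (K div 2) else 0) + 0)"
      by (simp only: diff_zero)
    from fcong_trans[OF this fcong_add[OF fcong_refl fcong_sym[OF X0]]]
    show ?thesis by (simp only: left_diff_distrib mult_1)
  next
    case Kn: True
    \<comment> \<open>P and Q are the sums of R along its K-th superdiagonal and subdiagonal.
      Neither is evaluated; both cancel in the end.\<close>
    define P where "P = (\<Sum>d=1..n-K. R d (d + K))"
    define Q where "Q = (\<Sum>d=1..n-K. R (d + K) d)"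
    \<comment> \<open>The first evaluation, straight from the definition of the flow.\<close>
    have Y1: "Y = (\<Sum>i=1..n. \<Sum>j=1..n. R j i * (?x ^ i * W (int i - int K) j))
        - (\<Sum>i=1..n. \<Sum>j=1..n. R j i * (?x ^ i * W (int i) (j - K)))"
    proof -
      have "fps_const (flow_matrix t s K i j) = W (int i - int K) j - W (int i) (j - K)" for i j
        by (simp add: flow_matrix_def W_def)
      then show ?thesis unfolding Y_def by (simp only: right_diff_distrib sum_subtractf)
    qed
    \<comment> \<open>Rows i < K can meet only the pole, row i = K gives row 0 of W, and for i > K
      the weight x^i = x^K x^(i - K) turns the shifted row into a row of R.\<close>
    have T1: "fcong n (\<Sum>i=1..n. \<Sum>j=1..n. R j i * (?x ^ i * W (int i - int K) j))
        ((\<Sum>i=1..n. \<Sum>j=1..n. if i + j = K then R j i * ?x ^ i else 0) + ?x ^ K * V 0 K + ?x ^ K * P)"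
    proof -
      have W_split: "W (int i - int K) j = (if i + j = K then 1 else 0) + (if K \<le> i then W (int (i - K)) j else 0)"
        if "j \<ge> 1" for i j
      proof (cases "K \<le> i")
        case True
        then show ?thesis using that by (simp add: of_nat_diff)
      next
        case False
        then show ?thesis unfolding W_def using Wc_neg[OF t0, of "int i - int K" s j] by auto
      qed
      have "(\<Sum>i=1..n. \<Sum>j=1..n. R j i * (?x ^ i * W (int i - int K) j)) =
          (\<Sum>i=1..n. \<Sum>j=1..n. (if i + j = K then R j i * ?x ^ i else 0)
             + (if K \<le> i then R j i * (?x ^ i * W (int (i - K)) j) else 0))"
      proof (intro sum.cong refl)
        fix i j assume "j \<in> {1..n}"
        then have "1 \<le> j" by simp
        show "R j i * (?x ^ i * W (int i - int K) j) = (if i + j = K then R j i * ?x ^ i else 0)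
             + (if K \<le> i then R j i * (?x ^ i * W (int (i - K)) j) else 0)"
          unfolding W_split[OF \<open>1 \<le> j\<close>] by (simp add: distrib_left)
      qed
      also have "\<dots> = (\<Sum>i=1..n. \<Sum>j=1..n. if i + j = K then R j i * ?x ^ i else 0)
          + (\<Sum>i=1..n. if K \<le> i then ?x ^ i * V (int (i - K)) i else 0)"
      proof -
        have "(\<Sum>j=1..n. if K \<le> i then R j i * (?x ^ i * W (int (i - K)) j) else 0) =
            (if K \<le> i then ?x ^ i * V (int (i - K)) i else 0)" for i
          by (simp add: V_def sum_distrib_left mult_ac)
        then show ?thesis by (simp only: sum.distrib)
      qed
      also have "(\<Sum>i=1..n. if K \<le> i then ?x ^ i * V (int (i - K)) i else 0) =
          (\<Sum>i=K..n. ?x ^ i * V (int (i - K)) i)"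
        by (rule sum.mono_neutral_cong_right) (use K0 in auto)
      also have "\<dots> = ?x ^ K * V 0 K + (\<Sum>i=Suc K..n. ?x ^ i * V (int (i - K)) i)"
        using Kn by (subst sum.atLeast_Suc_atMost) auto
      also have "(\<Sum>i=Suc K..n. ?x ^ i * V (int (i - K)) i) = ?x ^ K * (\<Sum>d=1..n-K. ?x ^ d * V (int d) (d + K))"
      proof -
        have "(\<Sum>i=Suc K..n. ?x ^ i * V (int (i - K)) i) = (\<Sum>d=1..n-K. ?x ^ (d + K) * V (int d) (d + K))"
          by (rule sum.reindex_bij_witness[of _ "\<lambda>d. d + K" "\<lambda>i. i - K"]) auto
        then show ?thesis by (simp add: sum_distrib_left power_add mult_ac)
      qed
      finally have e: "(\<Sum>i=1..n. \<Sum>j=1..n. R j i * (?x ^ i * W (int i - int K) j)) =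
          (\<Sum>i=1..n. \<Sum>j=1..n. if i + j = K then R j i * ?x ^ i else 0)
          + ?x ^ K * V 0 K + ?x ^ K * (\<Sum>d=1..n-K. ?x ^ d * V (int d) (d + K))"
        by (simp only: add.assoc)
      have "fcong n (\<Sum>d=1..n-K. ?x ^ d * V (int d) (d + K)) P"
        unfolding P_def
      proof (intro fcong_sum)
        fix d assume "d \<in> {1..n - K}"
        then have "fcong n (R d (d + K)) ((if d = d + K then 1 else 0) + ?x ^ d * V (int d) (d + K))"
          by (intro R) auto
        then show "fcong n (?x ^ d * V (int d) (d + K)) (R d (d + K))" using K0 by (simp add: fcong_sym)
      qed
      then show ?thesis unfolding e by (intro fcong_add fcong_mult fcong_refl)
    qed
    have T2: "fcong n (\<Sum>i=1..n. \<Sum>j=1..n. R j i * (?x ^ i * W (int i) (j - K))) Q"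
    proof -
      have W0: "W m 0 = 0" for m using t0 by (simp add: W_def)
      have "(\<Sum>i=1..n. \<Sum>j=1..n. R j i * (?x ^ i * W (int i) (j - K))) =
          (\<Sum>j=1..n. \<Sum>i=1..n. R j i * (?x ^ i * W (int i) (j - K)))" by (rule sum.swap)
      also have "\<dots> = (\<Sum>j=Suc K..n. \<Sum>i=1..n. R j i * (?x ^ i * W (int i) (j - K)))"
        by (rule sum.mono_neutral_right) (auto simp: W0 not_less_eq_eq)
      also have "\<dots> = (\<Sum>d=1..n-K. \<Sum>i=1..n. R (d + K) i * ?A i d)"
        unfolding A by (rule sum.reindex_bij_witness[of _ "\<lambda>d. d + K" "\<lambda>i. i - K"]) auto
      also have "fcong n \<dots> (\<Sum>d=1..n-K. R (d + K) d - (if d + K = d then 1 else 0))"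
        by (intro fcong_sum RA)
      also have "\<dots> = Q" using K0 by (simp add: Q_def)
      finally show ?thesis .
    qed
    \<comment> \<open>The second evaluation: \<open>Wc_shift\<close> trades the downward shift for
      the upward one, and the factor x^K supplies the weight x^(i + K) that row i + K needs.\<close>
    have Y2: "?x ^ K * Y = - (\<Sum>i=1..n. \<Sum>j=1..n. R j i * (?x ^ (i + K) * W (int i + int K) j))
       + ?x ^ K * (\<Sum>i=1..n. \<Sum>j=1..n. R j i * (?x ^ i * W (int i) (j + K)))
       + ?x ^ K * (\<Sum>e=1..K. \<Sum>j=1..n. (\<Sum>i=1..n. R j i * (?x ^ i * W (int i) e)) * W (int K - int e) j)"
    proof -
      have fl: "fps_const (flow_matrix t s K i j) = - W (int i + int K) j + W (int i) (j + K)
          + (\<Sum>e=1..K. W (int K - int e) j * W (int i) e)" if "j \<ge> 1" for i j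
      proof -
        have "flow_matrix t s K i j = - Wc t s j (int i + int K) + Wc t s (j + K) (int i)
            + (\<Sum>e=1..K. Wc t s j (int K - int e) * Wc t s e (int i))"
          using Wc_shift[OF t0, of j s "int i" k] that unfolding flow_matrix_def K[symmetric]
          by (simp add: algebra_simps)
        moreover have "fps_const (sum f I) = (\<Sum>e\<in>I. fps_const (f e))" for f :: "nat \<Rightarrow> complex" and I
          by (induction I rule: infinite_finite_induct) (auto simp flip: fps_const_add)
        ultimately show ?thesis unfolding W_def
          by (simp del: fps_const_add fps_const_neg fps_const_mult
              add: fps_const_add[symmetric] fps_const_neg[symmetric] fps_const_mult[symmetric])
      qed
      have "?x ^ K * Y = (\<Sum>i=1..n. \<Sum>j=1..n. - (R j i * (?x ^ (i + K) * W (int i + int K) j))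
         + ?x ^ K * (R j i * (?x ^ i * W (int i) (j + K)))
         + (\<Sum>e=1..K. ?x ^ K * (R j i * (?x ^ i * W (int i) e) * W (int K - int e) j)))"
        unfolding Y_def sum_distrib_left
        by (intro sum.cong refl) (simp add: fl algebra_simps power_add sum_distrib_left)
      also have "\<dots> = - (\<Sum>i=1..n. \<Sum>j=1..n. R j i * (?x ^ (i + K) * W (int i + int K) j))
         + ?x ^ K * (\<Sum>i=1..n. \<Sum>j=1..n. R j i * (?x ^ i * W (int i) (j + K)))
         + (\<Sum>i=1..n. \<Sum>j=1..n. \<Sum>e=1..K. ?x ^ K * (R j i * (?x ^ i * W (int i) e) * W (int K - int e) j))"
        by (simp only: sum.distrib sum_negf sum_distrib_left)
      also have "(\<Sum>i=1..n. \<Sum>j=1..n. \<Sum>e=1..K. ?x ^ K * (R j i * (?x ^ i * W (int i) e) * W (int K - int e) j)) =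
          (\<Sum>e=1..K. \<Sum>j=1..n. \<Sum>i=1..n. ?x ^ K * (R j i * (?x ^ i * W (int i) e) * W (int K - int e) j))"
      proof -
        have swap3: "(\<Sum>i=1..n. \<Sum>j=1..n. \<Sum>e=1..K. g i j e) = (\<Sum>e=1..K. \<Sum>j=1..n. \<Sum>i=1..n. g i j e)"
          for g :: "nat \<Rightarrow> nat \<Rightarrow> nat \<Rightarrow> complex fps"
        proof -
          have "(\<Sum>i=1..n. \<Sum>j=1..n. \<Sum>e=1..K. g i j e) = (\<Sum>i=1..n. \<Sum>e=1..K. \<Sum>j=1..n. g i j e)"
            by (intro sum.cong refl sum.swap)
          also have "\<dots> = (\<Sum>e=1..K. \<Sum>i=1..n. \<Sum>j=1..n. g i j e)" by (rule sum.swap)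
          also have "\<dots> = (\<Sum>e=1..K. \<Sum>j=1..n. \<Sum>i=1..n. g i j e)"
            by (intro sum.cong refl sum.swap)
          finally show ?thesis .
        qed
        show ?thesis by (rule swap3)
      qed
      finally show ?thesis by (simp add: sum_distrib_left sum_distrib_right)
    qed
    have TA: "fcong n (\<Sum>i=1..n. \<Sum>j=1..n. R j i * (?x ^ (i + K) * W (int i + int K) j)) Q"
    proof -
      have "(\<Sum>i=1..n. \<Sum>j=1..n. R j i * (?x ^ (i + K) * W (int i + int K) j)) =
          (\<Sum>i=1..n. ?x ^ (i + K) * V (int (i + K)) i)"
        by (simp add: V_def sum_distrib_left mult_ac)
      also have "fcong n \<dots> (\<Sum>i=1..n. if i \<le> n - K then R (i + K) i else 0)"
      proof (intro fcong_sum)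
        fix i assume i: "i \<in> {1..n}"
        show "fcong n (?x ^ (i + K) * V (int (i + K)) i) (if i \<le> n - K then R (i + K) i else 0)"
        proof (cases "i \<le> n - K")
          case True
          then have "fcong n (R (i + K) i) ((if i + K = i then 1 else 0) + ?x ^ (i + K) * V (int (i + K)) i)"
            using i Kn by (intro R) auto
          then show ?thesis using True K0 by (simp add: fcong_sym)
        next
          case False
          then show ?thesis by (simp add: fcong_0_power)
        qed
      qed
      also have "(\<Sum>i=1..n. if i \<le> n - K then R (i + K) i else 0) = Q"
        unfolding Q_def by (rule sum.mono_neutral_cong_right) auto
      finally show ?thesis .
    qed
    have TB: "fcong n (?x ^ K * (\<Sum>i=1..n. \<Sum>j=1..n. R j i * (?x ^ i * W (int i) (j + K)))) (?x ^ K * P)"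
    proof -
      have "?x ^ K * (\<Sum>i=1..n. \<Sum>j=1..n. R j i * (?x ^ i * W (int i) (j + K))) =
          (\<Sum>j=1..n. ?x ^ K * (\<Sum>i=1..n. R j i * (?x ^ i * W (int i) (j + K))))"
        by (subst sum.swap) (simp add: sum_distrib_left)
      also have "fcong n \<dots> (\<Sum>j=1..n. if j \<le> n - K then ?x ^ K * R j (j + K) else 0)"
      proof (intro fcong_sum)
        fix j assume j: "j \<in> {1..n}"
        show "fcong n (?x ^ K * (\<Sum>i=1..n. R j i * (?x ^ i * W (int i) (j + K))))
            (if j \<le> n - K then ?x ^ K * R j (j + K) else 0)"
        proof (cases "j \<le> n - K")
          case True
          have "fcong n (?x ^ K * (\<Sum>i=1..n. R j i * ?A i (j + K)))
              (?x ^ K * (R j (j + K) - (if j = j + K then 1 else 0)))"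
            by (intro fcong_mult fcong_refl RA)
          then show ?thesis using True K0 by (simp add: A)
        next
          case False
          \<comment> \<open>These columns do not count: the identity part of R has i = j and the
            rest carries x^j, so every term contains x^(K + j) with K + j > n.\<close>
          have "fcong n (?x ^ K * (R j i * (?x ^ i * W (int i) (j + K)))) 0" if i: "i \<in> {1..n}" for i
          proof -
            have "fcong n (?x ^ K * (R j i * (?x ^ i * W (int i) (j + K))))
                (?x ^ K * (((if j = i then 1 else 0) + ?x ^ j * V (int j) i) * (?x ^ i * W (int i) (j + K))))"
              by (intro fcong_mult fcong_refl R j i)
            also have "\<dots> = ?x ^ (K + j) * ((if j = i then W (int i) (j + K) else 0)
                + V (int j) i * (?x ^ i * W (int i) (j + K)))"
              by (auto simp: power_add algebra_simps)
            also have "fcong n \<dots> 0" by (rule fcong_0_power) (use False in auto)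
            finally show ?thesis .
          qed
          then have "fcong n (\<Sum>i=1..n. ?x ^ K * (R j i * (?x ^ i * W (int i) (j + K)))) (\<Sum>i=1..n. 0)"
            by (intro fcong_sum)
          then show ?thesis using False by (simp add: sum_distrib_left)
        qed
      qed
      also have "(\<Sum>j=1..n. if j \<le> n - K then ?x ^ K * R j (j + K) else 0) = (\<Sum>j=1..n-K. ?x ^ K * R j (j + K))"
        by (rule sum.mono_neutral_cong_right) auto
      also have "\<dots> = ?x ^ K * P" by (simp add: P_def sum_distrib_left)
      finally show ?thesis .
    qed
    \<comment> \<open>Summation over i applies R A = R - 1. The part with R gives entries of
      \<open>V\<close>, the identity part the finite trace of \<open>Wc_trace\<close>.\<close>
    have TC: "fcong n (\<Sum>e=1..K. \<Sum>j=1..n. (\<Sum>i=1..n. R j i * (?x ^ i * W (int i) e)) * W (int K - int e) j)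
        ((\<Sum>e=1..K. V (int K - int e) e) - fps_const (of_nat t * s - 2 + (if even k then 1 else 0)))"
    proof -
      have "fcong n (\<Sum>e=1..K. \<Sum>j=1..n. (\<Sum>i=1..n. R j i * (?x ^ i * W (int i) e)) * W (int K - int e) j)
          (\<Sum>e=1..K. \<Sum>j=1..n. (R j e - (if j = e then 1 else 0)) * W (int K - int e) j)"
        unfolding A[symmetric] by (intro fcong_sum fcong_mult fcong_refl RA)
      also have "\<dots> = (\<Sum>e=1..K. V (int K - int e) e - W (int K - int e) e)"
      proof (intro sum.cong refl)
        fix e assume e: "e \<in> {1..K}"
        have "(\<Sum>j=1..n. (R j e - (if j = e then 1 else 0)) * W (int K - int e) j) =
            V (int K - int e) e - (\<Sum>j=1..n. if j = e then W (int K - int e) j else 0)"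
          unfolding V_def sum_subtractf[symmetric]
          by (intro sum.cong refl) (simp add: algebra_simps)
        also have "(\<Sum>j=1..n. if j = e then W (int K - int e) j else 0) = W (int K - int e) e"
          using e Kn by simp
        finally show "(\<Sum>j=1..n. (R j e - (if j = e then 1 else 0)) * W (int K - int e) j) =
            V (int K - int e) e - W (int K - int e) e" .
      qed
      also have "\<dots> = (\<Sum>e=1..K. V (int K - int e) e) - fps_const (\<Sum>e=1..K. Wc t s e (int K - int e))"
      proof -
        have "(\<Sum>e\<in>I. W (int K - int e) e) = fps_const (\<Sum>e\<in>I. Wc t s e (int K - int e))" for I
          unfolding W_def by (induction I rule: infinite_finite_induct) (auto simp flip: fps_const_add)
        then show ?thesis by (simp add: sum_subtractf)
      qed
      also have "(\<Sum>e=1..K. Wc t s e (int K - int e)) = of_nat t * s - 2 + (if even k then 1 else 0)"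
        unfolding K by (rule Wc_trace[OF t k])
      finally show ?thesis .
    qed
    have sumV: "(\<Sum>e=1..K. V (int K - int e) e) =
        V 0 K + (\<Sum>j | 1 \<le> j \<and> j < K \<and> j \<le> n \<and> K - j \<le> n. V (int j) (K - j))"
    proof -
      have "(\<Sum>e=1..K. V (int K - int e) e) = V 0 K + (\<Sum>e=1..<K. V (int K - int e) e)"
        using K0 by (simp add: sum.last_plus)
      also have "(\<Sum>e=1..<K. V (int K - int e) e) = (\<Sum>j | 1 \<le> j \<and> j < K \<and> j \<le> n \<and> K - j \<le> n. V (int j) (K - j))"
        by (rule sum.reindex_bij_witness[of _ "\<lambda>j. K - j" "\<lambda>e. K - e"]) (use Kn in \<open>auto simp: of_nat_diff\<close>)
      finally show ?thesis .
    qed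
    define S where "S = (\<Sum>j | 1 \<le> j \<and> j < K \<and> j \<le> n \<and> K - j \<le> n. V (int j) (K - j))"
    define \<tau> where "\<tau> = fps_const (of_nat t * s - 2 + (if even k then 1 else 0))"
    define h where "h = (if even K then ?x ^ (K div 2) else 0)"
    have "fcong n Y (((h + ?x ^ K * S) + ?x ^ K * V 0 K + ?x ^ K * P) - Q)"
      unfolding Y1
      by (intro fcong_diff fcong_trans[OF T1] T2 fcong_add fcong_refl)
        (use pairs in \<open>simp add: h_def S_def\<close>)
    moreover have "fcong n (?x ^ K * Y) (- Q + ?x ^ K * P + ?x ^ K * ((V 0 K + S) - \<tau>))"
      unfolding Y2 by (intro fcong_add fcong_uminus TA TB fcong_mult fcong_refl)
        (use TC in \<open>simp only: sumV S_def \<tau>_def\<close>)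
    \<comment> \<open>All terms with P, Q, \<open>V 0 K\<close> and S cancel; what survives contains
      no entry of the resolvent.\<close>
    ultimately have "fcong n (Y - ?x ^ K * Y)
        ((((h + ?x ^ K * S) + ?x ^ K * V 0 K + ?x ^ K * P) - Q) - (- Q + ?x ^ K * P + ?x ^ K * ((V 0 K + S) - \<tau>)))"
      by (rule fcong_diff)
    also have "\<dots> = h + ?x ^ K * \<tau>" by (simp add: algebra_simps)
    finally show ?thesis by (simp add: h_def \<tau>_def left_diff_distrib)
  qed
qed

section \<open>The determinant and its logarithmic derivative\<close>

lemma fps_const_sum: "fps_const (\<Sum>i\<in>I. f i) = (\<Sum>i\<in>I. fps_const (f i))"
  by (induction I rule: infinite_finite_induct) (auto simp flip: fps_const_add)

lemma fps_const_prod: "fps_const (\<Prod>i\<in>I. f i) = (\<Prod>i\<in>I. fps_const (f i))"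
  by (induction I rule: infinite_finite_induct) (auto simp flip: fps_const_mult)

lemma fps_const_of_int': "fps_const (of_int k) = (of_int k :: complex fps)"
  by (simp add: fps_of_int)

lemma set_det_fps_const:
  "set_det M (\<lambda>i j. fps_const (A i j)) = fps_const (set_det M A :: complex)"
  unfolding set_det_def fps_const_sum
  by (simp add: fps_const_prod fps_const_of_int'[symmetric] flip: fps_const_mult)

lemma set_det_diagonal:
  assumes "finite M"
  shows "set_det M (\<lambda>i j. if i = j then d i else 0) = (\<Prod>i\<in>M. d i)"
  using assms
proof (induction M rule: finite_induct)
  case (insert e M)
  then have "set_det (insert e M) (\<lambda>i j. if i = j then d i else 0) = d e * set_det M (\<lambda>i j. if i = j then d i else 0)"
    by (subst set_det_zero_column) auto
  then show ?case using insert by simp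
qed simp

definition fredholm_matrix :: "nat \<Rightarrow> complex \<Rightarrow> nat \<Rightarrow> nat \<Rightarrow> complex fps" where
  "fredholm_matrix t s i j = (if i = j then 1 else 0) - weighted_matrix t s i j"

text \<open>Row i carries the factor x^i, so the minor on M carries x to the sum of M; its scalar
  part is \<open>set_det_Wc\<close>.\<close>

lemma set_det_fredholm:
  assumes t: "odd t"
  shows "set_det {1..n} (fredholm_matrix t s) =
    (\<Sum>M\<in>Pow {1..n}. fps_const ((-1) ^ card M * set_weight t s M) * fps_X ^ (\<Sum>M))"
proof -
  have "set_det {1..n} (fredholm_matrix t s) = (\<Sum>M\<in>Pow {1..n}. (-1) ^ card M * set_det M (weighted_matrix t s))"
    unfolding fredholm_matrix_def by (rule set_det_one_minus) simp
  also have "\<dots> = (\<Sum>M\<in>Pow {1..n}. fps_const ((-1) ^ card M * set_weight t s M) * fps_X ^ (\<Sum>M))"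
  proof (intro sum.cong refl)
    fix M assume M: "M \<in> Pow {1..n}"
    then have fin: "finite M" "0 \<notin> M" using finite_subset by auto
    have "set_det M (weighted_matrix t s) = set_det M (\<lambda>i j. fps_X ^ i * 1 * fps_const (Wc t s j (int i)))"
      by (rule set_det_cong) (simp add: weighted_matrix_def)
    also have "\<dots> = (\<Prod>i\<in>M. fps_X ^ i * 1) * set_det M (\<lambda>i j. fps_const (Wc t s j (int i)))"
      by (rule set_det_scale[OF fin(1)])
    also have "\<dots> = fps_X ^ (\<Sum>M) * fps_const (set_weight t s M)"
      by (simp add: set_det_fps_const set_det_Wc[OF t fin] power_sum)
    finally have "set_det M (weighted_matrix t s) = fps_X ^ (\<Sum>M) * fps_const (set_weight t s M)" .
    moreover have "(-1) ^ card M = fps_const ((-1) ^ card M :: complex)"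
      by (simp add: fps_const_power[symmetric] flip: fps_const_neg)
    ultimately show "(-1) ^ card M * set_det M (weighted_matrix t s) =
        fps_const ((-1) ^ card M * set_weight t s M) * fps_X ^ (\<Sum>M)"
      by (simp only: fps_const_mult[symmetric] mult_ac)
  qed
  finally show ?thesis .
qed

lemma set_det_deriv:
  assumes "finite M" "\<And>i j. i \<in> M \<Longrightarrow> j \<in> M \<Longrightarrow> has_coeff_deriv (\<lambda>s. A s i j) (D i j) s"
  shows "has_coeff_deriv (\<lambda>s. set_det M (A s)) (\<Sum>i\<in>M. set_det M ((A s)(i := D i))) s"
proof -
  have "has_coeff_deriv (\<lambda>s. of_int (sign p) * (\<Prod>i\<in>M. A s i (p i)))
     (\<Sum>i\<in>M. of_int (sign p) * (D i (p i) * (\<Prod>r\<in>M - {i}. A s r (p r)))) s"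
    if p: "p permutes M" for p
  proof -
    have "has_coeff_deriv (\<lambda>s. \<Prod>i\<in>M. A s i (p i)) (\<Sum>i\<in>M. D i (p i) * (\<Prod>r\<in>M - {i}. A s r (p r))) s"
      using assms p by (intro has_coeff_deriv_prod) (auto simp: permutes_in_image)
    from has_coeff_deriv_mult[OF has_coeff_deriv_const this, of "of_int (sign p)"]
    show ?thesis by (simp add: sum_distrib_left)
  qed
  then have "has_coeff_deriv (\<lambda>s. set_det M (A s))
     (\<Sum>p | p permutes M. \<Sum>i\<in>M. of_int (sign p) * (D i (p i) * (\<Prod>r\<in>M - {i}. A s r (p r)))) s"
    unfolding set_det_def by (intro has_coeff_deriv_sum) auto
  also have "(\<Sum>p | p permutes M. \<Sum>i\<in>M. of_int (sign p) * (D i (p i) * (\<Prod>r\<in>M - {i}. A s r (p r)))) =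
      (\<Sum>i\<in>M. set_det M ((A s)(i := D i)))"
    by (subst sum.swap) (simp add: set_det_fun_upd[OF assms(1)])
  finally show ?thesis .
qed

text \<open>The Lambert series X^K / (1 - X^K).\<close>

definition lambert :: "nat \<Rightarrow> complex fps" where
  "lambert K = Abs_fps (\<lambda>l. if l > 0 \<and> K dvd l then 1 else 0)"

lemma lambert_mult:
  assumes "K > 0"
  shows "(1 - fps_X ^ K) * lambert K = fps_X ^ K"
proof (rule fps_ext)
  fix l
  show "((1 - fps_X ^ K) * lambert K) $ l = fps_X ^ K $ l"
    using assms by (auto simp: left_diff_distrib fps_X_power_mult_nth lambert_def dvd_minus_self not_less)
qed

text \<open>For even k the additional x^K from \<open>Wc_trace\<close> joins x^(K/2), where K = t k:
  divided by 1 - x^K, their sum is x^(K/2) / (1 - x^(K/2)).\<close>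

lemma flow_trace_lambert:
  assumes t: "odd t" and k: "k > 0"
  shows "fcong n (\<Sum>i=1..n. \<Sum>j=1..n. resolvent n (weighted_matrix t s) j i * (fps_X ^ i * fps_const (flow_matrix t s (t * k) i j)))
    (fps_const (of_nat t * s - 2) * lambert (t * k) + (if even k then lambert (t * k div 2) else 0))"
    (is "fcong n ?Y ?Z")
proof -
  have K0: "t * k > 0" using t odd_pos k by simp
  have ev: "even (t * k) \<longleftrightarrow> even k" using t by simp
  have "(1 - fps_X ^ (t * k)) * ?Z = (if even (t * k) then fps_X ^ (t * k div 2) else 0)
     + fps_X ^ (t * k) * fps_const (of_nat t * s - 2 + (if even k then 1 else 0))"
  proof (cases "even k")
    case False
    then show ?thesis using ev lambert_mult[OF K0] by (simp add: mult_ac)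
  next
    case True
    then obtain m where m: "t * k = 2 * m" using ev by (auto elim!: evenE)
    then have "m > 0" using K0 by simp
    define p where "p = (fps_X ^ m :: complex fps)"
    have p2: "fps_X ^ (2 * m) = p * p" unfolding p_def mult_2 by (rule power_add)
    have "(1 - fps_X ^ (2 * m)) * lambert m = (1 + p) * ((1 - p) * lambert m)"
      unfolding p2 by (simp add: algebra_simps)
    also have "\<dots> = fps_X ^ m + fps_X ^ (2 * m)"
      unfolding lambert_mult[OF \<open>m > 0\<close>, folded p_def] p2 p_def[symmetric] by (simp add: algebra_simps)
    finally have "(1 - fps_X ^ (t * k)) * lambert (t * k div 2) = fps_X ^ (t * k div 2) + fps_X ^ (t * k)"
      by (simp add: m)
    moreover have "(1 - fps_X ^ (t * k)) * (fps_const (of_nat t * s - 2) * lambert (t * k)) =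
        fps_const (of_nat t * s - 2) * fps_X ^ (t * k)"
      using lambert_mult[OF K0] by (metis mult.left_commute)
    ultimately have "(1 - fps_X ^ (t * k)) * ?Z =
        fps_const (of_nat t * s - 2) * fps_X ^ (t * k) + (fps_X ^ (t * k div 2) + fps_X ^ (t * k))"
      using True by (simp only: if_True distrib_left)
    also have "\<dots> = fps_X ^ (t * k div 2) + fps_X ^ (t * k) * (fps_const (of_nat t * s - 2) + 1)"
      by (simp only: distrib_left mult_1_left mult_1_right ac_simps)
    also have "fps_const (of_nat t * s - 2) + 1 = fps_const (of_nat t * s - 2 + 1)"
      by (simp flip: fps_const_add)
    finally show ?thesis using True ev by (simp only: if_True)
  qed
  then have "fcong n ((1 - fps_X ^ (t * k)) * ?Y) ((1 - fps_X ^ (t * k)) * ?Z)"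
    using flow_trace[OF t k refl, of n s] by (simp only:)
  then show ?thesis by (rule fcong_cancel_one_minus_power[OF K0])
qed

text \<open>Modulo x^(n+1) this is minus the logarithm of the product of the 1 - x^(t j), in Lambert
  form; see \<open>log_euler_eq\<close>.\<close>

definition log_euler :: "nat \<Rightarrow> nat \<Rightarrow> complex fps" where
  "log_euler t n = (\<Sum>k=1..n. fps_const (1 / of_nat k) * lambert (t * k))"

text \<open>The even k = 2 m carry in addition 1/(2 m) times the Lambert series for t m. This is
  half of \<open>log_euler\<close>, so the constant -2 of the trace becomes -3/2.\<close>

lemma set_det_fredholm_deriv:
  assumes t: "odd t"
  shows "\<exists>D. has_coeff_deriv (\<lambda>s. set_det {1..n} (fredholm_matrix t s)) D s \<and>
    fcong n D (- (fps_const (of_nat t * s - 3 / 2) * log_euler t n) * set_det {1..n} (fredholm_matrix t s))"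
proof -
  have t0: "t > 0" using t odd_pos by blast
  let ?N = "{1..n}" and ?A = "weighted_matrix t s" and ?R = "resolvent n (weighted_matrix t s)"
  \<comment> \<open>The bound 2 n meets the requirement i + j <= B of \<open>Wc_deriv\<close> for
    all i and j up to n.\<close>
  define D where "D i j = - (fps_X ^ i * fps_const (\<Sum>k=1..2*n. flow_matrix t s (t * k) i j / of_nat k))" for i j
  have dA: "has_coeff_deriv (\<lambda>s. fredholm_matrix t s i j) (D i j) s" if "i \<in> ?N" "j \<in> ?N" for i j
    unfolding has_coeff_deriv_def
  proof
    fix l
    have "((\<lambda>s. Wc t s j (int i)) has_field_derivative (\<Sum>k=1..2*n. flow_matrix t s (t * k) i j / of_nat k)) (at s)"
      using Wc_deriv[OF t0, of "int i" j "2 * n" s] that by (simp add: flow_matrix_def)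
    then have "((\<lambda>s. (if i = j then 1 else 0) $ l - (if l = i then Wc t s j (int i) else 0)) has_field_derivative
        0 - (if l = i then \<Sum>k=1..2*n. flow_matrix t s (t * k) i j / of_nat k else 0)) (at s)"
      by (intro DERIV_diff DERIV_const) auto
    moreover have "(fps_X ^ i * fps_const c) $ l = (if l = i then c else 0)" for c :: complex
      by (auto simp: fps_X_power_mult_nth)
    ultimately show "((\<lambda>s. fredholm_matrix t s i j $ l) has_field_derivative D i j $ l) (at s)"
      unfolding fredholm_matrix_def weighted_matrix_def D_def by (simp only: fps_sub_nth fps_neg_nth diff_0)
  qed
  have Xdvd: "fps_X dvd ?A i j" if "i \<in> ?N" for i j
    unfolding weighted_matrix_def using that by (intro dvd_mult2) (auto simp: dvd_power)
  let ?Y = "\<lambda>k. \<Sum>i=1..n. \<Sum>j=1..n. ?R j i * (fps_X ^ i * fps_const (flow_matrix t s (t * k) i j))"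
  have jac: "fcong n (\<Sum>i\<in>?N. set_det ?N ((fredholm_matrix t s)(i := D i)))
      ((\<Sum>i\<in>?N. \<Sum>j\<in>?N. D i j * ?R j i) * set_det ?N (fredholm_matrix t s))"
    unfolding fcong_def
  proof (rule jacobi_formula_dvd)
    fix i j assume ij: "i \<in> ?N" "j \<in> ?N"
    have "(\<Sum>k\<in>?N. ?R i k * fredholm_matrix t s k j) = ?R i j - (\<Sum>k=1..n. ?R i k * ?A k j)"
    proof -
      have "(\<Sum>k\<in>?N. ?R i k * fredholm_matrix t s k j) =
          (\<Sum>k\<in>?N. (if k = j then ?R i k else 0) - ?R i k * ?A k j)"
        by (intro sum.cong refl) (simp add: fredholm_matrix_def right_diff_distrib)
      then show ?thesis using ij by (simp add: sum_subtractf)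
    qed
    moreover have "fcong n (\<Sum>k=1..n. ?R i k * ?A k j) (?R i j - (if i = j then 1 else 0))"
      by (rule resolvent_mult_right) (rule Xdvd)
    then have "fcong n (?R i j - (\<Sum>k=1..n. ?R i k * ?A k j)) (?R i j - (?R i j - (if i = j then 1 else 0)))"
      by (intro fcong_diff fcong_refl)
    ultimately have "fcong n (\<Sum>k\<in>?N. ?R i k * fredholm_matrix t s k j) (if i = j then 1 else 0)"
      by (simp only: diff_diff_eq2 add_diff_cancel_left')
    then show "fps_X ^ Suc n dvd (\<Sum>k\<in>?N. ?R i k * fredholm_matrix t s k j) - (if i = j then 1 else 0)"
      unfolding fcong_def .
  qed simp
  have "(\<Sum>i\<in>?N. \<Sum>j\<in>?N. D i j * ?R j i) = - (\<Sum>k=1..2*n. fps_const (1 / of_nat k) * ?Y k)"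
  proof -
    have "D i j * ?R j i = (\<Sum>k=1..2*n. - (fps_const (1 / of_nat k) * (?R j i * (fps_X ^ i * fps_const (flow_matrix t s (t * k) i j)))))" for i j
    proof -
      have "fps_const (flow_matrix t s (t * k) i j / of_nat k) = fps_const (1 / of_nat k) * fps_const (flow_matrix t s (t * k) i j)" for k
        by simp
      then have "D i j * ?R j i = - (fps_X ^ i * (\<Sum>k=1..2*n. fps_const (1 / of_nat k) * fps_const (flow_matrix t s (t * k) i j)) * ?R j i)"
        unfolding D_def fps_const_sum by (simp only: mult_minus_left)
      also have "\<dots> = (\<Sum>k=1..2*n. - (fps_const (1 / of_nat k) * (?R j i * (fps_X ^ i * fps_const (flow_matrix t s (t * k) i j)))))"
        unfolding sum_distrib_left sum_distrib_right sum_negf[symmetric]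
        by (intro sum.cong refl) (simp only: mult_ac)
      finally show ?thesis .
    qed
    then have "(\<Sum>i\<in>?N. \<Sum>j\<in>?N. D i j * ?R j i) =
       (\<Sum>i\<in>?N. \<Sum>j\<in>?N. \<Sum>k=1..2*n. - (fps_const (1 / of_nat k) * (?R j i * (fps_X ^ i * fps_const (flow_matrix t s (t * k) i j)))))"
      by (simp only:)
    also have "\<dots> = (\<Sum>i\<in>?N. \<Sum>k=1..2*n. \<Sum>j\<in>?N. - (fps_const (1 / of_nat k) * (?R j i * (fps_X ^ i * fps_const (flow_matrix t s (t * k) i j)))))"
      by (intro sum.cong refl sum.swap)
    also have "\<dots> = (\<Sum>k=1..2*n. \<Sum>i\<in>?N. \<Sum>j\<in>?N. - (fps_const (1 / of_nat k) * (?R j i * (fps_X ^ i * fps_const (flow_matrix t s (t * k) i j)))))"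
      by (rule sum.swap)
    finally show ?thesis by (simp only: sum_negf sum_distrib_left)
  qed
  also have "fcong n \<dots> (- (\<Sum>k=1..2*n. fps_const (1 / of_nat k) *
      (fps_const (of_nat t * s - 2) * lambert (t * k) + (if even k then lambert (t * k div 2) else 0))))"
    by (intro fcong_uminus fcong_sum fcong_mult[OF fcong_refl] flow_trace_lambert[OF t]) simp
  also have "fcong n \<dots> (- (fps_const (of_nat t * s - 3 / 2) * log_euler t n))"
  proof (rule fcong_uminus)
    have small: "fcong n (lambert K) 0" if "K > n" for K
      using that by (auto simp: fcong_iff lambert_def dest: dvd_imp_le)
    have 1: "fcong n (\<Sum>k=1..2*n. fps_const (1 / of_nat k) * lambert (t * k)) (log_euler t n)"
    proof -
      have "(\<Sum>k=1..2*n. fps_const (1 / of_nat k) * lambert (t * k)) =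
          (\<Sum>k=1..n. fps_const (1 / of_nat k) * lambert (t * k)) + (\<Sum>k=n+1..n+n. fps_const (1 / of_nat k) * lambert (t * k))"
        unfolding mult_2 by (rule sum.ub_add_nat) simp
      also have "fcong n \<dots> (log_euler t n + (\<Sum>k=n+1..n+n. fps_const (1 / of_nat k) * 0))"
        unfolding log_euler_def
      proof (intro fcong_add fcong_refl fcong_sum fcong_mult small)
        fix k assume "k \<in> {n+1..n+n}"
        then have "n < 1 * k" by simp
        also have "\<dots> \<le> t * k" using t0 by (intro mult_right_mono) auto
        finally show "n < t * k" .
      qed
      finally show ?thesis by simp
    qed
    have 2: "(\<Sum>k=1..2*n. fps_const (1 / of_nat k) * (if even k then lambert (t * k div 2) else 0)) =
        fps_const (1 / 2) * log_euler t n"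
    proof -
      have "(\<Sum>k=1..2*n. fps_const (1 / of_nat k) * (if even k then lambert (t * k div 2) else 0)) =
          (\<Sum>k | k \<in> {1..2*n} \<and> even k. fps_const (1 / of_nat k) * lambert (t * k div 2))"
        by (rule sum.mono_neutral_cong_right) auto
      also have "\<dots> = (\<Sum>m=1..n. fps_const (1 / of_nat (2 * m)) * lambert (t * m))"
        by (rule sum.reindex_bij_witness[of _ "\<lambda>m. 2 * m" "\<lambda>k. k div 2"]) (auto elim!: evenE)
      also have "\<dots> = (\<Sum>m=1..n. fps_const (1 / 2) * (fps_const (1 / of_nat m) * lambert (t * m)))"
      proof (intro sum.cong refl)
        fix m
        have "fps_const (1 / of_nat (2 * m)) = fps_const (1 / 2) * (fps_const (1 / of_nat m) :: complex fps)"
          unfolding fps_const_mult by simp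
        then show "fps_const (1 / of_nat (2 * m)) * lambert (t * m) = fps_const (1 / 2) * (fps_const (1 / of_nat m) * lambert (t * m))"
          by (simp only: mult.assoc)
      qed
      finally show ?thesis by (simp only: log_euler_def sum_distrib_left)
    qed
    have "(\<Sum>k=1..2*n. fps_const (1 / of_nat k) *
          (fps_const (of_nat t * s - 2) * lambert (t * k) + (if even k then lambert (t * k div 2) else 0))) =
        fps_const (of_nat t * s - 2) * (\<Sum>k=1..2*n. fps_const (1 / of_nat k) * lambert (t * k))
        + (\<Sum>k=1..2*n. fps_const (1 / of_nat k) * (if even k then lambert (t * k div 2) else 0))"
      unfolding sum_distrib_left sum.distrib[symmetric] by (intro sum.cong refl) (simp only: distrib_left mult_ac)
    also have "fcong n \<dots> (fps_const (of_nat t * s - 2) * log_euler t n + fps_const (1 / 2) * log_euler t n)"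
      unfolding 2 by (intro fcong_add fcong_mult fcong_refl 1)
    also have "\<dots> = fps_const (of_nat t * s - 3 / 2) * log_euler t n"
      by (simp add: distrib_right[symmetric])
    finally show "fcong n (\<Sum>k=1..2*n. fps_const (1 / of_nat k) *
          (fps_const (of_nat t * s - 2) * lambert (t * k) + (if even k then lambert (t * k div 2) else 0)))
        (fps_const (of_nat t * s - 3 / 2) * log_euler t n)" .
  qed
  finally have "fcong n (\<Sum>i\<in>?N. \<Sum>j\<in>?N. D i j * ?R j i) (- (fps_const (of_nat t * s - 3 / 2) * log_euler t n))" .
  then have "fcong n (\<Sum>i\<in>?N. set_det ?N ((fredholm_matrix t s)(i := D i)))
      (- (fps_const (of_nat t * s - 3 / 2) * log_euler t n) * set_det ?N (fredholm_matrix t s))"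
    using fcong_trans[OF jac fcong_mult[OF _ fcong_refl]] by blast
  moreover have "has_coeff_deriv (\<lambda>s. set_det ?N (fredholm_matrix t s))
      (\<Sum>i\<in>?N. set_det ?N ((fredholm_matrix t s)(i := D i))) s"
    by (rule set_det_deriv) (use dA in auto)
  ultimately show ?thesis by blast
qed

lemma neg_log_compose_power_nth:
  assumes "K > 0"
  shows "(neg_log oo fps_X ^ K) $ l = (if l > 0 \<and> K dvd l then of_nat K / of_nat l else 0)"
proof -
  have "(neg_log oo fps_X ^ K) $ l = (\<Sum>i=0..l. if l = K * i then neg_log $ i else 0)"
    unfolding fps_compose_nth power_mult[symmetric] by (intro sum.cong refl) (simp add: fps_X_power_nth)
  also have "\<dots> = (if l > 0 \<and> K dvd l then of_nat K / of_nat l else 0)"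
  proof (cases "K dvd l")
    case True
    then obtain e where e: "l = K * e" by (elim dvdE)
    then have "e \<le> l" using assms by simp
    have "(\<Sum>i=0..l. if l = K * i then neg_log $ i else 0) = (\<Sum>i=0..l. if i = e then neg_log $ e else 0)"
      using assms e by (intro sum.cong refl) auto
    also have "\<dots> = neg_log $ e" using \<open>e \<le> l\<close> by simp
    finally show ?thesis using True e assms by (simp add: neg_log_def)
  next
    case False
    then have "(\<Sum>i=0..l. if l = K * i then neg_log $ i else 0) = (0 :: complex)"
      by (intro sum.neutral) auto
    then show ?thesis using False by simp
  qed
  finally show ?thesis .
qed

text \<open>At the exponent l = t e both sides run over the divisors of e, and exchanging a divisor
  with its cofactor matches the summands.\<close>

lemma log_euler_eq:
  assumes t: "t > 0"
  shows "fcong n (log_euler t n) (\<Sum>j=1..n. neg_log oo fps_X ^ (t * j))"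
  unfolding fcong_iff
proof (intro allI impI)
  fix l assume l: "l \<le> n"
  have L: "log_euler t n $ l = (\<Sum>k=1..n. if l > 0 \<and> t * k dvd l then 1 / of_nat k else 0)"
    by (simp add: log_euler_def fps_sum_nth lambert_def if_distrib cong: if_cong)
  have R: "(\<Sum>j=1..n. neg_log oo fps_X ^ (t * j)) $ l =
      (\<Sum>j=1..n. if l > 0 \<and> t * j dvd l then of_nat (t * j) / of_nat l else 0)"
    unfolding fps_sum_nth using t by (intro sum.cong refl neg_log_compose_power_nth) auto
  show "log_euler t n $ l = (\<Sum>j=1..n. neg_log oo fps_X ^ (t * j)) $ l"
  proof (cases "l > 0 \<and> t dvd l")
    case False
    then have z: "(l > 0 \<and> t * k dvd l) = False" for k by (metis dvd_mult_left)
    show ?thesis unfolding L R z by simp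
  next
    case True
    then obtain e where e: "l = t * e" "e > 0" by (auto elim!: dvdE)
    have "1 * e \<le> t * e" using t by (intro mult_right_mono) auto
    then have "e \<le> l" using e(1) by (simp only: mult_1_left)
    then have en: "e \<le> n" using l by (rule le_trans)
    have "log_euler t n $ l = (\<Sum>k | k \<in> {1..n} \<and> k dvd e. 1 / of_nat k)"
      unfolding L using e t by (intro sum.mono_neutral_cong_right) auto
    also have "\<dots> = (\<Sum>j | j \<in> {1..n} \<and> j dvd e. of_nat (t * j) / of_nat l)"
    proof -
      have inv: "e div (e div j) = j \<and> e div j \<in> {k \<in> {1..n}. k dvd e} \<and> of_nat (t * (e div j)) / of_nat l = 1 / (of_nat j :: complex)"
        if "j \<in> {k \<in> {1..n}. k dvd e}" for j
      proof -
        have "j dvd e" using that by simp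
        then obtain f where f: "e = j * f" by (elim dvdE)
        then have pos: "f > 0" "j > 0" using e by (auto intro: Nat.gr0I)
        then have "1 * f \<le> j * f" by (intro mult_right_mono) auto
        then have "f \<le> e" using f by (simp only: mult_1_left)
        then have "f \<le> n" using en by (rule le_trans)
        moreover have "e div j = f" "e div f = j" using f pos by auto
        moreover have "of_nat (t * f) / of_nat l = 1 / (of_nat j :: complex)"
          unfolding e f using t pos by simp
        ultimately show ?thesis using pos f by simp
      qed
      show ?thesis
        by (rule sum.reindex_bij_witness[of _ "\<lambda>j. e div j" "\<lambda>j. e div j"]) (use inv in blast)+
    qed
    also have "\<dots> = (\<Sum>j=1..n. neg_log oo fps_X ^ (t * j)) $ l"
      unfolding R using e t by (intro sum.mono_neutral_cong_left) auto
    finally show ?thesis .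
  qed
qed

text \<open>The exponent is the antiderivative of t s - 3/2 that vanishes at s = 0. So the
  determinant times the inverse product \<open>G\<close> has zero derivative in every coefficient up
  to n, and its value can be read off at s = 0.\<close>

lemma signed_sum_product:
  assumes t: "odd t"
  shows "fcong n (\<Sum>M\<in>Pow {1..n}. fps_const ((-1) ^ card M * set_weight t s M) * fps_X ^ (\<Sum>M))
     ((\<Prod>i=1..n. 1 - fps_X ^ i) * (\<Prod>j=1..n. fps_one_minus_cpow (fps_X ^ (t * j)) ((of_nat t * s\<^sup>2 - 3 * s) / 2)))"
proof -
  have t0: "t > 0" using t odd_pos by blast
  let ?F = "\<lambda>s. set_det {1..n} (fredholm_matrix t s)"
  let ?a = "\<lambda>s. (of_nat t * s\<^sup>2 - 3 * s) / 2 :: complex"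
  let ?u = "\<lambda>j. fps_X ^ (t * j) :: complex fps"
  have u0: "?u j $ 0 = 0" if "j \<in> {1..n}" for j using that t0 by simp
  define G where "G s = (\<Prod>j=1..n. fps_one_minus_cpow (?u j) (- ?a s))" for s
  define \<Lambda> where "\<Lambda> = (\<Sum>j=1..n. neg_log oo ?u j)"
  have dG: "has_coeff_deriv G (fps_const (of_nat t * s - 3 / 2) * \<Lambda> * G s) s" for s
  proof -
    have "((\<lambda>s. - ?a s) has_field_derivative - (of_nat t * s - 3 / 2)) (at s)"
      by (auto intro!: derivative_eq_intros simp: field_simps)
    then have "has_coeff_deriv (\<lambda>s. fps_one_minus_cpow (?u j) (- ?a s))
       (fps_const (- (of_nat t * s - 3 / 2)) * (- (neg_log oo ?u j) * fps_one_minus_cpow (?u j) (- ?a s))) s"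
      if "j \<in> {1..n}" for j
      using has_coeff_deriv_chain[OF _ has_coeff_deriv_cpow[OF u0[OF that]]] by blast
    from has_coeff_deriv_prod[OF _ this, of "{1..n}" "\<lambda>j. j"]
    have "has_coeff_deriv G (\<Sum>j=1..n. fps_const (- (of_nat t * s - 3 / 2)) * (- (neg_log oo ?u j) * fps_one_minus_cpow (?u j) (- ?a s))
        * (\<Prod>i\<in>{1..n} - {j}. fps_one_minus_cpow (?u i) (- ?a s))) s"
      unfolding G_def by simp
    also have "(\<Sum>j=1..n. fps_const (- (of_nat t * s - 3 / 2)) * (- (neg_log oo ?u j) * fps_one_minus_cpow (?u j) (- ?a s))
        * (\<Prod>i\<in>{1..n} - {j}. fps_one_minus_cpow (?u i) (- ?a s))) =
        (\<Sum>j=1..n. fps_const (of_nat t * s - 3 / 2) * (neg_log oo ?u j) * G s)"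
    proof (intro sum.cong refl)
      fix j assume j: "j \<in> {1..n}"
      have G: "G s = fps_one_minus_cpow (?u j) (- ?a s) * (\<Prod>i\<in>{1..n} - {j}. fps_one_minus_cpow (?u i) (- ?a s))"
        unfolding G_def using j by (subst prod.remove[of _ j]) auto
      have "fps_const (- c) * (- b * f) * g = fps_const c * b * (f * g)" for c and b f g :: "complex fps"
        by (simp add: mult_ac flip: fps_const_neg)
      then show "fps_const (- (of_nat t * s - 3 / 2)) * (- (neg_log oo ?u j) * fps_one_minus_cpow (?u j) (- ?a s))
        * (\<Prod>i\<in>{1..n} - {j}. fps_one_minus_cpow (?u i) (- ?a s)) =
        fps_const (of_nat t * s - 3 / 2) * (neg_log oo ?u j) * G s" unfolding G .
    qed
    also have "\<dots> = fps_const (of_nat t * s - 3 / 2) * \<Lambda> * G s"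
      by (simp only: \<Lambda>_def sum_distrib_left sum_distrib_right)
    finally show ?thesis .
  qed
  have const: "(?F s * G s) $ l = (?F 0 * G 0) $ l" if l: "l \<le> n" for l
  proof -
    have "((\<lambda>s. (?F s * G s) $ l) has_field_derivative 0) (at s within UNIV)" for s
    proof -
      obtain D where D: "has_coeff_deriv ?F D s"
        "fcong n D (- (fps_const (of_nat t * s - 3 / 2) * log_euler t n) * ?F s)"
        using set_det_fredholm_deriv[OF t] by blast
      have "has_coeff_deriv (\<lambda>s. ?F s * G s) (D * G s + ?F s * (fps_const (of_nat t * s - 3 / 2) * \<Lambda> * G s)) s"
        by (rule has_coeff_deriv_mult[OF D(1) dG])
      then have "((\<lambda>s. (?F s * G s) $ l) has_field_derivative
          (D * G s + ?F s * (fps_const (of_nat t * s - 3 / 2) * \<Lambda> * G s)) $ l) (at s)"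
        unfolding has_coeff_deriv_def by blast
      moreover have "fcong n (D * G s + ?F s * (fps_const (of_nat t * s - 3 / 2) * \<Lambda> * G s))
          (- (fps_const (of_nat t * s - 3 / 2) * \<Lambda>) * ?F s * G s + ?F s * (fps_const (of_nat t * s - 3 / 2) * \<Lambda> * G s))"
      proof (intro fcong_add fcong_refl fcong_mult)
        have "fcong n (- (fps_const (of_nat t * s - 3 / 2) * log_euler t n) * ?F s) (- (fps_const (of_nat t * s - 3 / 2) * \<Lambda>) * ?F s)"
          unfolding \<Lambda>_def by (intro fcong_mult fcong_refl fcong_uminus log_euler_eq[OF t0])
        then show "fcong n D (- (fps_const (of_nat t * s - 3 / 2) * \<Lambda>) * ?F s)"
          by (rule fcong_trans[OF D(2)])
      qed
      then have "(D * G s + ?F s * (fps_const (of_nat t * s - 3 / 2) * \<Lambda> * G s)) $ l = 0"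
        using l unfolding fcong_iff by (simp add: mult_ac)
      ultimately show ?thesis by simp
    qed
    then obtain c where "\<And>s. (?F s * G s) $ l = c"
      using has_field_derivative_zero_constant[of UNIV "\<lambda>s. (?F s * G s) $ l"] by auto
    then show ?thesis by simp
  qed
  have F0: "?F 0 = (\<Prod>i=1..n. 1 - fps_X ^ i)"
  proof -
    have "?F 0 = set_det {1..n} (\<lambda>i j. if i = j then 1 - fps_X ^ i else 0)"
      by (rule set_det_cong) (auto simp: fredholm_matrix_def weighted_matrix_def Wc_at_0[OF t0])
    then show ?thesis by (simp add: set_det_diagonal)
  qed
  have G0: "G 0 = 1" unfolding G_def using u0 by (intro prod.neutral) simp
  have GG: "G s * (\<Prod>j=1..n. fps_one_minus_cpow (?u j) (?a s)) = 1"
  proof -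
    have "fps_one_minus_cpow (?u j) (- ?a s) * fps_one_minus_cpow (?u j) (?a s) = 1" if "j \<in> {1..n}" for j
      using fps_one_minus_cpow_add[OF u0[OF that], of "- ?a s" "?a s"] u0[OF that] by simp
    then show ?thesis unfolding G_def prod.distrib[symmetric] by (intro prod.neutral) simp
  qed
  have "fcong n (?F s * G s) (\<Prod>i=1..n. 1 - fps_X ^ i)"
    using const F0 G0 by (simp add: fcong_iff)
  from fcong_mult[OF this fcong_refl, of "\<Prod>j=1..n. fps_one_minus_cpow (?u j) (?a s)"]
  have "fcong n (?F s) ((\<Prod>i=1..n. 1 - fps_X ^ i) * (\<Prod>j=1..n. fps_one_minus_cpow (?u j) (?a s)))"
    by (simp only: mult.assoc GG mult_1_right)
  then show ?thesis unfolding set_det_fredholm[OF t] .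
qed

section \<open>Hooks, cores and balanced sets\<close>

text \<open>\<open>maya M\<close> is the set of all \<open>\<lambda>\<^sub>i - i\<close>, \<open>i \<ge> 1\<close>, for the doubled distinct partition \<open>\<lambda>\<close> whose
  positive \<open>\<lambda>\<^sub>i - i\<close> form \<open>M\<close>. Its boxes are the pairs of an element \<open>a\<close> and a smaller
  non-element \<open>b\<close>, the hook length is \<open>a - b\<close>, and the box lies above the diagonal iff \<open>a + b < 0\<close>.\<close>

definition maya :: "nat set \<Rightarrow> int \<Rightarrow> bool" where
  "maya M a \<longleftrightarrow> (a > 0 \<and> nat a \<in> M) \<or> (a < 0 \<and> nat (- a) \<notin> M)"

definition hooks :: "nat \<Rightarrow> nat set \<Rightarrow> (int \<times> int) set" where
  "hooks t M = {(a, b). maya M a \<and> \<not> maya M b \<and> b < a \<and> int t dvd a - b}"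

definition hook_factor :: "nat \<Rightarrow> complex \<Rightarrow> int \<times> int \<Rightarrow> complex" where
  "hook_factor t s = (\<lambda>(a, b). 1 - of_nat t * s / of_int ((if a + b < 0 then - 1 else 1) * (a - b)))"

lemma maya_0 [simp]: "\<not> maya M 0"
  by (simp add: maya_def)

lemma maya_uminus: "a \<noteq> 0 \<Longrightarrow> maya M (- a) \<longleftrightarrow> \<not> maya M a"
  by (auto simp: maya_def)

lemma maya_int: "m > 0 \<Longrightarrow> maya M (int m) \<longleftrightarrow> m \<in> M"
  by (simp add: maya_def)

lemma maya_neg_int: "m > 0 \<Longrightarrow> maya M (- int m) \<longleftrightarrow> m \<notin> M"
  by (simp add: maya_def)

lemma hooks_bounds:
  assumes M: "\<And>m. m \<in> M \<Longrightarrow> m \<le> L" and ab: "(a, b) \<in> hooks t M"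
  shows "a \<in> {- int L..int L}" "b \<in> {- int L..int L}"
proof -
  have a: "a \<le> int L" if "maya M a" for a
    using that M by (force simp: maya_def)
  have b: "b \<ge> - int L" if "\<not> maya M b" for b
  proof (rule ccontr)
    assume *: "\<not> - int L \<le> b"
    then have "nat (- b) \<in> M" using that by (auto simp: maya_def)
    then show False using M * by force
  qed
  have "maya M a" "\<not> maya M b" "b < a" using ab by (auto simp: hooks_def)
  then show "a \<in> {- int L..int L}" "b \<in> {- int L..int L}" using a[of a] b[of b] by auto
qed

lemma finite_hooks:
  assumes "finite M"
  shows "finite (hooks t M)"
proof -
  have "m \<le> \<Sum>M" if "m \<in> M" for m using member_le_sum[of m M "\<lambda>x. x"] that assms by simp
  then have "hooks t M \<subseteq> {- int (\<Sum>M)..int (\<Sum>M)} \<times> {- int (\<Sum>M)..int (\<Sum>M)}"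
    using hooks_bounds[of M "\<Sum>M"] by auto
  then show ?thesis using finite_subset by blast
qed

text \<open>The reflection \<open>(a, b) \<mapsto> (- b, - a)\<close> preserves hooks with \<open>b \<noteq> 0\<close> and flips the
  sign, so hooks with \<open>a + b \<noteq> 0\<close> can be paired.\<close>

lemma hooks_reflect:
  assumes "(a, b) \<in> hooks t M" "b \<noteq> 0"
  shows "(- b, - a) \<in> hooks t M"
proof -
  have "maya M a" using assms by (simp add: hooks_def)
  then have "a \<noteq> 0" by auto
  then show ?thesis using assms by (auto simp: hooks_def maya_uminus)
qed

lemma hook_factor_reflect:
  assumes "a + b > 0"
  shows "hook_factor t s (a, b) * hook_factor t s (- b, - a) = 1 - (of_nat t * s / of_int (a - b))\<^sup>2"
proof -
  have "hook_factor t s (a, b) = 1 - of_nat t * s / of_int (a - b)"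
    using assms by (simp add: hook_factor_def)
  moreover have "hook_factor t s (- b, - a) = 1 + of_nat t * s / of_int (a - b)"
  proof -
    have "- b + - a < 0" using assms by simp
    moreover have "(- 1) * (- b - - a) = - (a - b)" by simp
    ultimately have "hook_factor t s (- b, - a) = 1 - of_nat t * s / of_int (- (a - b))"
      unfolding hook_factor_def by (simp only: prod.case if_True)
    then show ?thesis by (simp only: of_int_minus divide_minus_right diff_minus_eq_add)
  qed
  ultimately show ?thesis by (simp only: power2_eq_square) (simp add: algebra_simps)
qed

text \<open>Two kinds of hooks escape the pairing: those with b = 0, whose mirror image (0, -a) is
  no hook, and those with a = -b, which are their own mirror image. They have the lengths m and 2 m
  with m in M and give the two linear factors for t | m; all pairs give squares.\<close>

lemma prod_hook_factor:
  assumes fin: "finite M" and M0: "0 \<notin> M" and t: "odd t"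
  shows "(\<Prod>p\<in>hooks t M. hook_factor t s p) = set_weight t s M"
proof -
  let ?h = "hook_factor t s" and ?\<sigma> = "of_nat t * s"
  let ?H = "hooks t M"
  let ?Z = "{p \<in> ?H. snd p = 0}" and ?D = "{p \<in> ?H. snd p \<noteq> 0 \<and> fst p + snd p = 0}"
  let ?P = "{p \<in> ?H. snd p \<noteq> 0 \<and> fst p + snd p > 0}" and ?N = "{p \<in> ?H. snd p \<noteq> 0 \<and> fst p + snd p < 0}"
  have fH: "finite ?H" by (rule finite_hooks[OF fin])
  have t0: "t > 0" using t odd_pos by blast
  have pos: "m > 0" if "m \<in> M" for m using that M0 by (metis not_gr0)
  let ?S1 = "{(m, k). m \<in> M \<and> k \<in> {0<..<m} \<and> k \<notin> M \<and> t dvd m - k}"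
  let ?S2 = "{(m, k). m \<in> M \<and> k \<in> {0<..<m} \<and> k \<in> M \<and> t dvd m + k}"
  let ?S0 = "{m \<in> M. t dvd m}"
  \<comment> \<open>Each pair is represented by its member with a + b > 0. Then a is an element m of
    M, and b is either a positive non-element k < m or, in \<open>P2\<close>, the negative of an
    element k < m.\<close>
  have P1: "{p \<in> ?P. snd p > 0} = (\<lambda>(m, k). (int m, int k)) ` ?S1"
  proof (intro equalityI subsetI)
    fix p assume p: "p \<in> {p \<in> ?P. snd p > 0}"
    obtain a b where ab: "p = (a, b)" by fastforce
    have "b > 0" "b < a" using p ab by (auto simp: hooks_def)
    then obtain m k where mk: "a = int m" "b = int k" using nonneg_int_cases by (metis less_imp_le order_less_trans)
    have "0 < k" "k < m" using \<open>b > 0\<close> \<open>b < a\<close> mk by auto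
    moreover have "m \<in> M" "k \<notin> M" "int t dvd int m - int k"
      using p ab mk \<open>0 < k\<close> \<open>k < m\<close> by (auto simp: hooks_def maya_int)
    moreover from this have "t dvd m - k"
      using \<open>k < m\<close> by (metis less_imp_le of_nat_diff of_nat_dvd_iff)
    ultimately show "p \<in> (\<lambda>(m, k). (int m, int k)) ` ?S1" using ab mk by auto
  next
    fix p assume "p \<in> (\<lambda>(m, k). (int m, int k)) ` ?S1"
    then obtain m k where mk: "p = (int m, int k)" "m \<in> M" "0 < k" "k < m" "k \<notin> M" "t dvd m - k" by auto
    then have "int t dvd int m - int k" by (metis less_imp_le of_nat_diff of_nat_dvd_iff)
    then show "p \<in> {p \<in> ?P. snd p > 0}" using mk by (auto simp: hooks_def maya_int)
  qed
  have P2: "{p \<in> ?P. snd p < 0} = (\<lambda>(m, k). (int m, - int k)) ` ?S2"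
  proof (intro equalityI subsetI)
    fix p assume p: "p \<in> {p \<in> ?P. snd p < 0}"
    obtain a b where ab: "p = (a, b)" by fastforce
    have "- b > 0" "- b < a" using p ab by (auto simp: hooks_def)
    then obtain m k where mk: "a = int m" "- b = int k" using nonneg_int_cases by (metis less_imp_le order_less_trans)
    then have b: "b = - int k" by simp
    have "0 < k" "k < m" using \<open>- b > 0\<close> \<open>- b < a\<close> mk by auto
    moreover have "m \<in> M" "k \<in> M" "int t dvd int m + int k"
      using p ab mk(1) b \<open>0 < k\<close> \<open>k < m\<close> by (auto simp: hooks_def maya_int maya_neg_int)
    moreover from this have "t dvd m + k" by (metis of_nat_add of_nat_dvd_iff)
    ultimately show "p \<in> (\<lambda>(m, k). (int m, - int k)) ` ?S2" using ab mk(1) b by auto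
  next
    fix p assume "p \<in> (\<lambda>(m, k). (int m, - int k)) ` ?S2"
    then obtain m k where mk: "p = (int m, - int k)" "m \<in> M" "0 < k" "k < m" "k \<in> M" "t dvd m + k" by auto
    then have "int t dvd int m + int k" by (metis of_nat_add of_nat_dvd_iff)
    then show "p \<in> {p \<in> ?P. snd p < 0}" using mk by (auto simp: hooks_def maya_int maya_neg_int)
  qed
  have PZ: "?Z = (\<lambda>m. (int m, 0)) ` ?S0"
  proof (intro equalityI subsetI)
    fix p assume p: "p \<in> ?Z"
    then have "fst p > 0" "maya M (fst p)" "int t dvd fst p" "snd p = 0" by (auto simp: hooks_def)
    moreover from this obtain m where "fst p = int m" "m > 0" using zero_less_imp_eq_int by blast
    ultimately show "p \<in> (\<lambda>m. (int m, 0)) ` ?S0" by (auto simp: maya_int image_iff prod_eq_iff)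
  qed (auto simp: hooks_def maya_int pos)
  have PD: "?D = (\<lambda>m. (int m, - int m)) ` ?S0"
  proof (intro equalityI subsetI)
    fix p assume p: "p \<in> ?D"
    obtain a b where ab: "p = (a, b)" by fastforce
    have a: "b = - a" "a > 0" "maya M a" "int t dvd a - b" using p ab by (auto simp: hooks_def)
    then obtain m where m: "a = int m" "m > 0" using zero_less_imp_eq_int by blast
    have "int t dvd int (2 * m)" using a m by simp
    then have "t dvd 2 * m" by (simp only: of_nat_dvd_iff)
    moreover have "coprime t 2" using t by simp
    ultimately have "t dvd m" by (simp add: coprime_dvd_mult_right_iff)
    then show "p \<in> (\<lambda>m. (int m, - int m)) ` ?S0" using ab a m by (auto simp: maya_int)
  next
    fix p assume "p \<in> (\<lambda>m. (int m, - int m)) ` ?S0"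
    then obtain m where m: "p = (int m, - int m)" "m \<in> M" "t dvd m" by auto
    then have "m > 0" "int t dvd int m + int m" using pos by auto
    then show "p \<in> ?D" using m by (auto simp: hooks_def maya_int maya_neg_int)
  qed
  have "?H = (?Z \<union> ?D) \<union> (?P \<union> ?N)" by auto
  moreover have "prod ?h ((?Z \<union> ?D) \<union> (?P \<union> ?N)) = (prod ?h ?Z * prod ?h ?D) * (prod ?h ?P * prod ?h ?N)"
    using fH by (subst prod.union_disjoint, simp, simp, force)+ simp
  ultimately have "prod ?h ?H = (prod ?h ?Z * prod ?h ?D) * (prod ?h ?P * prod ?h ?N)" by simp
  also have "prod ?h ?N = (\<Prod>(a,b)\<in>?P. ?h (- b, - a))"
  proof (rule prod.reindex_bij_witness[of _ "\<lambda>(a,b). (- b, - a)" "\<lambda>(a,b). (- b, - a)"])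
    show "(case p of (a, b) \<Rightarrow> (- b, - a)) \<in> ?P" if "p \<in> ?N" for p
    proof -
      obtain a b where ab: "p = (a, b)" by fastforce
      have "(- b, - a) \<in> ?H" using that ab by (intro hooks_reflect) auto
      moreover have "a \<noteq> 0" using that ab by (auto simp: hooks_def)
      ultimately show ?thesis using that ab by simp
    qed
    show "(case p of (a, b) \<Rightarrow> (- b, - a)) \<in> ?N" if "p \<in> ?P" for p
    proof -
      obtain a b where ab: "p = (a, b)" by fastforce
      have "(- b, - a) \<in> ?H" using that ab by (intro hooks_reflect) auto
      moreover have "a \<noteq> 0" using that ab by (auto simp: hooks_def)
      ultimately show ?thesis using that ab by simp
    qed
  qed auto
  also have "prod ?h ?P * (\<Prod>(a,b)\<in>?P. ?h (- b, - a)) = (\<Prod>(a,b)\<in>?P. 1 - (?\<sigma> / of_int (a - b))\<^sup>2)"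
    unfolding prod.distrib[symmetric] by (intro prod.cong refl) (auto simp: hook_factor_reflect simp del: of_int_diff)
  also have "\<dots> = (\<Prod>(m,k)\<in>{(m,k). m \<in> M \<and> k \<in> {0<..<m} \<and> k \<notin> M \<and> t dvd m - k}. 1 - (?\<sigma> / of_nat (m - k))\<^sup>2)
      * (\<Prod>(m,k)\<in>{(m,k). m \<in> M \<and> k \<in> {0<..<m} \<and> k \<in> M \<and> t dvd m + k}. 1 - (?\<sigma> / of_nat (m + k))\<^sup>2)"
  proof -
    have e: "?P = {p \<in> ?P. snd p > 0} \<union> {p \<in> ?P. snd p < 0}" by auto
    have "prod (\<lambda>(a,b). 1 - (?\<sigma> / of_int (a - b))\<^sup>2) ?P =
       prod (\<lambda>(a,b). 1 - (?\<sigma> / of_int (a - b))\<^sup>2) {p \<in> ?P. snd p > 0} *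
       prod (\<lambda>(a,b). 1 - (?\<sigma> / of_int (a - b))\<^sup>2) {p \<in> ?P. snd p < 0}"
      using fH by (subst e, subst prod.union_disjoint) (simp, simp, force, simp)
    also have "prod (\<lambda>(a,b). 1 - (?\<sigma> / of_int (a - b))\<^sup>2) {p \<in> ?P. snd p > 0} =
       (\<Prod>(m,k)\<in>?S1. 1 - (?\<sigma> / of_nat (m - k))\<^sup>2)"
      unfolding P1 by (subst prod.reindex) (auto simp: inj_on_def of_nat_diff intro!: prod.cong)
    also have "prod (\<lambda>(a,b). 1 - (?\<sigma> / of_int (a - b))\<^sup>2) {p \<in> ?P. snd p < 0} =
       (\<Prod>(m,k)\<in>?S2. 1 - (?\<sigma> / of_nat (m + k))\<^sup>2)"
      unfolding P2 by (subst prod.reindex) (auto simp: inj_on_def intro!: prod.cong)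
    finally show ?thesis .
  qed
  also have "(\<Prod>(m,k)\<in>{(m,k). m \<in> M \<and> k \<in> {0<..<m} \<and> k \<notin> M \<and> t dvd m - k}. 1 - (?\<sigma> / of_nat (m - k))\<^sup>2)
      * (\<Prod>(m,k)\<in>{(m,k). m \<in> M \<and> k \<in> {0<..<m} \<and> k \<in> M \<and> t dvd m + k}. 1 - (?\<sigma> / of_nat (m + k))\<^sup>2) =
      (\<Prod>m\<in>M. \<Prod>k\<in>{0<..<m}.
        if k \<notin> M \<and> t dvd m - k then 1 - (?\<sigma> / of_nat (m - k))\<^sup>2
        else if k \<in> M \<and> t dvd m + k then 1 - (?\<sigma> / of_nat (m + k))\<^sup>2 else 1)"
  proof -
    let ?S = "SIGMA m:M. {0<..<m}"
    have fS: "finite ?S" using fin by auto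
    have "(\<Prod>(m,k)\<in>?S1. 1 - (?\<sigma> / of_nat (m - k))\<^sup>2) =
        (\<Prod>(m,k)\<in>?S. if k \<notin> M \<and> t dvd m - k then 1 - (?\<sigma> / of_nat (m - k))\<^sup>2 else 1)"
      by (rule prod.mono_neutral_cong_left) (use fS in \<open>auto split: if_splits\<close>)
    moreover have "(\<Prod>(m,k)\<in>?S2. 1 - (?\<sigma> / of_nat (m + k))\<^sup>2) =
        (\<Prod>(m,k)\<in>?S. if k \<in> M \<and> t dvd m + k then 1 - (?\<sigma> / of_nat (m + k))\<^sup>2 else 1)"
      by (rule prod.mono_neutral_cong_left) (use fS in \<open>auto split: if_splits\<close>)
    ultimately have "(\<Prod>(m,k)\<in>?S1. 1 - (?\<sigma> / of_nat (m - k))\<^sup>2) * (\<Prod>(m,k)\<in>?S2. 1 - (?\<sigma> / of_nat (m + k))\<^sup>2) =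
        (\<Prod>(m,k)\<in>?S. if k \<notin> M \<and> t dvd m - k then 1 - (?\<sigma> / of_nat (m - k))\<^sup>2
          else if k \<in> M \<and> t dvd m + k then 1 - (?\<sigma> / of_nat (m + k))\<^sup>2 else 1)"
      by (simp only: prod.distrib[symmetric]) (intro prod.cong refl, auto)
    also have "\<dots> = (\<Prod>m\<in>M. \<Prod>k\<in>{0<..<m}.
        if k \<notin> M \<and> t dvd m - k then 1 - (?\<sigma> / of_nat (m - k))\<^sup>2
        else if k \<in> M \<and> t dvd m + k then 1 - (?\<sigma> / of_nat (m + k))\<^sup>2 else 1)"
      by (subst prod.Sigma) (use fin in auto)
    finally show ?thesis .
  qed
  also have "prod ?h ?Z = (\<Prod>m\<in>?S0. 1 - ?\<sigma> / of_nat m)"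
    unfolding PZ by (subst prod.reindex) (auto simp: inj_on_def hook_factor_def)
  also have "prod ?h ?D = (\<Prod>m\<in>?S0. 1 - ?\<sigma> / of_nat (2 * m))"
    unfolding PD by (subst prod.reindex) (auto simp: inj_on_def hook_factor_def)
  also have "(\<Prod>m\<in>?S0. 1 - ?\<sigma> / of_nat m) * (\<Prod>m\<in>?S0. 1 - ?\<sigma> / of_nat (2 * m)) =
      (\<Prod>m\<in>M. if t dvd m then (1 - ?\<sigma> / of_nat m) * (1 - ?\<sigma> / of_nat (2 * m)) else 1)"
    unfolding prod.distrib[symmetric] by (rule prod.mono_neutral_cong_left) (use fin in auto)
  finally show ?thesis
    unfolding set_weight_def by (simp only: prod.distrib)
qed

text \<open>The shifts move the residue classes \<open>\<plusminus> r\<close> of \<open>maya M\<close> rigidly in opposite directions; \<open>c r\<close> is used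
  only for \<open>0 < 2 r < t\<close>.\<close>

definition class_shift :: "nat \<Rightarrow> (nat \<Rightarrow> int) \<Rightarrow> int \<Rightarrow> int" where
  "class_shift t c a = (if a mod int t = 0 then 0
     else if 2 * (a mod int t) < int t then c (nat (a mod int t)) else - c (nat (int t - a mod int t)))"

definition shift_map :: "nat \<Rightarrow> (nat \<Rightarrow> int) \<Rightarrow> int \<Rightarrow> int" where
  "shift_map t c a = a + int t * class_shift t c a"

text \<open>Membership is tested on the preimage, hence the negated \<open>c\<close>; by
  \<open>maya_set_shift\<close> the complete Maya set is the image under
  \<open>shift_map t c\<close>.\<close>

definition set_shift :: "nat \<Rightarrow> (nat \<Rightarrow> int) \<Rightarrow> nat set \<Rightarrow> nat set" where
  "set_shift t c M = {m. m > 0 \<and> maya M (shift_map t (\<lambda>r. - c r) (int m))}"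

lemma mod_uminus_int:
  assumes "t > 0"
  shows "(- a) mod int t = (if a mod int t = 0 then 0 else int t - a mod int t)"
  by (simp add: zmod_zminus1_eq_if)

lemma class_shift_mod_cong: "a mod int t = b mod int t \<Longrightarrow> class_shift t c a = class_shift t c b"
  by (simp add: class_shift_def)

lemma class_shift_dvd: "int t dvd a \<Longrightarrow> class_shift t c a = 0"
  by (simp add: class_shift_def)

lemma class_shift_neg: "class_shift t (\<lambda>r. - c r) a = - class_shift t c a"
  by (simp add: class_shift_def)

text \<open>This antisymmetry keeps the shifted Maya set symmetric under complement and negation, so
  that it belongs to a set again. Oddness of t excludes the self-opposite residue t/2.\<close>

lemma class_shift_uminus:
  assumes "odd t"
  shows "class_shift t c (- a) = - class_shift t c a"
proof (cases "a mod int t = 0")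
  case False
  have t0: "t > 0" using assms odd_pos by blast
  define r where "r = a mod int t"
  have "0 \<le> r" unfolding r_def using t0 by (intro pos_mod_sign) simp
  then have r: "0 < r" using False unfolding r_def by linarith
  have r': "r < int t" unfolding r_def using t0 by (intro pos_mod_bound) simp
  have m: "(- a) mod int t = int t - r" using mod_uminus_int[OF t0, of a] False by (simp add: r_def)
  have "2 * r \<noteq> int t"
  proof
    assume "2 * r = int t"
    then have "even (int t)" by (metis dvd_triv_left)
    then show False using assms by simp
  qed
  then consider "2 * r < int t" | "2 * r > int t" by linarith
  then show ?thesis
  proof cases
    case 1
    then have "\<not> 2 * (int t - r) < int t" "int t - (int t - r) = r" by auto
    then show ?thesis unfolding class_shift_def m r_def[symmetric] using 1 r r' by (simp only: if_True if_False) simp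
  next
    case 2
    then have "2 * (int t - r) < int t" "\<not> 2 * r < int t" by auto
    then show ?thesis unfolding class_shift_def m r_def[symmetric] using r r' by simp
  qed
next
  case True
  then have "int t dvd a" by (metis dvd_eq_mod_eq_0)
  then show ?thesis by (simp add: class_shift_dvd)
qed

lemma shift_map_mod [simp]: "shift_map t c a mod int t = a mod int t"
  by (simp add: shift_map_def)

lemma dvd_shift_map_iff [simp]: "int t dvd shift_map t c a \<longleftrightarrow> int t dvd a"
  unfolding shift_map_def by (metis dvd_add_left_iff dvd_triv_left)

lemma shift_map_inverse: "shift_map t (\<lambda>r. - c r) (shift_map t c a) = a"
proof -
  have "class_shift t c (shift_map t c a) = class_shift t c a"
    by (rule class_shift_mod_cong) simp
  then show ?thesis by (simp add: shift_map_def[of t "\<lambda>r. - c r"] class_shift_neg) (simp add: shift_map_def)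
qed

lemma shift_map_inverse': "shift_map t c (shift_map t (\<lambda>r. - c r) a) = a"
  using shift_map_inverse[of t "\<lambda>r. - c r" a] by simp

lemma shift_map_inj: "shift_map t c a = shift_map t c b \<longleftrightarrow> a = b"
  by (metis shift_map_inverse)

lemma shift_map_0 [simp]: "shift_map t c 0 = 0"
  by (simp add: shift_map_def class_shift_def)

lemma shift_map_eq_0 [simp]: "shift_map t c a = 0 \<longleftrightarrow> a = 0"
  using shift_map_inj[of t c a 0] by simp

lemma shift_map_uminus: "odd t \<Longrightarrow> shift_map t c (- a) = - shift_map t c a"
  by (simp add: shift_map_def class_shift_uminus)

text \<open>The two ends of a hook divisible by t lie in one residue class and move together, so
  hook lengths are preserved.\<close>

lemma shift_map_diff:
  assumes "int t dvd a - b"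
  shows "shift_map t c a - shift_map t c b = a - b"
proof -
  have "a mod int t = b mod int t" using assms by (simp add: mod_eq_dvd_iff)
  then show ?thesis by (simp add: shift_map_def class_shift_mod_cong[of a t b])
qed

lemma shift_map_dvd: "int t dvd a \<Longrightarrow> shift_map t c a = a"
  by (simp add: shift_map_def class_shift_dvd)

lemma zero_notin_set_shift: "0 \<notin> set_shift t c M"
  by (simp add: set_shift_def)

lemma maya_set_shift:
  assumes "odd t"
  shows "maya (set_shift t c M) a \<longleftrightarrow> maya M (shift_map t (\<lambda>r. - c r) a)"
proof -
  consider "a = 0" | "a > 0" | "a < 0" by linarith
  then show ?thesis
  proof cases
    case 3
    then have "maya (set_shift t c M) a \<longleftrightarrow> \<not> maya M (shift_map t (\<lambda>r. - c r) (- a))"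
      by (simp add: maya_def[of "set_shift t c M"]) (simp add: set_shift_def)
    also have "\<dots> \<longleftrightarrow> maya M (shift_map t (\<lambda>r. - c r) a)"
      unfolding shift_map_uminus[OF assms] using 3 by (subst maya_uminus) auto
    finally show ?thesis .
  next
    case 2
    then show ?thesis by (simp add: maya_def[of "set_shift t c M"]) (simp add: set_shift_def)
  qed simp
qed

lemma set_shift_inverse:
  assumes "odd t" "0 \<notin> M"
  shows "set_shift t c (set_shift t (\<lambda>r. - c r) M) = M"
proof -
  have "m \<in> set_shift t c (set_shift t (\<lambda>r. - c r) M) \<longleftrightarrow> m \<in> M" for m
  proof (cases "m = 0")
    case False
    then have "m \<in> set_shift t c (set_shift t (\<lambda>r. - c r) M) \<longleftrightarrow> maya M (int m)"
      by (simp add: set_shift_def[of t c] maya_set_shift[OF assms(1)] shift_map_inverse')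
    then show ?thesis using False maya_int by simp
  qed (use assms zero_notin_set_shift in auto)
  then show ?thesis by blast
qed

lemma finite_set_shift:
  assumes "odd t" "finite M"
  shows "finite (set_shift t c M)"
proof -
  have t0: "t > 0" using assms(1) odd_pos by blast
  define C where "C = (\<Sum>r<t. \<bar>c r\<bar>)"
  have C: "\<bar>class_shift t c a\<bar> \<le> C" for a
  proof -
    have c: "\<bar>c r\<bar> \<le> C" if "r < t" for r
      unfolding C_def using that by (intro member_le_sum) auto
    have "0 \<le> C" unfolding C_def by (intro sum_nonneg) auto
    moreover have "nat (a mod int t) < t" using t0 by (simp add: nat_less_iff)
    moreover have "nat (int t - a mod int t) < t" if "a mod int t \<noteq> 0"
    proof -
      have "0 < a mod int t" using that t0 pos_mod_sign[of "int t" a] by linarith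
      then show ?thesis using t0 by linarith
    qed
    ultimately show ?thesis unfolding class_shift_def using c by auto
  qed
  have "set_shift t c M \<subseteq> {..\<Sum>M + t * nat C}"
  proof
    fix m assume m: "m \<in> set_shift t c M"
    let ?a = "shift_map t (\<lambda>r. - c r) (int m)"
    have "maya M ?a" using m by (simp add: set_shift_def)
    have "?a \<le> int (\<Sum>M)"
    proof (cases "?a > 0")
      case True
      then have "nat ?a \<in> M" using \<open>maya M ?a\<close> by (simp add: maya_def)
      then have "nat ?a \<le> \<Sum>M" using member_le_sum[of "nat ?a" M "\<lambda>x. x"] assms(2) by simp
      then show ?thesis by linarith
    next
      case False
      then have "?a \<le> 0" by simp
      also have "0 \<le> int (\<Sum>M)" by (rule of_nat_0_le_iff)
      finally show ?thesis .
    qed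
    then have "int m \<le> int (\<Sum>M) + int t * class_shift t c (int m)"
      by (simp add: shift_map_def class_shift_neg)
    also have "\<dots> \<le> int (\<Sum>M) + int t * C"
      using C[of "int m"] by (intro add_left_mono mult_left_mono) auto
    also have "\<dots> = int (\<Sum>M + t * nat C)" using C[of 0] by simp
    finally show "m \<in> {..\<Sum>M + t * nat C}" by (simp only: of_nat_le_iff atMost_iff)
  qed
  then show ?thesis by (rule finite_subset) simp
qed

lemma hooks_set_shift:
  assumes "odd t"
  shows "hooks t (set_shift t c M) = (\<lambda>(a, b). (shift_map t c a, shift_map t c b)) ` hooks t M"
proof (intro equalityI subsetI)
  fix p assume p: "p \<in> hooks t (set_shift t c M)"
  obtain a b where ab: "p = (a, b)" by fastforce
  let ?g = "shift_map t (\<lambda>r. - c r)"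
  have "int t dvd a - b" using p ab by (simp add: hooks_def)
  then have "?g a - ?g b = a - b" by (rule shift_map_diff)
  then have "(?g a, ?g b) \<in> hooks t M" using p ab by (auto simp: hooks_def maya_set_shift[OF assms])
  moreover have "p = (shift_map t c (?g a), shift_map t c (?g b))" by (simp add: ab shift_map_inverse')
  ultimately show "p \<in> (\<lambda>(a, b). (shift_map t c a, shift_map t c b)) ` hooks t M" by force
next
  fix p assume "p \<in> (\<lambda>(a, b). (shift_map t c a, shift_map t c b)) ` hooks t M"
  then obtain a b where ab: "p = (shift_map t c a, shift_map t c b)" "(a, b) \<in> hooks t M" by auto
  then have "int t dvd a - b" by (simp add: hooks_def)
  then have "shift_map t c a - shift_map t c b = a - b" by (rule shift_map_diff)
  then show "p \<in> hooks t (set_shift t c M)"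
    using ab by (auto simp: hooks_def maya_set_shift[OF assms] shift_map_inverse)
qed

lemma inj_on_shift_pair: "inj_on (\<lambda>(a, b). (shift_map t c a, shift_map t c b)) S"
  by (auto simp: inj_on_def shift_map_inj)

lemma card_hooks_set_shift: "odd t \<Longrightarrow> card (hooks t (set_shift t c M)) = card (hooks t M)"
  by (simp add: hooks_set_shift card_image inj_on_shift_pair)

definition low_class :: "nat \<Rightarrow> int \<Rightarrow> bool" where
  "low_class t a \<longleftrightarrow> \<not> int t dvd a \<and> 2 * (a mod int t) < int t"

lemma low_class_uminus:
  assumes "odd t" "\<not> int t dvd a"
  shows "low_class t (- a) \<longleftrightarrow> \<not> low_class t a"
proof -
  have t0: "t > 0" using assms(1) odd_pos by blast
  have "a mod int t \<noteq> 0" using assms(2) by (metis dvd_eq_mod_eq_0)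
  then have "(- a) mod int t = int t - a mod int t" using mod_uminus_int[OF t0] by simp
  moreover have "2 * (a mod int t) \<noteq> int t"
  proof
    assume "2 * (a mod int t) = int t"
    then have "even (int t)" by (metis dvd_triv_left)
    then show False using assms(1) by simp
  qed
  ultimately show ?thesis using assms(2) by (auto simp: low_class_def)
qed

lemma low_class_cong: "a mod int t = b mod int t \<Longrightarrow> low_class t a = low_class t b"
  unfolding low_class_def dvd_eq_mod_eq_0 by (simp only:)

text \<open>A shift may change the sign of a + b, so single factors are not invariant. Reflection
  exchanges the low and the high residue classes, and pairing along it gives factors that depend on
  the hook length alone. Only residue 0 keeps single factors, and shifts do not move it.\<close>

lemma prod_hooks_classes:
  assumes t: "odd t" and fin: "finite M"
  shows "(\<Prod>p\<in>hooks t M. hook_factor t s p) =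
    (\<Prod>p\<in>{p \<in> hooks t M. int t dvd fst p}. hook_factor t s p) *
    (\<Prod>p\<in>{p \<in> hooks t M. low_class t (fst p)}. 1 - (of_nat t * s / of_int (fst p - snd p))\<^sup>2)"
proof -
  let ?H = "hooks t M" and ?h = "hook_factor t s"
  have fH: "finite ?H" by (rule finite_hooks[OF fin])
  let ?A = "{p \<in> ?H. int t dvd fst p}" and ?L = "{p \<in> ?H. low_class t (fst p)}"
  let ?U = "{p \<in> ?H. \<not> int t dvd fst p \<and> \<not> low_class t (fst p)}"
  have mod: "fst p mod int t = snd p mod int t" if "p \<in> ?H" for p
    using that by (auto simp: hooks_def mod_eq_dvd_iff)
  have "?H = ?A \<union> (?L \<union> ?U)" by auto
  moreover have "prod ?h (?A \<union> (?L \<union> ?U)) = prod ?h ?A * (prod ?h ?L * prod ?h ?U)"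
    using fH by (subst prod.union_disjoint, simp, simp, force simp: low_class_def)+ simp
  ultimately have "prod ?h ?H = prod ?h ?A * (prod ?h ?L * prod ?h ?U)" by simp
  also have "prod ?h ?U = (\<Prod>p\<in>?L. ?h (- snd p, - fst p))"
  proof (rule prod.reindex_bij_witness[of _ "\<lambda>p. (- snd p, - fst p)" "\<lambda>p. (- snd p, - fst p)"])
    show "(- snd p, - fst p) \<in> ?L" if "p \<in> ?U" for p
    proof -
      have nd: "\<not> int t dvd snd p" using that mod[of p] by (metis (mono_tags, lifting) dvd_eq_mod_eq_0 mem_Collect_eq)
      then have "snd p \<noteq> 0" by auto
      then have "(- snd p, - fst p) \<in> ?H" using that hooks_reflect[of "fst p" "snd p"] by simp
      moreover have "\<not> low_class t (snd p)" using that low_class_cong[OF mod[of p]] by simp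
      ultimately show ?thesis using low_class_uminus[OF t nd] by simp
    qed
    show "(- snd p, - fst p) \<in> ?U" if "p \<in> ?L" for p
    proof -
      have "low_class t (snd p)" using that low_class_cong[OF mod[of p]] by simp
      then have nd: "\<not> int t dvd snd p" by (simp add: low_class_def)
      then have "snd p \<noteq> 0" by auto
      then have "(- snd p, - fst p) \<in> ?H" using that hooks_reflect[of "fst p" "snd p"] by simp
      then show ?thesis using low_class_uminus[OF t nd] \<open>low_class t (snd p)\<close> nd by simp
    qed
  qed auto
  also have "prod ?h ?L * (\<Prod>p\<in>?L. ?h (- snd p, - fst p)) = (\<Prod>p\<in>?L. 1 - (of_nat t * s / of_int (fst p - snd p))\<^sup>2)"
    unfolding prod.distrib[symmetric]
  proof (intro prod.cong refl)
    fix p assume p: "p \<in> ?L"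
    obtain a b where ab: "p = (a, b)" by fastforce
    have "a + b \<noteq> 0"
    proof
      assume "a + b = 0"
      then have "2 * a = a - b" by simp
      then have "int t dvd 2 * a" using p ab by (auto simp: hooks_def)
      moreover have "coprime (int t) 2" using t by simp
      ultimately show False using p ab by (simp add: low_class_def coprime_dvd_mult_right_iff)
    qed
    then consider "a + b > 0" | "- b + - a > 0" by linarith
    then show "?h p * ?h (- snd p, - fst p) = 1 - (of_nat t * s / of_int (fst p - snd p))\<^sup>2"
    proof cases
      case 1
      then show ?thesis unfolding ab using hook_factor_reflect by simp
    next
      case 2
      then show ?thesis unfolding ab using hook_factor_reflect[OF 2, of t s] by (simp add: mult.commute)
    qed
  qed
  finally show ?thesis .
qed

lemma set_weight_set_shift:
  assumes t: "odd t" and fin: "finite M" and M0: "0 \<notin> M"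
  shows "set_weight t s (set_shift t c M) = set_weight t s M"
proof -
  let ?g = "\<lambda>(a, b). (shift_map t c a, shift_map t c b)"
  have 1: "{p \<in> hooks t (set_shift t c M). int t dvd fst p} = ?g ` {p \<in> hooks t M. int t dvd fst p}"
  proof -
    have "int t dvd fst (?g p) \<longleftrightarrow> int t dvd fst p" for p by (simp add: case_prod_unfold)
    then show ?thesis unfolding hooks_set_shift[OF t] by blast
  qed
  have 2: "{p \<in> hooks t (set_shift t c M). low_class t (fst p)} = ?g ` {p \<in> hooks t M. low_class t (fst p)}"
  proof -
    have "low_class t (fst (?g p)) \<longleftrightarrow> low_class t (fst p)" for p
      using low_class_cong[OF shift_map_mod, of t c "fst p"] by (simp add: case_prod_unfold)
    then show ?thesis unfolding hooks_set_shift[OF t] by blast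
  qed
  have "set_weight t s (set_shift t c M) = (\<Prod>p\<in>hooks t (set_shift t c M). hook_factor t s p)"
    by (rule prod_hook_factor[OF finite_set_shift[OF t fin] zero_notin_set_shift t, symmetric])
  also have "\<dots> = (\<Prod>p\<in>?g ` {p \<in> hooks t M. int t dvd fst p}. hook_factor t s p) *
    (\<Prod>p\<in>?g ` {p \<in> hooks t M. low_class t (fst p)}. 1 - (of_nat t * s / of_int (fst p - snd p))\<^sup>2)"
    unfolding prod_hooks_classes[OF t finite_set_shift[OF t fin]] 1 2 ..
  also have "(\<Prod>p\<in>?g ` {p \<in> hooks t M. int t dvd fst p}. hook_factor t s p) =
      (\<Prod>p\<in>{p \<in> hooks t M. int t dvd fst p}. hook_factor t s p)"
  proof (subst prod.reindex[OF inj_on_shift_pair], intro prod.cong refl)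
    fix p assume p: "p \<in> {p \<in> hooks t M. int t dvd fst p}"
    obtain a b where ab: "p = (a, b)" by fastforce
    then have "int t dvd a" "int t dvd a - b" using p by (auto simp: hooks_def)
    then have "int t dvd a - (a - b)" by (rule dvd_diff)
    then show "(hook_factor t s \<circ> ?g) p = hook_factor t s p"
      using \<open>int t dvd a\<close> by (simp add: ab shift_map_dvd)
  qed
  also have "(\<Prod>p\<in>?g ` {p \<in> hooks t M. low_class t (fst p)}. 1 - (of_nat t * s / of_int (fst p - snd p))\<^sup>2) =
      (\<Prod>p\<in>{p \<in> hooks t M. low_class t (fst p)}. 1 - (of_nat t * s / of_int (fst p - snd p))\<^sup>2)"
  proof (subst prod.reindex[OF inj_on_shift_pair], intro prod.cong refl)
    fix p assume p: "p \<in> {p \<in> hooks t M. low_class t (fst p)}"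
    obtain a b where ab: "p = (a, b)" by fastforce
    then have "int t dvd a - b" using p by (auto simp: hooks_def)
    then have "shift_map t c a - shift_map t c b = a - b" by (rule shift_map_diff)
    then show "((\<lambda>p. 1 - (of_nat t * s / of_int (fst p - snd p))\<^sup>2) \<circ> ?g) p =
        1 - (of_nat t * s / of_int (fst p - snd p))\<^sup>2"
      unfolding ab by (simp del: of_int_diff)
  qed
  also have "(\<Prod>p\<in>{p \<in> hooks t M. int t dvd fst p}. hook_factor t s p) *
      (\<Prod>p\<in>{p \<in> hooks t M. low_class t (fst p)}. 1 - (of_nat t * s / of_int (fst p - snd p))\<^sup>2) = set_weight t s M"
    unfolding prod_hooks_classes[OF t fin, symmetric] by (rule prod_hook_factor[OF fin M0 t])
  finally show ?thesis .
qed

text \<open>Passing to the symmetric set \<open>maya M\<close>, the left-hand side is half of a regularised sum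
  of \<open>\<phi>\<close> over a shifted set; this makes it additive.\<close>

lemma sum_set_shift:
  fixes \<phi> :: "int \<Rightarrow> int"
  assumes t: "odd t" and fin: "finite M" and M0: "0 \<notin> M" and odd: "\<And>a. \<phi> (- a) = - \<phi> a"
  shows "(\<Sum>m\<in>set_shift t c M. \<phi> (int m)) =
    (\<Sum>m\<in>set_shift t c {}. \<phi> (int m)) + (\<Sum>m\<in>M. \<phi> (shift_map t c (int m)))"
proof -
  let ?S = "shift_map t c" and ?g = "shift_map t (\<lambda>r. - c r)"
  \<comment> \<open>The elements that the shift sends to the positive side, described by their
    positions before the shift.\<close>
  define T where "T M = {a. ?S a > 0 \<and> maya M a}" for M
  have T: "(\<Sum>m\<in>set_shift t c M. \<phi> (int m)) = (\<Sum>a\<in>T M. \<phi> (?S a))" for M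
    by (rule sum.reindex_bij_witness[of _ "\<lambda>a. nat (?S a)" "\<lambda>m. ?g (int m)"])
      (auto simp: set_shift_def T_def shift_map_inverse shift_map_inverse')
  have finT: "finite (T {})"
  proof -
    have "T {} \<subseteq> (\<lambda>m. ?g (int m)) ` set_shift t c {}"
    proof
      fix a assume "a \<in> T {}"
      then have "nat (?S a) \<in> set_shift t c {}" "a = ?g (int (nat (?S a)))"
        by (auto simp: set_shift_def T_def shift_map_inverse)
      then show "a \<in> (\<lambda>m. ?g (int m)) ` set_shift t c {}" by blast
    qed
    then show ?thesis using finite_set_shift[OF t, of "{}"] finite_surj by blast
  qed
  \<comment> \<open>Compared with the empty set, M adds its elements that land on the positive side
    and removes the negatives of those that land on the negative side. As \<phi> is odd, each
    element contributes its \<phi> value in both cases.\<close>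
  let ?P = "int ` {m \<in> M. ?S (int m) > 0}" and ?E = "(\<lambda>m. - int m) ` {m \<in> M. ?S (int m) < 0}"
  have pos: "m > 0" if "m \<in> M" for m using that M0 by (metis not_gr0)
  have E: "?E \<subseteq> T {}" using pos by (auto simp: T_def maya_def shift_map_uminus[OF t])
  have TM: "T M = ?P \<union> (T {} - ?E)"
  proof (intro equalityI subsetI)
    fix a assume a: "a \<in> T M"
    then have "a \<noteq> 0" by (auto simp: T_def)
    then consider "a > 0" | "a < 0" by linarith
    then show "a \<in> ?P \<union> (T {} - ?E)"
    proof cases
      case 1
      then obtain m where "a = int m" by (metis zero_less_imp_eq_int)
      then show ?thesis using a 1 by (auto simp: T_def maya_def)
    next
      case 2
      then show ?thesis using a by (auto simp: T_def maya_def)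
    qed
  next
    fix a assume "a \<in> ?P \<union> (T {} - ?E)"
    then show "a \<in> T M"
    proof
      assume "a \<in> ?P"
      then show ?thesis using pos by (auto simp: T_def maya_def)
    next
      assume a: "a \<in> T {} - ?E"
      then have "a < 0" "?S a > 0" by (auto simp: T_def maya_def)
      then obtain m where m: "a = - int m" by (metis minus_minus neg_0_less_iff_less zero_less_imp_eq_int)
      have "m \<notin> M"
      proof
        assume "m \<in> M"
        moreover have "?S (int m) < 0" using \<open>?S a > 0\<close> m by (simp add: shift_map_uminus[OF t])
        ultimately show False using a m by auto
      qed
      then show ?thesis using \<open>a < 0\<close> \<open>?S a > 0\<close> m by (auto simp: T_def maya_def)
    qed
  qed
  have "(\<Sum>a\<in>T M. \<phi> (?S a)) = (\<Sum>a\<in>?P. \<phi> (?S a)) + ((\<Sum>a\<in>T {}. \<phi> (?S a)) - (\<Sum>a\<in>?E. \<phi> (?S a)))"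
    unfolding TM using fin finT E
    by (subst sum.union_disjoint) (auto simp: sum_diff T_def maya_def)
  also have "(\<Sum>a\<in>?P. \<phi> (?S a)) = (\<Sum>m | m \<in> M \<and> ?S (int m) > 0. \<phi> (?S (int m)))"
    by (subst sum.reindex) (auto simp: inj_on_def)
  also have "(\<Sum>a\<in>?E. \<phi> (?S a)) = - (\<Sum>m | m \<in> M \<and> ?S (int m) < 0. \<phi> (?S (int m)))"
    by (subst sum.reindex) (auto simp: inj_on_def shift_map_uminus[OF t] odd sum_negf)
  finally have "(\<Sum>a\<in>T M. \<phi> (?S a)) = (\<Sum>a\<in>T {}. \<phi> (?S a)) +
      ((\<Sum>m | m \<in> M \<and> ?S (int m) > 0. \<phi> (?S (int m))) + (\<Sum>m | m \<in> M \<and> ?S (int m) < 0. \<phi> (?S (int m))))"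
    by simp
  also have "(\<Sum>m | m \<in> M \<and> ?S (int m) > 0. \<phi> (?S (int m))) + (\<Sum>m | m \<in> M \<and> ?S (int m) < 0. \<phi> (?S (int m))) =
      (\<Sum>m\<in>M. \<phi> (?S (int m)))"
  proof -
    have "?S (int m) \<noteq> 0" if "m \<in> M" for m using pos[OF that] by simp
    then have "?S (int m) > 0 \<or> ?S (int m) < 0" if "m \<in> M" for m using that by (meson linorder_neqE)
    then have "M = {m \<in> M. ?S (int m) > 0} \<union> {m \<in> M. ?S (int m) < 0}" by blast
    then have "sum f M = sum f {m \<in> M. ?S (int m) > 0} + sum f {m \<in> M. ?S (int m) < 0}" for f :: "nat \<Rightarrow> int"
      using fin by (metis (no_types, lifting) sum.union_disjoint finite_Un disjoint_iff mem_Collect_eq order_less_asym)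
    then show ?thesis by simp
  qed
  finally show ?thesis unfolding T .
qed

section \<open>Charges\<close>

definition class_sign :: "nat \<Rightarrow> nat \<Rightarrow> int \<Rightarrow> int" where
  "class_sign t r a = (if a mod int t = int r then 1 else if a mod int t = int t - int r then - 1 else 0)"

definition charge :: "nat \<Rightarrow> nat \<Rightarrow> nat set \<Rightarrow> int" where
  "charge t r M = (\<Sum>m\<in>M. class_sign t r (int m))"

definition balanced :: "nat \<Rightarrow> nat set \<Rightarrow> bool" where
  "balanced t M \<longleftrightarrow> (\<forall>r. 0 < r \<longrightarrow> 2 * r < t \<longrightarrow> charge t r M = 0)"

lemma class_sign_uminus:
  assumes "0 < r" "2 * r < t"
  shows "class_sign t r (- a) = - class_sign t r a"
proof -
  have t0: "t > 0" using assms by simp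
  have "0 \<le> a mod int t" "a mod int t < int t" using t0 by auto
  then show ?thesis unfolding class_sign_def mod_uminus_int[OF t0] using assms by auto
qed

lemma class_sign_shift [simp]: "class_sign t r (shift_map t c a) = class_sign t r a"
  by (simp add: class_sign_def)

text \<open>Writes the shift through class signs, so that summing it over a set produces the charges
  of the set.\<close>

lemma class_shift_eq_sum:
  assumes t: "odd t"
  shows "class_shift t c a = (\<Sum>r | 0 < r \<and> 2 * r < t. c r * class_sign t r a)"
proof -
  have t0: "t > 0" using t odd_pos by blast
  define \<rho> where "\<rho> = nat (a mod int t)"
  have \<rho>: "a mod int t = int \<rho>" "\<rho> < t" using t0 unfolding \<rho>_def by (auto simp: nat_less_iff)
  have fin: "finite {r. 0 < r \<and> 2 * r < t}" by (rule finite_subset[of _ "{..<t}"]) auto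
  have sg: "class_sign t r a = (if \<rho> = r then 1 else if \<rho> + r = t then - 1 else 0)" if "2 * r < t" for r
    unfolding class_sign_def \<rho>(1) using that by auto
  consider "\<rho> = 0" | "0 < \<rho>" "2 * \<rho> < t" | "2 * \<rho> > t" using t by (metis even_mult_iff even_numeral linorder_neqE_nat not_gr0)
  then show ?thesis
  proof cases
    case 1
    then have "(\<Sum>r | 0 < r \<and> 2 * r < t. c r * class_sign t r a) = 0"
      by (intro sum.neutral) (auto simp: sg)
    then show ?thesis using 1 \<rho> by (simp add: class_shift_def)
  next
    case 2
    then have "(\<Sum>r | 0 < r \<and> 2 * r < t. c r * class_sign t r a) = (\<Sum>r | 0 < r \<and> 2 * r < t. if r = \<rho> then c \<rho> else 0)"
      by (intro sum.cong refl) (auto simp: sg)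
    also have "\<dots> = c \<rho>" using 2 fin by simp
    finally show ?thesis using 2 \<rho> by (simp add: class_shift_def)
  next
    case 3
    then have "(\<Sum>r | 0 < r \<and> 2 * r < t. c r * class_sign t r a) =
        (\<Sum>r | 0 < r \<and> 2 * r < t. if r = t - \<rho> then - c (t - \<rho>) else 0)"
      using \<rho>(2) by (intro sum.cong refl) (auto simp: sg)
    also have "\<dots> = - c (t - \<rho>)" using 3 \<rho>(2) fin by simp
    also have "\<dots> = class_shift t c a"
    proof -
      have "nat (int t - int \<rho>) = t - \<rho>" by simp
      then show ?thesis using 3 \<rho> by (simp add: class_shift_def)
    qed
    finally show ?thesis ..
  qed
qed

lemma card_residue:
  assumes "\<rho> < t"
  shows "finite {m. m mod t = \<rho> \<and> int m < int t * k}" "card {m. m mod t = \<rho> \<and> int m < int t * k} = nat k"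
proof -
  have "{m. m mod t = \<rho> \<and> int m < int t * k} = (\<lambda>j. \<rho> + t * j) ` {..<nat k}"
  proof (intro equalityI subsetI)
    fix m assume m: "m \<in> {m. m mod t = \<rho> \<and> int m < int t * k}"
    then have "m mod t = \<rho>" "int m < int t * k" by auto
    then have e: "m = \<rho> + t * (m div t)" using mod_mult_div_eq[of m t] by simp
    then have "int m = int \<rho> + int t * int (m div t)" by (metis of_nat_add of_nat_mult)
    then have "int t * int (m div t) < int t * k" using \<open>int m < int t * k\<close> by linarith
    then have "int (m div t) < k" using assms by (simp add: mult_less_cancel_left)
    then have "m div t < nat k" by linarith
    then show "m \<in> (\<lambda>j. \<rho> + t * j) ` {..<nat k}" using e by blast
  next
    fix m assume "m \<in> (\<lambda>j. \<rho> + t * j) ` {..<nat k}"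
    then obtain j where j: "m = \<rho> + t * j" "j < nat k" by auto
    then have "int t * (int j + 1) \<le> int t * k" using assms by (intro mult_left_mono) auto
    then have "int m < int t * k" using j assms by (simp add: distrib_left)
    then show "m \<in> {m. m mod t = \<rho> \<and> int m < int t * k}" using j assms by simp
  qed
  moreover have "inj (\<lambda>j. \<rho> + t * j)" using assms by (auto simp: inj_on_def)
  ultimately show "finite {m. m mod t = \<rho> \<and> int m < int t * k}" "card {m. m mod t = \<rho> \<and> int m < int t * k} = nat k"
    by (simp, simp add: card_image inj_on_subset[OF _ subset_UNIV])
qed

lemma charge_eq_card:
  assumes "finite M" "0 < r" "2 * r < t"
  shows "charge t r M = int (card {m \<in> M. m mod t = r}) - int (card {m \<in> M. m mod t = t - r})"
proof -
  have "charge t r M = (\<Sum>m\<in>M. (if m mod t = r then 1 else 0) - (if m mod t = t - r then 1 else 0))"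
    unfolding charge_def
  proof (intro sum.cong refl)
    fix m
    have "int m mod int t = int (m mod t)" by (rule zmod_int[symmetric])
    then have "int m mod int t = int r \<longleftrightarrow> m mod t = r" by linarith
    moreover have "int m mod int t = int t - int r \<longleftrightarrow> m mod t = t - r"
      using \<open>int m mod int t = int (m mod t)\<close> assms(2,3) by linarith
    ultimately show "class_sign t r (int m) = (if m mod t = r then 1 else 0) - (if m mod t = t - r then 1 else 0)"
      unfolding class_sign_def using assms by auto
  qed
  also have "\<dots> = (\<Sum>m\<in>{m \<in> M. m mod t = r}. 1) - (\<Sum>m\<in>{m \<in> M. m mod t = t - r}. 1)"
    unfolding sum.inter_filter[OF assms(1)] by (rule sum_subtractf)
  finally show ?thesis by simp
qed

text \<open>Of the numbers congruent to r modulo t the shifted empty set contains those below t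
  c(r), and of those congruent to -r the ones below -t c(r). At most one of the two parts is
  nonempty, and it has |c(r)| elements.\<close>

lemma charge_set_shift_empty:
  assumes t: "odd t" and r: "0 < r" "2 * r < t"
  shows "charge t r (set_shift t c {}) = c r"
proof -
  let ?S = "set_shift t c {}"
  have S: "m \<in> ?S \<longleftrightarrow> m > 0 \<and> int m < int t * class_shift t c (int m)" for m
    by (simp add: set_shift_def maya_def shift_map_def class_shift_neg)
  have 1: "{m \<in> ?S. m mod t = r} = {m. m mod t = r \<and> int m < int t * c r}"
  proof -
    have "class_shift t c (int m) = c r" if "m mod t = r" for m
    proof -
      have "int m mod int t = int r" unfolding zmod_int[symmetric] that ..
      then show ?thesis using r by (simp add: class_shift_def)
    qed
    moreover have "m > 0" if "m mod t = r" for m using that r by (cases m) auto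
    ultimately show ?thesis using S by auto
  qed
  have 2: "{m \<in> ?S. m mod t = t - r} = {m. m mod t = t - r \<and> int m < int t * (- c r)}"
  proof -
    have "class_shift t c (int m) = - c r" if "m mod t = t - r" for m
    proof -
      have "int m mod int t = int t - int r" unfolding zmod_int[symmetric] that using r by (intro of_nat_diff) simp
      moreover have "nat (int t - (int t - int r)) = r" by simp
      ultimately show ?thesis using r by (simp add: class_shift_def)
    qed
    moreover have "m > 0" if "m mod t = t - r" for m using that r by (cases m) auto
    ultimately show ?thesis using S by auto
  qed
  have "charge t r ?S = int (nat (c r)) - int (nat (- c r))"
    unfolding charge_eq_card[OF finite_set_shift[OF t finite.emptyI] r] 1 2 using r
    by (subst card_residue(2), simp, subst card_residue(2)) auto
  then show ?thesis by simp
qed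

lemma charge_set_shift:
  assumes t: "odd t" and r: "0 < r" "2 * r < t" and M: "finite M" "0 \<notin> M"
  shows "charge t r (set_shift t c M) = c r + charge t r M"
  using sum_set_shift[OF t M, of "class_sign t r" c, OF class_sign_uminus[OF r]] charge_set_shift_empty[OF t r, of c]
  by (simp add: charge_def)

text \<open>Moving B changes its sum by t times a combination of its charges, all of which
  vanish.\<close>

lemma sum_set_shift_balanced:
  assumes t: "odd t" and B: "finite B" "0 \<notin> B" "balanced t B"
  shows "\<Sum>(set_shift t c B) = \<Sum>(set_shift t c {}) + \<Sum>B"
proof -
  have "(\<Sum>m\<in>B. shift_map t c (int m)) = (\<Sum>m\<in>B. int m) + int t * (\<Sum>m\<in>B. class_shift t c (int m))"
    by (simp add: shift_map_def sum.distrib sum_distrib_left)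
  also have "(\<Sum>m\<in>B. class_shift t c (int m)) = (\<Sum>r | 0 < r \<and> 2 * r < t. c r * charge t r B)"
    unfolding class_shift_eq_sum[OF t] charge_def sum_distrib_left by (rule sum.swap)
  also have "\<dots> = 0" using B(3) by (intro sum.neutral) (auto simp: balanced_def)
  finally have "(\<Sum>m\<in>B. shift_map t c (int m)) = int (\<Sum>B)" by simp
  moreover have "(\<Sum>m\<in>set_shift t c B. int m) = (\<Sum>m\<in>set_shift t c {}. int m) + (\<Sum>m\<in>B. shift_map t c (int m))"
    by (rule sum_set_shift[OF t B(1,2), of "\<lambda>a. a"]) simp
  ultimately have "int (\<Sum>(set_shift t c B)) = int (\<Sum>(set_shift t c {}) + \<Sum>B)" by simp
  then show ?thesis by (simp only: of_nat_eq_iff)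
qed

text \<open>The function \<psi> is odd, invariant under the shift and equal to 1 or -1 away from 0.
  So its sum over a set has the parity of the cardinality, and \<open>sum_set_shift\<close> makes it
  additive.\<close>

lemma sign_set_shift:
  assumes t: "odd t" and B: "finite B" "0 \<notin> B"
  shows "(-1 :: complex) ^ card (set_shift t c B) = (-1) ^ card (set_shift t c {}) * (-1) ^ card B"
proof -
  define \<psi> :: "int \<Rightarrow> int" where "\<psi> a = (if int t dvd a then sgn a else if low_class t a then 1 else - 1)" for a
  have odd: "\<psi> (- a) = - \<psi> a" for a
    unfolding \<psi>_def using low_class_uminus[OF t, of a] by (auto simp: sgn_minus)
  have inv: "\<psi> (shift_map t c a) = \<psi> a" for a
    unfolding \<psi>_def using low_class_cong[OF shift_map_mod, of t c a] by (auto simp: shift_map_dvd)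
  have par: "even (\<Sum>m\<in>M. \<psi> (int m)) \<longleftrightarrow> even (card M)" if "finite M" "0 \<notin> M" for M
    using that
  proof (induction M rule: finite_induct)
    case (insert m M)
    then have "odd (\<psi> (int m))" by (auto simp: \<psi>_def)
    then show ?case using insert by auto
  qed simp
  have "(\<Sum>m\<in>set_shift t c B. \<psi> (int m)) = (\<Sum>m\<in>set_shift t c {}. \<psi> (int m)) + (\<Sum>m\<in>B. \<psi> (int m))"
    using sum_set_shift[OF t B, of \<psi> c, OF odd] by (simp add: inv)
  then have "even (card (set_shift t c B)) \<longleftrightarrow> (even (card (set_shift t c {})) \<longleftrightarrow> even (card B))"
    using par[OF finite_set_shift[OF t B(1)] zero_notin_set_shift]
      par[OF finite_set_shift[OF t finite.emptyI] zero_notin_set_shift] par[OF B]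
    by (metis even_add)
  then show ?thesis by (cases "even (card (set_shift t c {}))"; cases "even (card B)") auto
qed

section \<open>Counting the hooks of balanced sets\<close>

lemma sum_card_less:
  fixes S :: "'a::linorder set"
  assumes "finite S"
  shows "2 * (\<Sum>j\<in>S. card {k \<in> S. k < j}) = card S * (card S - 1)"
  using assms
proof (induction S rule: finite_linorder_max_induct)
  case (insert b S)
  have b: "b \<notin> S" using insert by auto
  have "{k \<in> insert b S. k < b} = S" using insert by auto
  moreover have "(\<Sum>j\<in>S. card {k \<in> insert b S. k < j}) = (\<Sum>j\<in>S. card {k \<in> S. k < j})"
    using insert(2) by (intro sum.cong refl arg_cong[where f=card]) auto
  ultimately have "2 * (\<Sum>j\<in>insert b S. card {k \<in> insert b S. k < j}) = 2 * card S + card S * (card S - 1)"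
    using insert b by simp
  then show ?case using insert(1) b by (cases "card S") auto
qed simp

text \<open>The pairs on the left are the boxes of the partition with Maya diagram \<open>J\<close>,
  and the right side is the energy of a diagram of charge 0. Positions are counted from -L, below
  which everything is occupied: an element j has j + L positions under it, of which the occupied
  ones are subtracted.\<close>

lemma card_inversions:
  fixes J :: "int \<Rightarrow> bool"
  assumes lo: "\<And>j. j < - int L \<Longrightarrow> J j" and fin: "finite {j. 0 \<le> j \<and> J j}"
    and charge: "card {j. 0 \<le> j \<and> J j} = card {j. j < 0 \<and> \<not> J j}"
  shows "int (card {(j, k). J j \<and> \<not> J k \<and> k < j}) =
    (\<Sum>j | 0 \<le> j \<and> J j. j) - (\<Sum>j | j < 0 \<and> \<not> J j. j)"
proof -
  let ?P = "{j. 0 \<le> j \<and> J j}" and ?N = "{j. j < 0 \<and> \<not> J j}" and ?I = "{- int L..<0}"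
  define S where "S = {j. - int L \<le> j \<and> J j}"
  have N: "?N \<subseteq> ?I" using lo by force
  have S: "S = ?P \<union> (?I - ?N)" unfolding S_def by auto
  have finS: "finite S" unfolding S using fin by simp
  \<comment> \<open>Charge 0 means that S has as many elements as the interval from -L to
    -1.\<close>
  have cS: "card S = L"
  proof -
    have "card S = card ?P + card (?I - ?N)" unfolding S using fin by (intro card_Un_disjoint) auto
    also have "card (?I - ?N) = L - card ?N" using N by (subst card_Diff_subset) (auto intro: finite_subset)
    moreover have "card ?N \<le> L" using card_mono[OF _ N] by simp
    ultimately show ?thesis using charge by simp
  qed
  have sS: "\<Sum>S = \<Sum>?P + (\<Sum>?I - \<Sum>?N)"
  proof -
    have "\<Sum>S = \<Sum>?P + \<Sum>(?I - ?N)" unfolding S using fin by (intro sum.union_disjoint) auto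
    also have "\<Sum>(?I - ?N) = \<Sum>?I - \<Sum>?N" using N by (intro sum_diff) auto
    finally show ?thesis .
  qed
  have gauss: "2 * \<Sum>?I = - int L * (int L + 1)"
  proof -
    have "?I = (\<lambda>i. - int i) ` {1..L}" by (auto simp: image_iff) presburger
    then have "\<Sum>?I = - (\<Sum>i=1..L. int i)" by (simp add: sum.reindex inj_on_def sum_negf)
    moreover have "2 * (\<Sum>i=1..L. int i) = int L * (int L + 1)"
      by (induction L) (auto simp: algebra_simps)
    ultimately show ?thesis by simp
  qed
  have "{(j, k). J j \<and> \<not> J k \<and> k < j} = (SIGMA j:S. {k. \<not> J k \<and> k < j})"
    unfolding S_def using lo by (auto, force)
  moreover have fk: "finite {k. \<not> J k \<and> k < j}" for j
    by (rule finite_subset[of _ "{- int L..<j}"]) (use lo in \<open>auto, force\<close>)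
  ultimately have "card {(j, k). J j \<and> \<not> J k \<and> k < j} = (\<Sum>j\<in>S. card {k. \<not> J k \<and> k < j})"
    using finS by (simp add: card_SigmaI)
  then have "int (card {(j, k). J j \<and> \<not> J k \<and> k < j}) = (\<Sum>j\<in>S. int (card {k. \<not> J k \<and> k < j}))" by simp
  also have "\<dots> = (\<Sum>j\<in>S. (j + int L) - int (card {k \<in> S. k < j}))"
  proof (intro sum.cong refl)
    fix j assume j: "j \<in> S"
    have "{- int L..<j} = {k. \<not> J k \<and> k < j} \<union> {k \<in> S. k < j}" unfolding S_def using lo by (auto, force)
    then have "card {- int L..<j} = card {k. \<not> J k \<and> k < j} + card {k \<in> S. k < j}"
      using fk finite_subset[of "{k \<in> S. k < j}" S] finS by (simp only:) (rule card_Un_disjoint, simp_all, auto simp: S_def)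
    moreover have "int (card {- int L..<j}) = j + int L" using j by (simp add: S_def)
    ultimately show "int (card {k. \<not> J k \<and> k < j}) = (j + int L) - int (card {k \<in> S. k < j})" by simp
  qed
  also have "\<dots> = \<Sum>S + int L * int L - int (\<Sum>j\<in>S. card {k \<in> S. k < j})"
    by (simp add: sum_subtractf sum.distrib cS)
  finally have "2 * int (card {(j, k). J j \<and> \<not> J k \<and> k < j}) =
      2 * \<Sum>S + 2 * (int L * int L) - int (2 * (\<Sum>j\<in>S. card {k \<in> S. k < j}))" by simp
  also have "int (2 * (\<Sum>j\<in>S. card {k \<in> S. k < j})) = int L * (int L - 1)"
    unfolding sum_card_less[OF finS] cS by (cases L) (auto simp: algebra_simps)
  finally show ?thesis using sS gauss by (simp add: algebra_simps)
qed

definition neg_mod :: "nat \<Rightarrow> nat \<Rightarrow> nat" where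
  "neg_mod t m = (if m mod t = 0 then 0 else t - m mod t)"

lemma mod_uminus_of_nat:
  assumes "t > 0"
  shows "(- int m) mod int t = int (neg_mod t m)"
proof -
  have "m mod t \<le> t" using assms by (simp add: less_imp_le)
  then show ?thesis unfolding mod_uminus_int[OF assms] zmod_int[symmetric] neg_mod_def by (simp add: of_nat_diff)
qed

lemma neg_mod_less: "t > 0 \<Longrightarrow> neg_mod t m < t"
  by (simp add: neg_mod_def)

lemma neg_mod_eq_0_iff: "t > 0 \<Longrightarrow> neg_mod t m = 0 \<longleftrightarrow> m mod t = 0"
  by (simp add: neg_mod_def not_le)

lemma neg_mod_eq_iff:
  assumes "0 < \<rho>" "\<rho> < t"
  shows "neg_mod t m = \<rho> \<longleftrightarrow> m mod t = t - \<rho>"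
proof -
  have "x < t \<Longrightarrow> (if x = 0 then 0 else t - x) = \<rho> \<longleftrightarrow> x = t - \<rho>" for x
    using assms by auto
  then show ?thesis unfolding neg_mod_def using assms by simp
qed

text \<open>Below t/2 this is the vanishing of a charge, above t/2 the same with both sides
  exchanged, and for residue 0 the two sets coincide.\<close>

lemma card_balanced_classes:
  assumes B: "finite B" "balanced t B" and t: "odd t" and \<rho>: "\<rho> < t"
  shows "card {m \<in> B. m mod t = \<rho>} = card {m \<in> B. neg_mod t m = \<rho>}"
proof -
  consider "\<rho> = 0" | "0 < \<rho>" "2 * \<rho> < t" | "2 * \<rho> > t" using t by (metis even_mult_iff even_numeral linorder_neqE_nat not_gr0)
  then show ?thesis
  proof cases
    case 1
    then have "m mod t = \<rho> \<longleftrightarrow> neg_mod t m = \<rho>" for m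
      using neg_mod_eq_0_iff[of t m] \<rho> by simp
    then show ?thesis by simp
  next
    case 2
    have "neg_mod t m = \<rho> \<longleftrightarrow> m mod t = t - \<rho>" for m
      using neg_mod_eq_iff \<rho> 2 by simp
    then show ?thesis using charge_eq_card[OF B(1) 2] B(2) 2 by (simp add: balanced_def)
  next
    case 3
    have r: "0 < t - \<rho>" "2 * (t - \<rho>) < t" using 3 \<rho> by auto
    have "neg_mod t m = \<rho> \<longleftrightarrow> m mod t = t - \<rho>" for m
      using neg_mod_eq_iff \<rho> 3 by simp
    moreover have "t - (t - \<rho>) = \<rho>" using \<rho> by simp
    ultimately show ?thesis using charge_eq_card[OF B(1) r] B(2) r by (simp add: balanced_def)
  qed
qed

text \<open>The positions of residue \<rho> form a Maya diagram of charge 0, so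
  \<open>card_inversions\<close> applies. An element m of residue \<rho> sits at (m - \<rho>) / t,
  and an element whose negative has residue \<rho> leaves a gap at (- m - \<rho>) / t; the \<rho>
  cancel because there are equally many of both.\<close>

lemma card_class_hooks:
  assumes t: "odd t" and B: "finite B" "0 \<notin> B" "balanced t B" and \<rho>: "\<rho> < t"
  shows "int t * int (card {(j, k). maya B (int \<rho> + int t * j) \<and> \<not> maya B (int \<rho> + int t * k) \<and> k < j}) =
    (\<Sum>m | m \<in> B \<and> m mod t = \<rho>. int m) + (\<Sum>m | m \<in> B \<and> neg_mod t m = \<rho>. int m)"
proof -
  have t0: "t > 0" using \<rho> by simp
  define J where "J j \<longleftrightarrow> maya B (int \<rho> + int t * j)" for j
  let ?P = "{j. 0 \<le> j \<and> J j}" and ?N = "{j. j < 0 \<and> \<not> J j}"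
  let ?BP = "{m \<in> B. m mod t = \<rho>}" and ?BN = "{m \<in> B. neg_mod t m = \<rho>}"
  have le: "m \<le> \<Sum>B" if "m \<in> B" for m using member_le_sum[of m B "\<lambda>x. x"] that B(1) by simp
  have div: "(int \<rho> + int t * j) div int t = j" for j using \<rho> by simp
  have neg: "int \<rho> + int t * j < 0 \<longleftrightarrow> j < 0" for j
  proof
    assume "j < 0"
    then have "int t * j \<le> int t * (- 1)" by (intro mult_left_mono) auto
    then show "int \<rho> + int t * j < 0" using \<rho> by linarith
  next
    assume "int \<rho> + int t * j < 0"
    then have "int t * j < 0" by linarith
    then show "j < 0" using t0 by (simp add: mult_less_0_iff)
  qed
  have P: "bij_betw (\<lambda>m. int m div int t) ?BP ?P"
  proof (rule bij_betw_byWitness[where f' = "\<lambda>j. nat (int \<rho> + int t * j)"])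
    have e: "int \<rho> + int t * (int m div int t) = int m" if "m mod t = \<rho>" for m
      using that mod_mult_div_eq[of "int m" "int t"] by (simp only: zmod_int[symmetric])
    then show "\<forall>a\<in>?BP. nat (int \<rho> + int t * (int a div int t)) = a" by auto
    have nn: "int (nat (int \<rho> + int t * j)) = int \<rho> + int t * j" if "j \<in> ?P" for j
      using neg[of j] that by auto
    then show "\<forall>j\<in>?P. int (nat (int \<rho> + int t * j)) div int t = j" using div by auto
    show "(\<lambda>m. int m div int t) ` ?BP \<subseteq> ?P"
    proof
      fix j assume "j \<in> (\<lambda>m. int m div int t) ` ?BP"
      then obtain m where m: "m \<in> B" "m mod t = \<rho>" "j = int m div int t" by auto
      then have "m > 0" using B(2) by (metis not_gr0)
      then have "J j" unfolding J_def m(3) e[OF m(2)] using m(1) by (simp add: maya_int)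
      moreover have "0 \<le> j" unfolding m(3) by (simp add: pos_imp_zdiv_nonneg_iff t0)
      ultimately show "j \<in> ?P" by simp
    qed
    show "(\<lambda>j. nat (int \<rho> + int t * j)) ` ?P \<subseteq> ?BP"
    proof
      fix m assume "m \<in> (\<lambda>j. nat (int \<rho> + int t * j)) ` ?P"
      then obtain j where j: "m = nat (int \<rho> + int t * j)" "0 \<le> j" "J j" by auto
      then have m: "int m = int \<rho> + int t * j" using nn by auto
      have "m \<in> B" using j(3) neg[of j] j(2) unfolding J_def m[symmetric] by (simp add: maya_def)
      moreover have "int (m mod t) = int \<rho>" unfolding zmod_int m using \<rho> by simp
      ultimately show "m \<in> ?BP" by simp
    qed
  qed
  have N: "bij_betw (\<lambda>m. (- int m) div int t) ?BN ?N"
  proof (rule bij_betw_byWitness[where f' = "\<lambda>j. nat (- (int \<rho> + int t * j))"])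
    have e: "int \<rho> + int t * ((- int m) div int t) = - int m" if "neg_mod t m = \<rho>" for m
      using that mod_mult_div_eq[of "- int m" "int t"] by (simp only: mod_uminus_of_nat[OF t0])
    then show "\<forall>a\<in>?BN. nat (- (int \<rho> + int t * ((- int a) div int t))) = a" by auto
    have nn: "- int (nat (- (int \<rho> + int t * j))) = int \<rho> + int t * j" if "j \<in> ?N" for j
      using neg[of j] that by auto
    then show "\<forall>j\<in>?N. (- int (nat (- (int \<rho> + int t * j)))) div int t = j" using div by auto
    show "(\<lambda>m. (- int m) div int t) ` ?BN \<subseteq> ?N"
    proof
      fix j assume "j \<in> (\<lambda>m. (- int m) div int t) ` ?BN"
      then obtain m where m: "m \<in> B" "neg_mod t m = \<rho>" "j = (- int m) div int t" by auto
      then have "m > 0" using B(2) by (metis not_gr0)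
      then have "\<not> J j" unfolding J_def m(3) e[OF m(2)] using m(1) by (simp add: maya_neg_int)
      moreover have "j < 0" using neg[of j] e[OF m(2)] m(3) \<open>m > 0\<close> by simp
      ultimately show "j \<in> ?N" by simp
    qed
    show "(\<lambda>j. nat (- (int \<rho> + int t * j))) ` ?N \<subseteq> ?BN"
    proof
      fix m assume "m \<in> (\<lambda>j. nat (- (int \<rho> + int t * j))) ` ?N"
      then obtain j where j: "m = nat (- (int \<rho> + int t * j))" "j < 0" "\<not> J j" by auto
      then have m: "- int m = int \<rho> + int t * j" using nn by auto
      have "m \<in> B" using j(3) neg[of j] j(2) unfolding J_def m[symmetric] by (simp add: maya_def)
      moreover have "int (neg_mod t m) = int \<rho>" unfolding mod_uminus_of_nat[OF t0, symmetric] m using \<rho> by simp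
      ultimately show "m \<in> ?BN" by simp
    qed
  qed
  have cards: "card ?P = card ?BP" "card ?N = card ?BN" using bij_betw_same_card[OF P] bij_betw_same_card[OF N] by simp_all
  have eq: "card ?BP = card ?BN" by (rule card_balanced_classes[OF B(1,3) t \<rho>])
  have lo: "J j" if "j < - int (\<Sum>B)" for j
  proof -
    have neg': "int \<rho> + int t * j < 0" using neg[of j] that by linarith
    have "int t * j \<le> int t * (- int (\<Sum>B) - 1)" using that by (intro mult_left_mono) auto
    moreover have "1 * int (\<Sum>B) \<le> int t * int (\<Sum>B)" using t0 by (intro mult_right_mono of_nat_0_le_iff) auto
    ultimately have "int \<rho> + int t * j < - int (\<Sum>B)" using \<rho> by (simp add: algebra_simps)
    then have "nat (- (int \<rho> + int t * j)) > \<Sum>B" by linarith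
    then have "nat (- (int \<rho> + int t * j)) \<notin> B" using le leD by blast
    then show ?thesis using neg' by (simp add: J_def maya_def)
  qed
  have finP: "finite ?P" using bij_betw_finite[OF P] B(1) by simp
  have "int t * int (card {(j, k). J j \<and> \<not> J k \<and> k < j}) = (\<Sum>j\<in>?P. int t * j) - (\<Sum>j\<in>?N. int t * j)"
  proof -
    have "card ?P = card ?N" unfolding cards by (rule eq)
    then have "int (card {(j, k). J j \<and> \<not> J k \<and> k < j}) = (\<Sum>j\<in>?P. j) - (\<Sum>j\<in>?N. j)"
      by (intro card_inversions[of "\<Sum>B" J, OF lo finP]) auto
    then show ?thesis by (simp only: right_diff_distrib sum_distrib_left)
  qed
  also have "(\<Sum>j\<in>?P. int t * j) = (\<Sum>m\<in>?BP. int m - int \<rho>)"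
    unfolding sum.reindex_bij_betw[OF P, symmetric]
  proof (intro sum.cong refl)
    fix m assume "m \<in> ?BP"
    then show "int t * (int m div int t) = int m - int \<rho>"
      using mod_mult_div_eq[of "int m" "int t"] unfolding zmod_int[symmetric] by auto
  qed
  also have "(\<Sum>j\<in>?N. int t * j) = (\<Sum>m\<in>?BN. - int m - int \<rho>)"
    unfolding sum.reindex_bij_betw[OF N, symmetric]
  proof (intro sum.cong refl)
    fix m assume "m \<in> ?BN"
    then show "int t * ((- int m) div int t) = - int m - int \<rho>"
      using mod_mult_div_eq[of "- int m" "int t"] unfolding mod_uminus_of_nat[OF t0] by auto
  qed
  also have "(\<Sum>m\<in>?BP. int m - int \<rho>) - (\<Sum>m\<in>?BN. - int m - int \<rho>) = (\<Sum>m\<in>?BP. int m) + (\<Sum>m\<in>?BN. int m)"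
    by (simp add: sum_subtractf sum_negf eq)
  finally show ?thesis unfolding J_def .
qed

text \<open>Each m is counted once through the residue of m and once through the residue of -m,
  hence the factor 2.\<close>

lemma card_hooks_balanced:
  assumes t: "odd t" and B: "finite B" "0 \<notin> B" "balanced t B"
  shows "t * card (hooks t B) = 2 * \<Sum>B"
proof -
  have t0: "t > 0" using t odd_pos by blast
  let ?I = "\<lambda>\<rho>. {(j, k). maya B (int \<rho> + int t * j) \<and> \<not> maya B (int \<rho> + int t * k) \<and> k < j}"
  let ?H = "\<lambda>\<rho>. {p \<in> hooks t B. nat (fst p mod int t) = \<rho>}"
  have bij: "card (?I \<rho>) = card (?H \<rho>)" if "\<rho> < t" for \<rho>
  proof (rule bij_betw_same_card[of "\<lambda>(j, k). (int \<rho> + int t * j, int \<rho> + int t * k)"],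
      rule bij_betw_byWitness[where f' = "\<lambda>(a, b). (a div int t, b div int t)"])
    show "\<forall>a\<in>?I \<rho>. (case case a of (j, k) \<Rightarrow> (int \<rho> + int t * j, int \<rho> + int t * k) of
        (a, b) \<Rightarrow> (a div int t, b div int t)) = a" using that by auto
    have e: "int \<rho> + int t * (a div int t) = a \<and> int \<rho> + int t * (b div int t) = b" if "(a, b) \<in> ?H \<rho>" for a b
    proof -
      have "a mod int t = int \<rho>" using that t0 by auto
      moreover have "b mod int t = a mod int t" using that by (simp add: hooks_def mod_eq_dvd_iff dvd_diff_commute)
      ultimately show ?thesis using mod_mult_div_eq[of a "int t"] mod_mult_div_eq[of b "int t"] by simp
    qed
    then show "\<forall>a'\<in>?H \<rho>. (case case a' of (a, b) \<Rightarrow> (a div int t, b div int t) of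
        (j, k) \<Rightarrow> (int \<rho> + int t * j, int \<rho> + int t * k)) = a'" by auto
    show "(\<lambda>(j, k). (int \<rho> + int t * j, int \<rho> + int t * k)) ` ?I \<rho> \<subseteq> ?H \<rho>"
    proof clarify
      fix j k assume *: "maya B (int \<rho> + int t * j)" "\<not> maya B (int \<rho> + int t * k)" "k < j"
      have "int \<rho> + int t * j - (int \<rho> + int t * k) = int t * (j - k)" by (simp add: right_diff_distrib)
      then have "int t dvd int \<rho> + int t * j - (int \<rho> + int t * k)" by simp
      then show "(int \<rho> + int t * j, int \<rho> + int t * k) \<in> hooks t B \<and>
          nat (fst (int \<rho> + int t * j, int \<rho> + int t * k) mod int t) = \<rho>"
        using * that t0 by (simp add: hooks_def)
    qed
    show "(\<lambda>(a, b). (a div int t, b div int t)) ` ?H \<rho> \<subseteq> ?I \<rho>"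
    proof (rule image_subsetI)
      fix p assume p: "p \<in> ?H \<rho>"
      obtain a b where ab: "p = (a, b)" by fastforce
      have h: "maya B a" "\<not> maya B b" "b < a" using p ab by (auto simp: hooks_def)
      have e': "int \<rho> + int t * (a div int t) = a" "int \<rho> + int t * (b div int t) = b" using e p ab by auto
      have "b div int t < a div int t"
      proof -
        have "int t * (b div int t) < int t * (a div int t)" using e' h(3) by linarith
        then show ?thesis using t0 by simp
      qed
      then show "(case p of (a, b) \<Rightarrow> (a div int t, b div int t)) \<in> ?I \<rho>" unfolding ab using e' h by simp
    qed
  qed
  have "int (t * card (hooks t B)) = int t * (\<Sum>\<rho><t. int (card (?H \<rho>)))"
  proof -
    have "card (hooks t B) = (\<Sum>\<rho><t. card (?H \<rho>))"
      unfolding card_eq_sum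
      by (rule sum.group[symmetric]) (use finite_hooks[OF B(1)] t0 in \<open>auto simp: nat_less_iff\<close>)
    then show ?thesis by simp
  qed
  also have "\<dots> = (\<Sum>\<rho><t. int t * int (card (?I \<rho>)))"
    unfolding sum_distrib_left using bij by (intro sum.cong refl) simp
  also have "\<dots> = (\<Sum>\<rho><t. (\<Sum>m | m \<in> B \<and> m mod t = \<rho>. int m) + (\<Sum>m | m \<in> B \<and> neg_mod t m = \<rho>. int m))"
    by (intro sum.cong refl card_class_hooks[OF t B]) simp
  also have "\<dots> = (\<Sum>m\<in>B. int m) + (\<Sum>m\<in>B. int m)"
    unfolding sum.distrib using B(1) t0 neg_mod_less
    by (intro arg_cong2[where f = "(+)"] sum.group) auto
  also have "\<dots> = int (2 * \<Sum>B)" by simp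
  finally show ?thesis by (simp only: of_nat_eq_iff)
qed

text \<open>A hook divisible by t forces one of length exactly t, at the first gap met when stepping
  down from a by t. With positive sign its factor at s = 1 is 1 - t/t = 0; with negative sign the
  reflected hook has the positive sign.\<close>

lemma set_weight_1_eq_0:
  assumes t: "odd t" and B: "finite B" "0 \<notin> B" and ne: "hooks t B \<noteq> {}"
  shows "set_weight t 1 B = 0"
proof -
  have t0: "t > 0" using t odd_pos by blast
  obtain a b where ab: "(a, b) \<in> hooks t B" using ne by auto
  then have h: "maya B a" "\<not> maya B b" "b < a" "int t dvd a - b" by (auto simp: hooks_def)
  obtain d where d: "a - b = int t * d" using h(4) by (elim dvdE)
  have "int t * d > 0" using d h(3) by simp
  then have "d > 0" using t0 by (simp add: zero_less_mult_iff)
  then obtain n where n: "d = int n" using zero_less_imp_eq_int by blast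
  have ex: "\<exists>k. \<not> maya B (a - int t * int k)"
    using d n h(2) by (intro exI[of _ n]) (metis diff_diff_eq2 add_diff_cancel_left' diff_add_cancel)
  define k where "k = (LEAST k. \<not> maya B (a - int t * int k))"
  have k: "\<not> maya B (a - int t * int k)" unfolding k_def by (rule LeastI_ex[OF ex])
  then have "k > 0" using h(1) by (cases k) auto
  then have k1: "maya B (a - int t * int (k - 1))" using not_less_Least[of "k - 1" "\<lambda>k. \<not> maya B (a - int t * int k)"]
    using \<open>k > 0\<close> unfolding k_def[symmetric] by simp
  let ?a = "a - int t * int (k - 1)" and ?b = "a - int t * int k"
  have kk: "int k = int (k - 1) + 1" using \<open>k > 0\<close> by simp
  have diff: "?a - ?b = int t" unfolding kk by (simp add: distrib_left)
  have "?b < ?a" using diff t0 by linarith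
  then have H: "(?a, ?b) \<in> hooks t B" using k k1 diff unfolding hooks_def by simp
  have "\<exists>p\<in>hooks t B. hook_factor t 1 p = 0"
  proof (cases "?a + ?b < 0")
    case False
    then have "hook_factor t 1 (?a, ?b) = 1 - of_nat t * 1 / of_int (?a - ?b)"
      unfolding hook_factor_def by (simp only: prod.case if_False mult_1)
    also have "\<dots> = 0" unfolding diff using t0 by simp
    finally show ?thesis using H by blast
  next
    case True
    \<comment> \<open>If the lower end were 0, the sum of the two ends would be t and not
      negative.\<close>
    then have "?b \<noteq> 0" using diff t0 by linarith
    then have H': "(- ?b, - ?a) \<in> hooks t B" by (rule hooks_reflect[OF H])
    have "\<not> - ?b + - ?a < 0" using True by linarith
    then have "hook_factor t 1 (- ?b, - ?a) = 1 - of_nat t * 1 / of_int (- ?b - - ?a)"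
      unfolding hook_factor_def by (simp only: prod.case if_False mult_1)
    also have "- ?b - - ?a = int t" using diff by linarith
    finally show ?thesis using H' t0 by (intro bexI[of _ "(- ?b, - ?a)"]) simp_all
  qed
  then have "(\<Prod>p\<in>hooks t B. hook_factor t 1 p) = 0"
    using finite_hooks[OF B(1)] by (simp add: prod_zero_iff)
  then show ?thesis unfolding prod_hook_factor[OF B t] .
qed

section \<open>Cores, balanced parts and the factorization of the series\<close>

text \<open>The value 0 outside the range that is read by \<open>class_shift\<close> makes equality
  of charge vectors an equality of functions.\<close>

definition charges :: "nat \<Rightarrow> nat set \<Rightarrow> nat \<Rightarrow> int" where
  "charges t M r = (if 0 < r \<and> 2 * r < t then charge t r M else 0)"

text \<open>By \<open>hooks_set_shift\<close> a shift of the empty set has no hooks divisible by t;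
  this one has the charges of M and is the t-core of M.\<close>

definition core :: "nat \<Rightarrow> nat set \<Rightarrow> nat set" where
  "core t M = set_shift t (charges t M) {}"

text \<open>Undoing the shift that builds the core leaves a balanced set, which carries the
  information of the t-quotient.\<close>

definition quot :: "nat \<Rightarrow> nat set \<Rightarrow> nat set" where
  "quot t M = set_shift t (\<lambda>r. - charges t M r) M"

lemma charges_set_shift:
  assumes t: "odd t" and M: "finite M" "0 \<notin> M"
  shows "charges t (set_shift t (charges t N) M) r = charges t N r + charges t M r"
  using charge_set_shift[OF t _ _ M] by (simp add: charges_def)

lemma charges_empty [simp]: "charges t {} r = 0"
  by (simp add: charges_def charge_def)

lemma charges_balanced: "balanced t B \<Longrightarrow> charges t B r = 0"
  by (simp add: charges_def balanced_def)

lemma charges_core: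
  assumes "odd t"
  shows "charges t (core t M) = charges t M"
  using charges_set_shift[OF assms, of "{}" M] by (simp add: core_def fun_eq_iff)

lemma quot_properties:
  assumes t: "odd t" and M: "finite M" "0 \<notin> M"
  shows "finite (quot t M)" "0 \<notin> quot t M" "balanced t (quot t M)"
    and "set_shift t (charges t M) (quot t M) = M"
proof -
  show "finite (quot t M)" unfolding quot_def by (rule finite_set_shift[OF t M(1)])
  show "0 \<notin> quot t M" unfolding quot_def by (rule zero_notin_set_shift)
  show "set_shift t (charges t M) (quot t M) = M" unfolding quot_def by (rule set_shift_inverse[OF t M(2)])
  have "charge t r (quot t M) = 0" if "0 < r" "2 * r < t" for r
    unfolding quot_def charge_set_shift[OF t that M] using that by (simp add: charges_def)
  then show "balanced t (quot t M)" by (simp add: balanced_def)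
qed

lemma core_set_shift:
  assumes t: "odd t" and B: "finite B" "0 \<notin> B" "balanced t B" and K: "core t K = K"
  shows "core t (set_shift t (charges t K) B) = K" "quot t (set_shift t (charges t K) B) = B"
proof -
  have c: "charges t (set_shift t (charges t K) B) = charges t K"
    by (rule ext) (simp add: charges_set_shift[OF t B(1,2)] charges_balanced[OF B(3)])
  show "core t (set_shift t (charges t K) B) = K" unfolding core_def c using K by (simp only: core_def)
  show "quot t (set_shift t (charges t K) B) = B"
    unfolding quot_def c using set_shift_inverse[OF t B(2), of "\<lambda>r. - charges t K r"] by simp
qed

definition sum_sets :: "nat \<Rightarrow> nat set set" where
  "sum_sets n = {M. finite M \<and> 0 \<notin> M \<and> \<Sum>M = n}"

lemma sum_sets_eq: "n \<le> N \<Longrightarrow> sum_sets n = {M \<in> Pow {1..N}. \<Sum>M = n}"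
proof (intro equalityI subsetI)
  fix M assume n: "n \<le> N" and M: "M \<in> sum_sets n"
  have "m \<in> {1..N}" if "m \<in> M" for m
  proof -
    have "m \<noteq> 0" using M that by (metis (mono_tags, lifting) mem_Collect_eq sum_sets_def)
    moreover have "m \<le> \<Sum>M" using member_le_sum[of m M "\<lambda>x. x"] that M by (simp add: sum_sets_def)
    ultimately show ?thesis using M n by (simp add: sum_sets_def)
  qed
  then show "M \<in> {M \<in> Pow {1..N}. \<Sum>M = n}" using M by (auto simp: sum_sets_def)
next
  fix M assume "M \<in> {M \<in> Pow {1..N}. \<Sum>M = n}"
  then show "M \<in> sum_sets n" using finite_subset[of M "{1..N}"] by (auto simp: sum_sets_def)
qed

lemma finite_sum_sets: "finite (sum_sets n)"
  by (simp add: sum_sets_eq[OF order_refl])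

definition hook_series :: "nat \<Rightarrow> complex \<Rightarrow> complex \<Rightarrow> complex fps" where
  "hook_series t y s = Abs_fps (\<lambda>n. \<Sum>M\<in>sum_sets n. (-1) ^ card M * y ^ card (hooks t M) * set_weight t s M)"

definition core_series :: "nat \<Rightarrow> complex fps" where
  "core_series t = Abs_fps (\<lambda>n. \<Sum>K | K \<in> sum_sets n \<and> core t K = K. (-1) ^ card K)"

definition balanced_series :: "nat \<Rightarrow> complex \<Rightarrow> complex \<Rightarrow> complex fps" where
  "balanced_series t y s = Abs_fps (\<lambda>n. \<Sum>B | B \<in> sum_sets n \<and> balanced t B.
     (-1) ^ card B * y ^ card (hooks t B) * set_weight t s B)"

text \<open>A set corresponds to its core and its balanced part. Sums add because the second is
  balanced, signs multiply, and both the number of hooks and the weight depend on the balanced part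
  alone.\<close>

lemma hook_series_factorization:
  assumes t: "odd t"
  shows "hook_series t y s = core_series t * balanced_series t y s"
proof (rule fps_ext)
  fix n
  let ?K = "\<lambda>i. {K. K \<in> sum_sets i \<and> core t K = K}" and ?B = "\<lambda>i. {B. B \<in> sum_sets i \<and> balanced t B}"
  let ?w = "\<lambda>M. (-1) ^ card M * y ^ card (hooks t M) * set_weight t s M"
  have "hook_series t y s $ n = (\<Sum>M\<in>sum_sets n. ?w M)" by (simp add: hook_series_def)
  also have "\<dots> = (\<Sum>(i, K, B)\<in>(SIGMA i:{0..n}. ?K i \<times> ?B (n - i)). (-1) ^ card K * ?w B)"
  proof (rule sum.reindex_bij_witness[of _ "\<lambda>(i, K, B). set_shift t (charges t K) B" "\<lambda>M. (\<Sum>(core t M), core t M, quot t M)"])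
    fix M assume "M \<in> sum_sets n"
    then have M: "finite M" "0 \<notin> M" "\<Sum>M = n" by (auto simp: sum_sets_def)
    note q = quot_properties[OF t M(1,2)]
    show "(case (\<Sum>(core t M), core t M, quot t M) of (i, K, B) \<Rightarrow> set_shift t (charges t K) B) = M"
      using q(4) by (simp add: charges_core[OF t])
    have c: "finite (core t M)" "0 \<notin> core t M"
      unfolding core_def using finite_set_shift[OF t] zero_notin_set_shift by auto
    have cc: "core t (core t M) = core t M" by (simp add: core_def[of t "core t M"] charges_core[OF t]) (simp add: core_def)
    have "\<Sum>(core t M) + \<Sum>(quot t M) = n"
      using sum_set_shift_balanced[OF t q(1-3), of "charges t M"] unfolding q(4) core_def M(3) by simp
    then show "(\<Sum>(core t M), core t M, quot t M) \<in> (SIGMA i:{0..n}. ?K i \<times> ?B (n - i))"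
      using c cc q(1-3) by (auto simp: sum_sets_def)
    have "(-1 :: complex) ^ card M = (-1) ^ card (core t M) * (-1) ^ card (quot t M)"
      using sign_set_shift[OF t q(1,2), of "charges t M"] unfolding q(4) core_def .
    moreover have "card (hooks t M) = card (hooks t (quot t M))" "set_weight t s M = set_weight t s (quot t M)"
      unfolding quot_def using card_hooks_set_shift[OF t] set_weight_set_shift[OF t M(1,2)] by simp_all
    ultimately show "(case (\<Sum>(core t M), core t M, quot t M) of (i, K, B) \<Rightarrow> (-1) ^ card K * ?w B) = ?w M"
      by simp
  next
    fix p assume p: "p \<in> (SIGMA i:{0..n}. ?K i \<times> ?B (n - i))"
    obtain i K B where iKB: "p = (i, K, B)" using prod_cases3 by blast
    have K: "i \<le> n" "finite K" "0 \<notin> K" "\<Sum>K = i" "core t K = K" and B: "finite B" "0 \<notin> B" "balanced t B" "\<Sum>B = n - i"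
      using p iKB by (auto simp: sum_sets_def)
    show "(\<Sum>(core t (case p of (i, K, B) \<Rightarrow> set_shift t (charges t K) B)),
        core t (case p of (i, K, B) \<Rightarrow> set_shift t (charges t K) B),
        quot t (case p of (i, K, B) \<Rightarrow> set_shift t (charges t K) B)) = p"
      using core_set_shift[OF t B(1-3) K(5)] K(4) by (simp add: iKB)
    have "\<Sum>(set_shift t (charges t K) B) = n"
      using sum_set_shift_balanced[OF t B(1-3), of "charges t K"] K B(4) unfolding core_def by simp
    then show "(case p of (i, K, B) \<Rightarrow> set_shift t (charges t K) B) \<in> sum_sets n"
      using finite_set_shift[OF t B(1)] zero_notin_set_shift by (simp add: iKB sum_sets_def)
  qed
  also have "\<dots> = (\<Sum>i=0..n. \<Sum>(K, B)\<in>?K i \<times> ?B (n - i). (-1) ^ card K * ?w B)"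
    by (subst sum.Sigma) (auto simp: finite_sum_sets)
  also have "\<dots> = (\<Sum>i=0..n. (\<Sum>K\<in>?K i. (-1) ^ card K) * (\<Sum>B\<in>?B (n - i). ?w B))"
    unfolding sum_product sum.cartesian_product ..
  also have "\<dots> = (core_series t * balanced_series t y s) $ n"
    by (simp add: fps_mult_nth core_series_def balanced_series_def)
  finally show "hook_series t y s $ n = (core_series t * balanced_series t y s) $ n" .
qed

lemma card_hooks_sum_sets:
  assumes t: "odd t" and B: "B \<in> sum_sets n" "balanced t B"
  shows "t * card (hooks t B) = 2 * n"
  using card_hooks_balanced[OF t, of B] B by (simp add: sum_sets_def)

lemma balanced_empty [simp]: "balanced t {}"
  by (simp add: balanced_def charge_def)

lemma hooks_empty [simp]: "hooks t {} = {}"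
  by (auto simp: hooks_def maya_def)

text \<open>A balanced set of sum n > 0 has 2 n / t > 0 hooks divisible by t, and a single one
  annihilates its weight at s = 1.\<close>

lemma balanced_series_1_1:
  assumes t: "odd t"
  shows "balanced_series t 1 1 = 1"
proof (rule fps_ext)
  fix n
  show "balanced_series t 1 1 $ n = (1 :: complex fps) $ n"
  proof (cases "n = 0")
    case True
    have "sum_sets 0 = {{}}" 
    proof -
      have "Pow {1..0::nat} = {{}}" by simp
      then have "sum_sets 0 = {M \<in> {{}}. \<Sum>M = 0}" using sum_sets_eq[of 0 0] by (simp only: order_refl)
      also have "\<dots> = {{}}" by force
      finally show ?thesis .
    qed
    then have "B \<in> sum_sets n \<and> balanced t B \<longleftrightarrow> B = {}" for B
      unfolding True by (cases "B = {}") simp_all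
    then have "{B. B \<in> sum_sets n \<and> balanced t B} = {{}}" by simp
    moreover have "set_weight t 1 {} = 1" using prod_hook_factor[of "{}" t 1] t by simp
    ultimately show ?thesis using True by (simp add: balanced_series_def)
  next
    case False
    have "set_weight t 1 B = 0" if B: "B \<in> sum_sets n" "balanced t B" for B
    proof (rule set_weight_1_eq_0[OF t])
      show "hooks t B \<noteq> {}" using card_hooks_sum_sets[OF t B] False by auto
    qed (use B in \<open>auto simp: sum_sets_def\<close>)
    then have "(\<Sum>B | B \<in> sum_sets n \<and> balanced t B. (-1) ^ card B * 1 ^ card (hooks t B) * set_weight t 1 B) = 0"
      by (intro sum.neutral) auto
    then show ?thesis using False by (simp add: balanced_series_def)
  qed
qed

lemma hook_series_1_cong:
  assumes t: "odd t"
  shows "fcong n (hook_series t 1 s) ((\<Prod>i=1..n. 1 - fps_X ^ i) *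
    (\<Prod>j=1..n. fps_one_minus_cpow (fps_X ^ (t * j)) ((of_nat t * s\<^sup>2 - 3 * s) / 2)))"
proof (rule fcong_trans[OF _ signed_sum_product[OF t]], unfold fcong_iff, intro allI impI)
  fix i assume i: "i \<le> n"
  have "hook_series t 1 s $ i = (\<Sum>M\<in>{M \<in> Pow {1..n}. \<Sum>M = i}. (-1) ^ card M * set_weight t s M)"
    using sum_sets_eq[OF i] by (simp add: hook_series_def)
  also have "\<dots> = (\<Sum>M\<in>Pow {1..n}. if \<Sum>M = i then (-1) ^ card M * set_weight t s M else 0)"
    by (rule sum.inter_filter) simp
  also have "\<dots> = (\<Sum>M\<in>Pow {1..n}. fps_const ((-1) ^ card M * set_weight t s M) * fps_X ^ \<Sum>M) $ i"
    unfolding fps_sum_nth by (intro sum.cong refl) (auto simp: fps_X_power_iff)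
  finally show "hook_series t 1 s $ i = (\<Sum>M\<in>Pow {1..n}. fps_const ((-1) ^ card M * set_weight t s M) * fps_X ^ \<Sum>M) $ i" .
qed

text \<open>At s = 1 the balanced factor is 1 and (t s^2 - 3 s) / 2 becomes (t - 3) / 2.\<close>

lemma core_series_cong:
  assumes t: "odd t"
  shows "fcong n (core_series t) ((\<Prod>i=1..n. 1 - fps_X ^ i) *
    (\<Prod>j=1..n. fps_one_minus_cpow (fps_X ^ (t * j)) ((of_nat t - 3) / 2)))"
  using hook_series_1_cong[OF t, of n 1] unfolding hook_series_factorization[OF t] balanced_series_1_1[OF t] by simp

lemma fps_X_power_mult_nth_0:
  assumes "t > 0" "j > 0"
  shows "(fps_X ^ (t * j) :: complex fps) $ 0 = 0"
  using assms by simp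

text \<open>The core series has constant term 1 and can be divided out; the exponents
  subtract.\<close>

lemma balanced_series_1_cong:
  assumes t: "odd t"
  shows "fcong n (balanced_series t 1 s)
    (\<Prod>j=1..n. fps_one_minus_cpow (fps_X ^ (t * j)) ((of_nat t * s\<^sup>2 - 3 * s - of_nat t + 3) / 2))"
proof -
  have t0: "t > 0" using t odd_pos by blast
  let ?E = "\<lambda>e. \<Prod>j=1..n. fps_one_minus_cpow (fps_X ^ (t * j)) e :: complex fps"
  let ?P = "\<Prod>i=1..n. 1 - fps_X ^ i :: complex fps"
  let ?C = "core_series t" and ?a = "(of_nat t - 3) / 2 :: complex" and ?b = "(of_nat t * s\<^sup>2 - 3 * s - of_nat t + 3) / 2"
  have E: "?E (a + b) = ?E a * ?E b" for a b
    unfolding prod.distrib[symmetric]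
    using t0 by (intro prod.cong refl fps_one_minus_cpow_add fps_X_power_mult_nth_0) auto
  have ab: "(of_nat t * s\<^sup>2 - 3 * s) / 2 = ?a + ?b" by (simp add: field_simps)
  have 1: "fcong n (?C * balanced_series t 1 s) (?P * (?E ?a * ?E ?b))"
    using hook_series_1_cong[OF t, of n s] unfolding hook_series_factorization[OF t] ab E .
  have "fcong n (?C * ?E ?b) (?P * ?E ?a * ?E ?b)"
    by (rule fcong_mult[OF core_series_cong[OF t] fcong_refl])
  then have "fcong n (?C * balanced_series t 1 s) (?C * ?E ?b)"
    unfolding mult.assoc[of ?P] by (rule fcong_trans[OF 1 fcong_sym])
  then have "fcong n (inverse ?C * (?C * balanced_series t 1 s)) (inverse ?C * (?C * ?E ?b))"
    by (rule fcong_mult[OF fcong_refl])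
  moreover have "inverse ?C * (?C * f) = f" for f
  proof -
    have "fcong 0 ?C 1" using core_series_cong[OF t, of 0] by simp
    then have "?C $ 0 \<noteq> 0" by (simp add: fcong_iff)
    then show ?thesis unfolding mult.assoc[symmetric] by (simp add: inverse_mult_eq_1)
  qed
  ultimately show ?thesis by (simp only:)
qed

text \<open>With w^t = y^2, a balanced set of sum n has y to the number of its hooks equal to w^n.
  So y enters by substituting w x for x, and w^(t j) = y^(2 j) removes the auxiliary root.\<close>

lemma balanced_series_cong:
  assumes t: "odd t"
  shows "fcong n (balanced_series t y s)
    (\<Prod>j=1..n. fps_one_minus_cpow (fps_const (y ^ (2 * j)) * fps_X ^ (t * j)) ((of_nat t * s\<^sup>2 - 3 * s - of_nat t + 3) / 2))"
proof -
  have t0: "t > 0" using t odd_pos by blast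
  obtain w where w: "y\<^sup>2 = w ^ t" using exists_complex_root[of t "y\<^sup>2"] t0 by auto
  let ?b = "(of_nat t * s\<^sup>2 - 3 * s - of_nat t + 3) / 2" and ?W = "fps_const w * fps_X"
  have scale: "balanced_series t y s $ i = w ^ i * balanced_series t 1 s $ i" for i
  proof -
    have "y ^ card (hooks t B) = w ^ i" if B: "B \<in> sum_sets i" "balanced t B" for B
    proof -
      have e: "t * card (hooks t B) = 2 * i" by (rule card_hooks_sum_sets[OF t B])
      \<comment> \<open>Since t is odd, the number of hooks is even, so only powers of y^2 have to
        be expressed through w.\<close>
      have "even (t * card (hooks t B))" unfolding e by simp
      then obtain k where k: "card (hooks t B) = 2 * k" using t by (auto elim: evenE)
      then have "i = t * k" using e by simp
      then show ?thesis unfolding k using w by (simp add: power_mult)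
    qed
    then show ?thesis unfolding balanced_series_def fps_nth_Abs_fps sum_distrib_left
      by (intro sum.cong refl) simp
  qed
  have "fcong n (balanced_series t 1 s oo ?W) ((\<Prod>j=1..n. fps_one_minus_cpow (fps_X ^ (t * j)) ?b) oo ?W)"
    using balanced_series_1_cong[OF t, of n s] by (simp add: fcong_iff fps_compose_linear)
  moreover have "balanced_series t 1 s oo ?W = balanced_series t y s"
    by (rule fps_ext) (simp add: fps_compose_linear scale)
  moreover have "(\<Prod>j=1..n. fps_one_minus_cpow (fps_X ^ (t * j)) ?b) oo ?W =
      (\<Prod>j=1..n. fps_one_minus_cpow (fps_const (y ^ (2 * j)) * fps_X ^ (t * j)) ?b)"
  proof -
    have "fps_one_minus_cpow (fps_X ^ (t * j)) ?b oo ?W =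
        fps_one_minus_cpow (fps_const (y ^ (2 * j)) * fps_X ^ (t * j)) ?b" if "j \<in> {1..n}" for j
    proof -
      have "(fps_X ^ (t * j) :: complex fps) oo ?W = fps_const (y ^ (2 * j)) * fps_X ^ (t * j)"
      proof -
        have "(fps_X ^ (t * j) :: complex fps) oo ?W = ?W ^ (t * j)"
          by (simp add: fps_compose_power[symmetric])
        also have "\<dots> = fps_const (w ^ (t * j)) * fps_X ^ (t * j)" by (simp add: power_mult_distrib fps_const_power)
        also have "w ^ (t * j) = y ^ (2 * j)" using w by (simp add: power_mult)
        finally show ?thesis .
      qed
      moreover have "fps_one_minus_cpow (fps_X ^ (t * j)) ?b oo ?W = fps_one_minus_cpow (fps_X ^ (t * j) oo ?W) ?b"
        using that t0 by (intro fps_one_minus_cpow_compose fps_X_power_mult_nth_0) auto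
      ultimately show ?thesis by simp
    qed
    then show ?thesis by (subst fps_compose_prod_distrib) auto
  qed
  ultimately show ?thesis by simp
qed

lemma hook_series_cong:
  assumes t: "odd t"
  shows "fcong n (hook_series t y s) (\<Prod>j=1..n. (1 - fps_X ^ j) *
    fps_one_minus_cpow (fps_X ^ (t * j)) ((of_nat t - 3) / 2) *
    fps_one_minus_cpow (fps_const (y ^ (2 * j)) * fps_X ^ (t * j)) ((of_nat t * s\<^sup>2 - 3 * s - of_nat t + 3) / 2))"
  unfolding hook_series_factorization[OF t] prod.distrib
  by (rule fcong_mult[OF core_series_cong[OF t] balanced_series_cong[OF t]])

section \<open>Doubled distinct partitions\<close>

text \<open>Such a set is an initial segment. Conjugate parts and the Durfee length are defined as
  cardinalities of sets of this kind.\<close>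

lemma down_closed_iff_le_card:
  fixes S :: "nat set"
  assumes fin: "finite S" and pos: "\<And>i. i \<in> S \<Longrightarrow> 1 \<le> i"
    and down: "\<And>i k. i \<in> S \<Longrightarrow> 1 \<le> k \<Longrightarrow> k \<le> i \<Longrightarrow> k \<in> S" and i: "1 \<le> i"
  shows "i \<in> S \<longleftrightarrow> i \<le> card S"
proof
  assume "i \<in> S"
  then have "{1..i} \<subseteq> S" using down by auto
  then have "card {1..i} \<le> card S" by (rule card_mono[OF fin])
  then show "i \<le> card S" by simp
next
  assume c: "i \<le> card S"
  show "i \<in> S"
  proof (rule ccontr)
    assume "i \<notin> S"
    then have "k \<in> {1..<i}" if "k \<in> S" for k
      using down[OF that i] pos[OF that] by (metis atLeastLessThan_iff not_le)
    then have "card S \<le> card {1..<i}" by (intro card_mono) auto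
    then show False using c i by simp
  qed
qed

lemma part_antimono:
  assumes p: "is_partition p" and "1 \<le> i" "i \<le> k"
  shows "part p k \<le> part p i"
proof (cases "k \<le> length p \<and> i \<noteq> k")
  case True
  have "sorted_wrt (\<ge>) p" using p by (simp add: is_partition_def)
  moreover have "i - 1 < k - 1" "k - 1 < length p" using True assms by auto
  ultimately have "p ! (k - 1) \<le> p ! (i - 1)" by (rule sorted_wrt_nth_less)
  then show ?thesis using True assms by (simp add: part_def)
next
  case False
  then show ?thesis using assms by (auto simp: part_def)
qed

lemma part_pos_iff:
  assumes "is_partition p" "1 \<le> i"
  shows "0 < part p i \<longleftrightarrow> i \<le> length p"
  using assms by (auto simp: part_def is_partition_def)

lemma le_conj_part_iff:
  assumes p: "is_partition p" and "1 \<le> i" "1 \<le> j"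
  shows "i \<le> conj_part p j \<longleftrightarrow> j \<le> part p i"
proof -
  let ?S = "{i \<in> {1..length p}. j \<le> part p i}"
  have "i \<in> ?S \<longleftrightarrow> i \<le> card ?S"
  proof (rule down_closed_iff_le_card)
    fix i k assume "i \<in> ?S" "1 \<le> k" "k \<le> i"
    then show "k \<in> ?S" using part_antimono[OF p, of k i] by auto
  qed (use assms in auto)
  moreover have "i \<in> ?S \<longleftrightarrow> j \<le> part p i" using part_pos_iff[OF p assms(2)] assms by auto
  ultimately show ?thesis by (simp add: conj_part_def)
qed

lemma le_durfee_iff:
  assumes p: "is_partition p" and "1 \<le> i"
  shows "i \<le> durfee p \<longleftrightarrow> i \<le> part p i"
proof -
  let ?S = "{i \<in> {1..length p}. i \<le> part p i}"
  have "i \<in> ?S \<longleftrightarrow> i \<le> card ?S"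
  proof (rule down_closed_iff_le_card)
    fix i k assume "i \<in> ?S" "1 \<le> k" "k \<le> i"
    then show "k \<in> ?S" using part_antimono[OF p, of k i] by auto
  qed (use assms in auto)
  moreover have "i \<in> ?S \<longleftrightarrow> i \<le> part p i" using part_pos_iff[OF p assms(2)] assms by auto
  ultimately show ?thesis by (simp add: durfee_def)
qed

section \<open>Row and column labels of a partition\<close>

definition row_label :: "nat list \<Rightarrow> nat \<Rightarrow> int" where
  "row_label p i = int (part p i) - int i"

text \<open>The offset -1 makes the hook length exactly the difference of a row label and a column
  label, and the two families of labels disjoint.\<close>

definition column_label :: "nat list \<Rightarrow> nat \<Rightarrow> int" where
  "column_label p j = int j - 1 - int (conj_part p j)"

definition row_labels :: "nat list \<Rightarrow> int set" where
  "row_labels p = row_label p ` {1..}"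

lemma row_label_less: "is_partition p \<Longrightarrow> 1 \<le> i \<Longrightarrow> i < k \<Longrightarrow> row_label p k < row_label p i"
  using part_antimono[of p i k] by (simp add: row_label_def)

lemma column_less:
  assumes p: "is_partition p" and "1 \<le> i" "i < k"
  shows "column_label p i < column_label p k"
proof -
  have "conj_part p k \<le> conj_part p i"
  proof (cases "conj_part p k = 0")
    case False
    then have "k \<le> part p (conj_part p k)" using le_conj_part_iff[OF p, of "conj_part p k" k] assms by simp
    then show ?thesis using le_conj_part_iff[OF p, of "conj_part p k" i] assms False by simp
  qed simp
  then show ?thesis using assms by (simp add: column_label_def)
qed

lemma row_le: "is_partition p \<Longrightarrow> 1 \<le> i \<Longrightarrow> i \<le> k \<Longrightarrow> row_label p k \<le> row_label p i"
  using row_label_less[of p i k] by (cases "i = k") auto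

lemma column_le: "is_partition p \<Longrightarrow> 1 \<le> i \<Longrightarrow> i \<le> k \<Longrightarrow> column_label p i \<le> column_label p k"
  using column_less[of p i k] by (cases "i = k") auto

lemma row_eq_iff: "is_partition p \<Longrightarrow> 1 \<le> i \<Longrightarrow> 1 \<le> k \<Longrightarrow> row_label p i = row_label p k \<longleftrightarrow> i = k"
  using row_label_less[of p i k] row_label_less[of p k i] by (cases i k rule: linorder_cases) auto

lemma column_eq_iff: "is_partition p \<Longrightarrow> 1 \<le> i \<Longrightarrow> 1 \<le> k \<Longrightarrow> column_label p i = column_label p k \<longleftrightarrow> i = k"
  using column_less[of p i k] column_less[of p k i] by (cases i k rule: linorder_cases) auto

lemma column_label_less_row_label_iff:
  assumes p: "is_partition p" and ij: "1 \<le> i" "1 \<le> j"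
  shows "column_label p j < row_label p i \<longleftrightarrow> j \<le> part p i" "column_label p j \<noteq> row_label p i"
  using le_conj_part_iff[OF p ij] by (auto simp: row_label_def column_label_def)

text \<open>The labels number the steps of the boundary path of the diagram, so each integer belongs
  to exactly one row or one column.\<close>

lemma in_row_labels_iff:
  assumes p: "is_partition p"
  shows "x \<in> row_labels p \<longleftrightarrow> x \<notin> column_label p ` {1..}"
proof
  assume "x \<in> row_labels p"
  then obtain i where "x = row_label p i" "1 \<le> i" by (auto simp: row_labels_def)
  then have "column_label p j \<noteq> x" if "1 \<le> j" for j using column_label_less_row_label_iff(2)[OF p _ that] by simp
  then show "x \<notin> column_label p ` {1..}" by auto
next
  assume nc: "x \<notin> column_label p ` {1..}"
  show "x \<in> row_labels p"
  proof (rule ccontr)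
    assume x: "x \<notin> row_labels p"
    define k where "k = (LEAST k. row_label p (Suc k) < x)"
    have "\<exists>k. row_label p (Suc k) < x"
    proof
      show "row_label p (Suc (length p + nat (- x))) < x"
        using part_pos_iff[OF p, of "Suc (length p + nat (- x))"] by (simp add: row_label_def)
    qed
    then have k: "row_label p (Suc k) < x" unfolding k_def by (rule LeastI_ex)
    have k': "k = 0 \<or> row_label p k > x"
    proof (cases k)
      case (Suc m)
      then have "\<not> row_label p (Suc m) < x" using not_less_Least[of m "\<lambda>k. row_label p (Suc k) < x"] unfolding k_def[symmetric] by simp
      moreover have "row_label p (Suc m) \<noteq> x" using x by (auto simp: row_labels_def)
      ultimately show ?thesis using Suc by simp
    qed simp
    \<comment> \<open>Exactly k rows have labels above x, so a column with label x must have height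
      k; j solves j - 1 - k = x.\<close>
    define j where "j = nat (x + 1 + int k)"
    have j: "int j = x + 1 + int k" "1 \<le> j" using k unfolding j_def row_label_def by auto
    have "\<not> j \<le> part p (Suc k)" using k j by (simp add: row_label_def)
    then have "\<not> Suc k \<le> conj_part p j" using le_conj_part_iff[OF p, of "Suc k" j] j by simp
    moreover have "k \<le> conj_part p j"
    proof (cases "k = 0")
      case False
      then have "j \<le> part p k" using k' j by (simp add: row_label_def)
      then show ?thesis using le_conj_part_iff[OF p, of k j] j False by simp
    qed simp
    ultimately have "conj_part p j = k" by simp
    then have "column_label p j = x" using j by (simp add: column_label_def)
    then show False using nc j by auto
  qed
qed

lemma hook_eq:
  assumes p: "is_partition p" and b: "(i, j) \<in> boxes p"
  shows "int (hook p (i, j)) = row_label p i - column_label p j"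
proof -
  have "1 \<le> i" "1 \<le> j" "j \<le> part p i" using b by (auto simp: boxes_def)
  moreover from this have "i \<le> conj_part p j" using le_conj_part_iff[OF p] by simp
  ultimately show ?thesis by (simp add: hook_def row_label_def column_label_def)
qed

lemma in_boxes_iff:
  assumes p: "is_partition p"
  shows "(i, j) \<in> boxes p \<longleftrightarrow> 1 \<le> i \<and> 1 \<le> j \<and> column_label p j < row_label p i"
  using column_label_less_row_label_iff(1)[OF p, of i j] part_pos_iff[OF p, of i] by (auto simp: boxes_def)

lemma row_pos_iff:
  assumes "is_partition p" "1 \<le> i"
  shows "0 \<le> row_label p i \<longleftrightarrow> i \<le> durfee p"
  using le_durfee_iff[OF assms] by (simp add: row_label_def)

text \<open>On the Durfee square the defining condition negates the labels. Row d of the square, of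
  side d, extends past it, so column d + 1 has height exactly d; its label 0 is the one integer that
  negation cannot pair.\<close>

lemma doubled_distinct_column:
  assumes p: "p \<in> doubled_distinct"
  shows "\<And>i. 1 \<le> i \<Longrightarrow> i \<le> durfee p \<Longrightarrow> column_label p i = - row_label p i \<and> 0 < row_label p i"
    and "column_label p (Suc (durfee p)) = 0"
proof -
  have P: "is_partition p" using p by (simp add: doubled_distinct_def)
  show 1: "column_label p i = - row_label p i \<and> 0 < row_label p i" if i: "1 \<le> i" "i \<le> durfee p" for i
  proof -
    have "part p i = conj_part p i + 1" using p i by (simp add: doubled_distinct_def)
    moreover have "i \<le> conj_part p i" using le_durfee_iff[OF P i(1)] le_conj_part_iff[OF P i(1) i(1)] i by simp
    ultimately show ?thesis by (simp add: row_label_def column_label_def)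
  qed
  let ?d = "durfee p"
  have "\<not> Suc ?d \<le> conj_part p (Suc ?d)"
    using le_conj_part_iff[OF P, of "Suc ?d" "Suc ?d"] le_durfee_iff[OF P, of "Suc ?d"] by simp
  moreover have "?d \<le> conj_part p (Suc ?d)"
  proof (cases "?d = 0")
    case False
    then have "Suc ?d \<le> part p ?d" using 1[of ?d] by (simp add: row_label_def)
    then show ?thesis using le_conj_part_iff[OF P, of ?d "Suc ?d"] False by simp
  qed simp
  ultimately have "conj_part p (Suc ?d) = ?d" by simp
  then show "column_label p (Suc ?d) = 0" by (simp add: column_label_def)
qed

text \<open>Negation carries the labels of the first rows to those of the first columns; as row and
  column labels are complementary, this is a symmetry of the set of row labels alone.\<close>

lemma doubled_distinct_iff:
  assumes P: "is_partition p"
  shows "p \<in> doubled_distinct \<longleftrightarrow> 0 \<notin> row_labels p \<and> (\<forall>x>0. x \<in> row_labels p \<longleftrightarrow> - x \<notin> row_labels p)"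
proof
  assume p: "p \<in> doubled_distinct"
  note dd = doubled_distinct_column[OF p]
  have "0 \<notin> row_labels p" unfolding in_row_labels_iff[OF P] using dd(2) by (metis atLeast_iff image_eqI le_add1 not_not plus_1_eq_Suc)
  moreover have "x \<in> row_labels p \<longleftrightarrow> - x \<notin> row_labels p" if x: "x > 0" for x
  proof
    assume "x \<in> row_labels p"
    then obtain i where i: "x = row_label p i" "1 \<le> i" by (auto simp: row_labels_def)
    then have "- x = column_label p i" using dd(1) row_pos_iff[OF P i(2)] x by simp
    then show "- x \<notin> row_labels p" unfolding in_row_labels_iff[OF P] using i(2) by auto
  next
    assume "- x \<notin> row_labels p"
    then obtain j where j: "- x = column_label p j" "1 \<le> j" unfolding in_row_labels_iff[OF P] by auto
    have "j \<le> durfee p"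
    proof (rule ccontr)
      assume "\<not> j \<le> durfee p"
      then have "column_label p (Suc (durfee p)) \<le> column_label p j" by (intro column_le[OF P]) auto
      then show False using dd(2) j(1) x by simp
    qed
    then have "x = row_label p j" using dd(1)[of j] j by simp
    then show "x \<in> row_labels p" using j(2) by (auto simp: row_labels_def)
  qed
  ultimately show "0 \<notin> row_labels p \<and> (\<forall>x>0. x \<in> row_labels p \<longleftrightarrow> - x \<notin> row_labels p)" by blast
next
  assume sym: "0 \<notin> row_labels p \<and> (\<forall>x>0. x \<in> row_labels p \<longleftrightarrow> - x \<notin> row_labels p)"
  \<comment> \<open>Row labels decrease and column labels increase, so the i-th of each must match:
    smaller partners are already used up by induction, and larger ones give two opposite
    inequalities.\<close>
  have "column_label p i = - row_label p i" if "1 \<le> i" "i \<le> durfee p" for i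
    using that
  proof (induction i rule: less_induct)
    case (less i)
    have r: "row_label p i \<in> row_labels p" using less.prems by (simp add: row_labels_def)
    then have pos: "row_label p i > 0" using row_pos_iff[OF P less.prems(1)] less.prems(2) sym by (metis order_le_less)
    then have "- row_label p i \<notin> row_labels p" using sym r by blast
    then obtain j where j: "- row_label p i = column_label p j" "1 \<le> j" unfolding in_row_labels_iff[OF P] by auto
    have "i \<le> j"
    proof (rule ccontr)
      assume "\<not> i \<le> j"
      then have "column_label p j = - row_label p j" using less.IH[of j] j less.prems by simp
      then show False using j row_label_less[OF P j(2), of i] \<open>\<not> i \<le> j\<close> by simp
    qed
    then have le: "column_label p i \<le> - row_label p i" using column_le[OF P less.prems(1)] j by simp
    then have neg: "- column_label p i > 0" using pos by simp
    have "column_label p i \<notin> row_labels p" unfolding in_row_labels_iff[OF P] using less.prems(1) by auto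
    then have "- column_label p i \<in> row_labels p" using sym neg by (metis minus_minus)
    then obtain k where k: "- column_label p i = row_label p k" "1 \<le> k" by (auto simp: row_labels_def)
    have "i \<le> k"
    proof (rule ccontr)
      assume "\<not> i \<le> k"
      then have "column_label p k = - row_label p k" using less.IH[of k] k less.prems by simp
      then show False using k column_less[OF P k(2), of i] \<open>\<not> i \<le> k\<close> by simp
    qed
    then have "row_label p k \<le> row_label p i" by (rule row_le[OF P less.prems(1)])
    then show ?case using k le by simp
  qed
  then have "part p i = conj_part p i + 1" if "i \<in> {1..durfee p}" for i
    using that by (force simp: row_label_def column_label_def)
  then show "p \<in> doubled_distinct" using P by (simp add: doubled_distinct_def)
qed

section \<open>The bijection with finite sets of positive numbers\<close>

definition frobenius :: "nat list \<Rightarrow> nat set" where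
  "frobenius p = {m. m > 0 \<and> int m \<in> row_labels p}"

lemma maya_frobenius:
  assumes p: "p \<in> doubled_distinct"
  shows "maya (frobenius p) a \<longleftrightarrow> a \<in> row_labels p"
proof -
  have P: "is_partition p" using p by (simp add: doubled_distinct_def)
  have s: "0 \<notin> row_labels p" "x > 0 \<Longrightarrow> x \<in> row_labels p \<longleftrightarrow> - x \<notin> row_labels p" for x
    using doubled_distinct_iff[OF P] p by auto
  consider "a = 0" | "a > 0" | "a < 0" by linarith
  then show ?thesis
  proof cases
    case 3
    then show ?thesis using s(2)[of "- a"] by (simp add: maya_def frobenius_def)
  qed (use s(1) in \<open>simp_all add: maya_def frobenius_def\<close>)
qed

lemma frobenius_eq_image:
  assumes p: "p \<in> doubled_distinct"
  shows "frobenius p = (\<lambda>i. nat (row_label p i)) ` {1..durfee p}"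
proof -
  have P: "is_partition p" using p by (simp add: doubled_distinct_def)
  show ?thesis
  proof (intro equalityI subsetI)
    fix m assume "m \<in> frobenius p"
    then obtain i where i: "1 \<le> i" "int m = row_label p i" by (auto simp: frobenius_def row_labels_def)
    then have "i \<le> durfee p" using row_pos_iff[OF P i(1)] by simp
    moreover have "m = nat (row_label p i)" using i(2) by linarith
    ultimately show "m \<in> (\<lambda>i. nat (row_label p i)) ` {1..durfee p}" using i(1) by auto
  next
    fix m assume "m \<in> (\<lambda>i. nat (row_label p i)) ` {1..durfee p}"
    then obtain i where i: "1 \<le> i" "i \<le> durfee p" "m = nat (row_label p i)" by auto
    then show "m \<in> frobenius p"
      using doubled_distinct_column(1)[OF p i(1,2)] by (auto simp: frobenius_def row_labels_def)
  qed
qed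

lemma card_frobenius:
  assumes p: "p \<in> doubled_distinct"
  shows "card (frobenius p) = durfee p"
proof -
  have P: "is_partition p" using p by (simp add: doubled_distinct_def)
  have "inj_on (\<lambda>i. nat (row_label p i)) {1..durfee p}"
  proof (rule inj_onI)
    fix i k assume ik: "i \<in> {1..durfee p}" "k \<in> {1..durfee p}" "nat (row_label p i) = nat (row_label p k)"
    then have "row_label p i = row_label p k"
      using doubled_distinct_column(1)[OF p, of i] doubled_distinct_column(1)[OF p, of k] by auto
    then show "i = k" using row_eq_iff[OF P] ik by auto
  qed
  then show ?thesis unfolding frobenius_eq_image[OF p] by (simp add: card_image)
qed

lemma bij_betw_boxes_hooks:
  assumes p: "p \<in> doubled_distinct"
  shows "bij_betw (\<lambda>(i, j). (row_label p i, column_label p j)) (boxes_mod t p) (hooks t (frobenius p))"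
proof -
  have P: "is_partition p" using p by (simp add: doubled_distinct_def)
  have dvd: "t dvd hook p (i, j) \<longleftrightarrow> int t dvd row_label p i - column_label p j" if "(i, j) \<in> boxes p" for i j
    unfolding hook_eq[OF P that, symmetric] by (rule of_nat_dvd_iff[symmetric])
  show ?thesis
  proof (rule bij_betw_imageI)
    show "inj_on (\<lambda>(i, j). (row_label p i, column_label p j)) (boxes_mod t p)"
      by (auto simp: inj_on_def boxes_mod_def in_boxes_iff[OF P] row_eq_iff[OF P] column_eq_iff[OF P])
    show "(\<lambda>(i, j). (row_label p i, column_label p j)) ` boxes_mod t p = hooks t (frobenius p)"
    proof (intro equalityI subsetI)
      fix x assume "x \<in> (\<lambda>(i, j). (row_label p i, column_label p j)) ` boxes_mod t p"
      then obtain i j where x: "x = (row_label p i, column_label p j)" "(i, j) \<in> boxes p" "t dvd hook p (i, j)"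
        by (auto simp: boxes_mod_def)
      moreover from x(2) have "row_label p i \<in> row_labels p" "column_label p j \<notin> row_labels p"
        unfolding in_row_labels_iff[OF P, of "column_label p j"] using in_boxes_iff[OF P] by (auto simp: row_labels_def)
      ultimately show "x \<in> hooks t (frobenius p)"
        using dvd in_boxes_iff[OF P] by (simp add: hooks_def maya_frobenius[OF p])
    next
      fix x assume "x \<in> hooks t (frobenius p)"
      then obtain a b where x: "x = (a, b)" "a \<in> row_labels p" "b \<notin> row_labels p" "b < a" "int t dvd a - b"
        by (auto simp: hooks_def maya_frobenius[OF p])
      obtain i where i: "a = row_label p i" "1 \<le> i" using x(2) by (auto simp: row_labels_def)
      obtain j where j: "b = column_label p j" "1 \<le> j" using x(3) unfolding in_row_labels_iff[OF P] by auto
      have box: "(i, j) \<in> boxes p" using in_boxes_iff[OF P] i j x(4) by simp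
      then have "(i, j) \<in> boxes_mod t p" using dvd[OF box] x(5) i j by (simp add: boxes_mod_def)
      then show "x \<in> (\<lambda>(i, j). (row_label p i, column_label p j)) ` boxes_mod t p" using x(1) i j by force
    qed
  qed
qed

text \<open>For j within the Durfee square the column label is minus the row label of j, so the sum
  of labels compares the rows i and j. Later columns have nonnegative labels, and later rows have
  negative ones.\<close>

lemma hook_sign_eq:
  assumes p: "p \<in> doubled_distinct" and b: "(i, j) \<in> boxes p"
  shows "hook_sign (i, j) = (if row_label p i + column_label p j < 0 then - 1 else 1)"
proof -
  have P: "is_partition p" using p by (simp add: doubled_distinct_def)
  note dd = doubled_distinct_column[OF p]
  have ij: "1 \<le> i" "1 \<le> j" "j \<le> part p i" using b by (auto simp: boxes_def)
  have col: "0 \<le> column_label p j" if "durfee p < j"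
    using column_le[OF P, of "Suc (durfee p)" j] dd(2) that by simp
  have "j < i \<longleftrightarrow> row_label p i + column_label p j < 0"
  proof (cases "i \<le> durfee p")
    case True
    show ?thesis
    proof (cases "j \<le> durfee p")
      case True
      then have "row_label p i + column_label p j = row_label p i - row_label p j" using dd(1)[of j] ij by simp
      then show ?thesis
        using row_label_less[OF P ij(2), of i] row_le[OF P ij(1), of j] by (cases "j < i") auto
    next
      case False
      then show ?thesis using col dd(1)[of i] ij True by simp
    qed
  next
    case False
    then have "j < i" using le_durfee_iff[OF P ij(1)] ij(3) by simp
    have neg: "row_label p i < 0" using row_pos_iff[OF P ij(1)] False by simp
    have "column_label p j < row_label p i" using in_boxes_iff[OF P] b by simp
    then show ?thesis using \<open>j < i\<close> neg by simp
  qed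
  then show ?thesis by (simp add: hook_sign_def)
qed

lemma frobenius_finite: "p \<in> doubled_distinct \<Longrightarrow> finite (frobenius p)"
  by (simp add: frobenius_eq_image)

lemma zero_notin_frobenius: "0 \<notin> frobenius p"
  by (simp add: frobenius_def)

lemma prod_boxes_mod:
  assumes p: "p \<in> doubled_distinct" and t: "odd t"
  shows "(\<Prod>b\<in>boxes_mod t p. y - y * of_nat t * s / (of_int (hook_sign b) * of_nat (hook p b))) =
    y ^ card (hooks t (frobenius p)) * set_weight t s (frobenius p)"
proof -
  have P: "is_partition p" using p by (simp add: doubled_distinct_def)
  have "(\<Prod>b\<in>boxes_mod t p. y - y * of_nat t * s / (of_int (hook_sign b) * of_nat (hook p b))) =
      (\<Prod>b\<in>boxes_mod t p. y * hook_factor t s ((\<lambda>(i, j). (row_label p i, column_label p j)) b))"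
  proof (intro prod.cong refl)
    fix b assume "b \<in> boxes_mod t p"
    moreover obtain i j where ij: "b = (i, j)" by fastforce
    ultimately have b: "(i, j) \<in> boxes p" by (simp add: boxes_mod_def)
    have "(of_int (hook_sign b) * of_nat (hook p b) :: complex) = of_int (hook_sign b * int (hook p b))" by simp
    also have "hook_sign b * int (hook p b) =
        (if row_label p i + column_label p j < 0 then - 1 else 1) * (row_label p i - column_label p j)"
      unfolding ij hook_sign_eq[OF p b] hook_eq[OF P b] ..
    finally have "(of_int (hook_sign b) * of_nat (hook p b) :: complex) =
        of_int ((if row_label p i + column_label p j < 0 then - 1 else 1) * (row_label p i - column_label p j))" .
    then show "y - y * of_nat t * s / (of_int (hook_sign b) * of_nat (hook p b)) =
        y * hook_factor t s ((\<lambda>(i, j). (row_label p i, column_label p j)) b)"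
      unfolding ij hook_factor_def prod.case by (simp only: right_diff_distrib mult_1_right times_divide_eq_right mult.assoc)
  qed
  also have "\<dots> = (\<Prod>x\<in>hooks t (frobenius p). y * hook_factor t s x)"
    by (rule prod.reindex_bij_betw[OF bij_betw_boxes_hooks[OF p]])
  also have "\<dots> = y ^ card (hooks t (frobenius p)) * set_weight t s (frobenius p)"
    unfolding prod.distrib prod_constant
      prod_hook_factor[OF frobenius_finite[OF p] zero_notin_frobenius t] ..
  finally show ?thesis .
qed

lemma card_boxes: "card (boxes p) = weight p"
proof -
  have "boxes p = (SIGMA i:{1..length p}. {1..part p i})" by (auto simp: boxes_def)
  then have "card (boxes p) = (\<Sum>i\<in>{1..length p}. part p i)" by simp
  also have "\<dots> = (\<Sum>i<length p. p ! i)"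
    by (rule sum.reindex_bij_witness[of _ Suc "\<lambda>i. i - 1"]) (auto simp: part_def)
  also have "\<dots> = weight p" by (simp add: sum_list_sum_nth atLeast0LessThan)
  finally show ?thesis .
qed

text \<open>The hook count for t = 1: every box counts, and every set is balanced because no r
  satisfies 0 < 2 r < 1.\<close>

lemma weight_frobenius:
  assumes p: "p \<in> doubled_distinct"
  shows "weight p = 2 * \<Sum>(frobenius p)"
proof -
  have "weight p = card (boxes_mod 1 p)" by (simp add: card_boxes[symmetric] boxes_mod_def)
  also have "\<dots> = card (hooks 1 (frobenius p))" by (rule bij_betw_same_card[OF bij_betw_boxes_hooks[OF p]])
  also have "\<dots> = 2 * \<Sum>(frobenius p)"
    using card_hooks_balanced[of 1 "frobenius p"] frobenius_finite[OF p] zero_notin_frobenius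
    by (simp add: balanced_def)
  finally show ?thesis .
qed

lemma partition_eqI:
  assumes p: "is_partition p" and q: "is_partition q" and eq: "\<And>i. 1 \<le> i \<Longrightarrow> part p i = part q i"
  shows "p = q"
proof (rule nth_equalityI)
  have "i \<le> length p \<longleftrightarrow> i \<le> length q" if "1 \<le> i" for i
    using part_pos_iff[OF p that] part_pos_iff[OF q that] eq[OF that] by simp
  from this[of "length p"] this[of "length q"] show l: "length p = length q"
    by (cases "length p"; cases "length q") auto
  show "p ! i = q ! i" if "i < length p" for i
    using eq[of "Suc i"] that l by (simp add: part_def)
qed

text \<open>Row labels decrease strictly, so the set of labels determines their sequence; the
  induction compares the i-th largest elements.\<close>

lemma row_labels_inject:
  assumes p: "is_partition p" and q: "is_partition q" and eq: "row_labels p = row_labels q"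
  shows "p = q"
proof -
  have *: "row_label p i \<le> row_label q i" if "1 \<le> i" "is_partition p" "is_partition q" "row_labels p = row_labels q"
    "\<And>k. 1 \<le> k \<Longrightarrow> k < i \<Longrightarrow> row_label p k = row_label q k" for i p q
  proof -
    have "row_label p i \<in> row_labels q" using that(1,4) by (auto simp: row_labels_def)
    then obtain k where k: "row_label p i = row_label q k" "1 \<le> k" by (auto simp: row_labels_def)
    have "i \<le> k"
    proof (rule ccontr)
      assume "\<not> i \<le> k"
      then show False using that(5)[of k] k row_label_less[OF that(2), of k i] by simp
    qed
    then show ?thesis using row_le[OF that(3) that(1)] k by simp
  qed
  have "row_label p i = row_label q i" if "1 \<le> i" for i
    using that
  proof (induction i rule: less_induct)
    case (less i)
    have "row_label p i \<le> row_label q i" using less by (intro *[OF less.prems p q eq]) auto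
    moreover have "row_label q i \<le> row_label p i" using less by (intro *[OF less.prems q p eq[symmetric]]) auto
    ultimately show ?case by simp
  qed
  then have "part p i = part q i" if "1 \<le> i" for i using that by (force simp: row_label_def)
  then show ?thesis by (rule partition_eqI[OF p q])
qed

lemma partition_of_antimono:
  fixes f :: "nat \<Rightarrow> nat"
  assumes anti: "antimono f" and ev: "f N = 0"
  obtains p where "is_partition p" "\<And>i. part p (Suc i) = f i"
proof
  define k where "k = (LEAST k. f k = 0)"
  have k: "f k = 0" unfolding k_def using ev by (rule LeastI)
  have pos: "f i > 0" if "i < k" for i
    using not_less_Least[of i "\<lambda>k. f k = 0"] that unfolding k_def by simp
  have zero: "f i = 0" if "k \<le> i" for i using antimonoD[OF anti that] k by simp
  show "is_partition (map f [0..<k])"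
    using pos antimonoD[OF anti] by (auto simp: is_partition_def sorted_wrt_iff_nth_less)
  show "part (map f [0..<k]) (Suc i) = f i" for i
    using zero by (auto simp: part_def)
qed

lemma enumerate_card_less:
  fixes S :: "nat set"
  assumes S: "infinite S" and s: "s \<in> S"
  shows "enumerate S (card {x \<in> S. x < s}) = s"
proof -
  obtain n where n: "s = enumerate S n" using enumerate_Ex[OF S s] by metis
  have "{x \<in> S. x < s} = enumerate S ` {..<n}"
  proof (intro equalityI subsetI)
    fix x assume x: "x \<in> {x \<in> S. x < s}"
    then have "x \<in> S" by simp
    then obtain k where k: "x = enumerate S k" using enumerate_Ex[OF S] by metis
    then have "k < n" using x n enumerate_mono_iff[OF S] by simp
    then show "x \<in> enumerate S ` {..<n}" using k by simp
  next
    fix x assume "x \<in> enumerate S ` {..<n}"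
    then obtain k where "x = enumerate S k" "k < n" by auto
    then show "x \<in> {x \<in> S. x < s}" using n enumerate_in_set[OF S, of k] enumerate_mono[OF _ S, of k n] by simp
  qed
  moreover have "inj_on (enumerate S) {..<n}"
    using strict_mono_enumerate[OF S] strict_mono_imp_inj_on by blast
  ultimately show ?thesis using n by (simp add: card_image)
qed

text \<open>Row labels are obtained by listing the Maya set in decreasing order, here as the
  increasing enumeration of S under n = L - a. For 1 <= m <= L exactly one of m and -m is present,
  so L elements are at least -L; after them the labels are consecutive and the parts are 0.\<close>

lemma frobenius_surj:
  assumes M: "finite M" "0 \<notin> M"
  obtains p where "p \<in> doubled_distinct" "frobenius p = M"
proof -
  define L where "L = \<Sum>M"
  have le: "m \<le> L" if "m \<in> M" for m unfolding L_def using member_le_sum[of m M "\<lambda>x. x"] that M(1) by simp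
  define S where "S = {n. maya M (int L - int n)}"
  have big: "n \<in> S" if "2 * L < n" for n
  proof -
    have "nat (- (int L - int n)) \<notin> M" using le that by force
    then show ?thesis using that by (simp add: S_def maya_def)
  qed
  then have "{2 * L<..} \<subseteq> S" by auto
  then have inf: "infinite S" using infinite_Ioi infinite_super by blast
  have bij: "card {n \<in> S. n \<le> 2 * L} = L"
  proof -
    have "bij_betw (\<lambda>n. nat \<bar>int L - int n\<bar>) {n \<in> S. n \<le> 2 * L} {1..L}"
    proof (rule bij_betw_byWitness[where f' = "\<lambda>m. if m \<in> M then L - m else L + m"])
      show "\<forall>n\<in>{n \<in> S. n \<le> 2 * L}. (if nat \<bar>int L - int n\<bar> \<in> M then L - nat \<bar>int L - int n\<bar> else L + nat \<bar>int L - int n\<bar>) = n"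
      proof
        fix n assume n: "n \<in> {n \<in> S. n \<le> 2 * L}"
        then have m: "maya M (int L - int n)" by (simp add: S_def)
        consider "n < L" | "L < n" | "n = L" by linarith
        then show "(if nat \<bar>int L - int n\<bar> \<in> M then L - nat \<bar>int L - int n\<bar> else L + nat \<bar>int L - int n\<bar>) = n"
        proof cases
          case 1
          then have "nat \<bar>int L - int n\<bar> = L - n" "nat (int L - int n) = L - n" by linarith+
          then show ?thesis using m 1 by (simp add: maya_def)
        next
          case 2
          then have "nat \<bar>int L - int n\<bar> = n - L" "nat (- (int L - int n)) = n - L" by linarith+
          then show ?thesis using m 2 by (simp add: maya_def)
        next
          case 3
          then show ?thesis using m by simp
        qed
      qed
      show "\<forall>m\<in>{1..L}. nat \<bar>int L - int (if m \<in> M then L - m else L + m)\<bar> = m" by auto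
      show "(\<lambda>n. nat \<bar>int L - int n\<bar>) ` {n \<in> S. n \<le> 2 * L} \<subseteq> {1..L}"
      proof (rule image_subsetI)
        fix n assume n: "n \<in> {n \<in> S. n \<le> 2 * L}"
        then have "maya M (int L - int n)" by (simp add: S_def)
        then have "int L - int n \<noteq> 0" by auto
        then show "nat \<bar>int L - int n\<bar> \<in> {1..L}" using n by auto
      qed
      show "(\<lambda>m. if m \<in> M then L - m else L + m) ` {1..L} \<subseteq> {n \<in> S. n \<le> 2 * L}"
      proof (rule image_subsetI)
        fix m assume m: "m \<in> {1..L}"
        then have "int L - int (if m \<in> M then L - m else L + m) = (if m \<in> M then int m else - int m)" by auto
        then show "(if m \<in> M then L - m else L + m) \<in> {n \<in> S. n \<le> 2 * L}"
          using m by (auto simp: S_def maya_int maya_neg_int)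
      qed
    qed
    from bij_betw_same_card[OF this] show ?thesis by simp
  qed
  have tail: "enumerate S L = 2 * L + 1"
  proof -
    have "{x \<in> S. x < 2 * L + 1} = {n \<in> S. n \<le> 2 * L}" by auto
    then show ?thesis using enumerate_card_less[OF inf big[of "2 * L + 1"]] bij by simp
  qed
  have step: "enumerate S n < enumerate S (Suc n)" for n by (rule enumerate_step[OF inf])
  have tail': "enumerate S (L + r) = 2 * L + 1 + r" for r
  proof (induction r)
    case (Suc r)
    have "card {x \<in> S. x < 2 * L + 1 + Suc r} = card ({n \<in> S. n \<le> 2 * L} \<union> {2 * L + 1..2 * L + 1 + r})"
      using big by (intro arg_cong[where f = card]) auto
    also have "\<dots> = L + Suc r" using bij by (subst card_Un_disjoint) auto
    finally show ?case using enumerate_card_less[OF inf big[of "2 * L + 1 + Suc r"]] by simp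
  qed (simp add: tail)
  \<comment> \<open>The part is found from \<lambda> - (n + 1) = L - \<open>enumerate S n\<close>;
    by \<open>bound\<close> the subtraction does not truncate.\<close>
  define f where "f n = n + L + 1 - enumerate S n" for n
  have bound: "enumerate S n \<le> n + L + 1" for n
  proof (cases "n \<le> L")
    case True
    have "enumerate S n + r \<le> enumerate S (n + r)" for r
    proof (induction r)
      case (Suc r)
      then show ?case using step[of "n + r"] by simp
    qed simp
    from this[of "L - n"] show ?thesis using True tail by simp
  next
    case False
    then obtain r where "n = L + r" by (metis le_add_diff_inverse nat_le_linear)
    then show ?thesis using tail'[of r] by simp
  qed
  have "antimono f"
  proof (rule antimono_iff_le_Suc[THEN iffD2], intro allI)
    show "f (Suc n) \<le> f n" for n using step[of n] unfolding f_def by linarith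
  qed
  moreover have "f L = 0" by (simp add: f_def tail)
  ultimately obtain p where p: "is_partition p" "\<And>i. part p (Suc i) = f i"
    by (rule partition_of_antimono) blast
  have row_label: "row_label p (Suc n) = int L - int (enumerate S n)" for n
    using bound[of n] by (simp add: row_label_def p(2) f_def of_nat_diff)
  have row_labels: "a \<in> row_labels p \<longleftrightarrow> maya M a" for a
  proof
    assume "a \<in> row_labels p"
    then obtain i where i: "a = row_label p i" "1 \<le> i" by (auto simp: row_labels_def)
    then obtain n where "i = Suc n" by (cases i) auto
    then show "maya M a" using i(1) row_label[of n] enumerate_in_set[OF inf, of n] by (simp add: S_def)
  next
    assume a: "maya M a"
    have "a \<le> int L"
    proof (cases "a > 0")
      case True
      then have "nat a \<in> M" using a by (simp add: maya_def)
      then show ?thesis using le by force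
    qed simp
    then have "nat (int L - a) \<in> S" using a by (simp add: S_def)
    then obtain n where "enumerate S n = nat (int L - a)" using enumerate_Ex[OF inf] by metis
    then have "row_label p (Suc n) = a" using row_label[of n] \<open>a \<le> int L\<close> by simp
    then show "a \<in> row_labels p" by (force simp: row_labels_def)
  qed
  have "p \<in> doubled_distinct"
    unfolding doubled_distinct_iff[OF p(1)] row_labels using maya_uminus[of _ M] by auto
  moreover have "frobenius p = M" unfolding frobenius_def row_labels
    using M(2) maya_int[of _ M] by (metis (no_types, lifting) Collect_cong Collect_mem_eq not_gr0)
  ultimately show ?thesis by (rule that)
qed

lemma bij_betw_frobenius:
  "bij_betw frobenius {p \<in> doubled_distinct. weight p = 2 * n} (sum_sets n)"
proof (rule bij_betw_imageI)
  show "inj_on frobenius {p \<in> doubled_distinct. weight p = 2 * n}"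
  proof (rule inj_onI)
    fix p q assume p: "p \<in> {p \<in> doubled_distinct. weight p = 2 * n}" and q: "q \<in> {p \<in> doubled_distinct. weight p = 2 * n}"
      and eq: "frobenius p = frobenius q"
    have "row_labels p = row_labels q" using maya_frobenius[of p] maya_frobenius[of q] p q eq by auto
    then show "p = q" using row_labels_inject[of p q] p q by (simp add: doubled_distinct_def)
  qed
  show "frobenius ` {p \<in> doubled_distinct. weight p = 2 * n} = sum_sets n"
  proof (intro equalityI subsetI)
    fix M assume "M \<in> frobenius ` {p \<in> doubled_distinct. weight p = 2 * n}"
    then show "M \<in> sum_sets n"
      using weight_frobenius frobenius_finite zero_notin_frobenius by (auto simp: sum_sets_def)
  next
    fix M assume M: "M \<in> sum_sets n"
    then have M': "finite M" "0 \<notin> M" by (simp_all add: sum_sets_def)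
    obtain p where p: "p \<in> doubled_distinct" "frobenius p = M" using frobenius_surj[OF M'] .
    then have "weight p = 2 * n" using weight_frobenius[OF p(1)] M by (simp add: sum_sets_def)
    then show "M \<in> frobenius ` {p \<in> doubled_distinct. weight p = 2 * n}" using p by blast
  qed
qed

lemma sum_doubled_distinct:
  assumes t: "odd t"
  shows "(\<Sum>p | p \<in> doubled_distinct \<and> weight p = 2 * n. (-1) ^ durfee p *
      (\<Prod>b\<in>boxes_mod t p. y - y * of_nat t * s / (of_int (hook_sign b) * of_nat (hook p b)))) =
    hook_series t y s $ n"
proof -
  have "(\<Sum>p | p \<in> doubled_distinct \<and> weight p = 2 * n. (-1) ^ durfee p *
      (\<Prod>b\<in>boxes_mod t p. y - y * of_nat t * s / (of_int (hook_sign b) * of_nat (hook p b)))) =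
    (\<Sum>p | p \<in> doubled_distinct \<and> weight p = 2 * n. (-1) ^ card (frobenius p) *
      y ^ card (hooks t (frobenius p)) * set_weight t s (frobenius p))"
    by (intro sum.cong refl) (simp add: prod_boxes_mod[OF _ t] card_frobenius)
  also have "\<dots> = (\<Sum>M\<in>sum_sets n. (-1) ^ card M * y ^ card (hooks t M) * set_weight t s M)"
    by (rule sum.reindex_bij_betw[OF bij_betw_frobenius])
  finally show ?thesis by (simp add: hook_series_def)
qed

theorem theorem1p2:
  fixes t t' :: nat and y z :: complex
  assumes "t = 2 * t' + 1"
  shows "(\<lambda>k. (1 - fps_X ^ Suc k)
              * fps_one_minus_cpow (fps_X ^ (Suc k * t)) (of_nat t' - 1)
              * fps_one_minus_cpow (fps_const (y ^ (2 * Suc k)) * fps_X ^ (Suc k * t))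
                  ((2 * z + 1) * (z * of_nat t + 3 * (of_nat t - 1) / 2)))
         has_prod
         Abs_fps (\<lambda>n. \<Sum>p | p \<in> doubled_distinct \<and> weight p = 2 * n.
           (-1) ^ durfee p *
           (\<Prod>b\<in>boxes_mod t p.
              y - y * of_nat t * (2 * z + 2) / (of_int (hook_sign b) * of_nat (hook p b))))"
    (is "?f has_prod ?S")
proof -
  have t: "odd t" "t > 0" using assms by simp_all
  let ?s = "2 * z + 2"
  have S: "?S = hook_series t y ?s"
    by (rule fps_ext) (simp only: fps_nth_Abs_fps sum_doubled_distinct[OF t(1)])
  have e1: "of_nat t' - 1 = (of_nat t - 3) / (2 :: complex)" by (simp add: assms)
  \<comment> \<open>In terms of s = 2 z + 2 the exponent is (s - 1) (t s + t - 3) / 2, the value of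
    (t s^2 - 3 s) / 2 minus its value at s = 1.\<close>
  have e2: "(2 * z + 1) * (z * of_nat t + 3 * (of_nat t - 1) / 2) =
      (of_nat t * ?s\<^sup>2 - 3 * ?s - of_nat t + 3) / 2"
    by (simp add: power2_eq_square field_simps)
  let ?g = "\<lambda>j. (1 - fps_X ^ j) * fps_one_minus_cpow (fps_X ^ (t * j)) ((of_nat t - 3) / 2) *
    fps_one_minus_cpow (fps_const (y ^ (2 * j)) * fps_X ^ (t * j)) ((of_nat t * ?s\<^sup>2 - 3 * ?s - of_nat t + 3) / 2)"
  have f: "?f = (\<lambda>k. ?g (Suc k))" unfolding e1 e2 by (simp only: mult.commute[of t])
  have part: "prod ?f {..n} = prod ?g {1..Suc n}" for n
    unfolding f by (rule prod.reindex_bij_witness[of _ "\<lambda>j. j - 1" Suc]) auto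
  have nth: "prod ?f {..n} $ i = ?S $ i" if "i \<le> n" for n i
    using hook_series_cong[OF t(1), of "Suc n" y ?s] that
    unfolding S part fcong_iff by simp
  have "(\<lambda>n. prod ?f {..n}) \<longlonglongrightarrow> ?S"
  proof (rule tendsto_fpsI)
    fix i
    show "\<forall>\<^sub>F n in sequentially. prod ?f {..n} $ i = ?S $ i"
      using eventually_ge_at_top[of i] by eventually_elim (rule nth)
  qed
  \<comment> \<open>\<open>raw_has_prod\<close> asks for a nonzero limit; every factor has constant
    coefficient 1.\<close>
  moreover have "?S \<noteq> 0"
  proof
    assume "?S = 0"
    then have "prod ?f {..0} $ 0 = 0" using nth[of 0 0] by simp
    then show False using t(2) by (simp add: fps_one_minus_cpow_nth_0)
  qed
  ultimately show ?thesis by (simp add: has_prod_def raw_has_prod_def)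
qed

end
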